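(* Let $(c_j)_{j\in\mathbb N}$ be a sequence of non-zero real numbers with $\sum_{j}|c_j|<\infty$ and let $(\tau_j)_{j\in\mathbb N}$ be a bounded sequence of distinct real numbers. Let $\phi(s)=\sum_{n\ge1}a(n)\lambda_n^{-s}$ be a Dirichlet series belonging to the class $\mathcal A$ with parameter $r>0$ and dual series $\psi(s)=\sum_{n\ge1}b(n)\mu_n^{-s}$ (see context). Suppose that $b(n)=\overline{a(n)}$ and $\lambda_n=\mu_n$ for all $n$, and that the abscissa of absolute convergence $\sigma_a$ of $\phi$ satisfies $\sigma_a<\min\{1,r\}+\frac12\max\{1,r\}$. If one of the following conditions holds: 1. the function $\Theta(z;a;\lambda)=\sum_{n=1}^\infty a(n)e^{-\lambda_nz}$ ($\mathrm{Re}(z)>0$) satisfies $\Theta\left(e^{i\left(\frac\pi2-\epsilon\right)};a;\lambda\right)=o\left(\epsilon^{-\frac{r+1}2}\right)$ as $\epsilon\to0^+$; 2. $\sigma_a<\frac{r+1}2$; then the function $$F_\phi(s):=\sum_{j=1}^\infty c_j\,\Gamma(s+i\tau_j)\,\phi(s+i\tau_j)$$ has infinitely many zeros on the critical line $\mathrm{Re}(s)=\frac r2$.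
   Context: Hecke pair with parameter $r>0$: $(\lambda_n)_{n\ge1}$, $(\mu_n)_{n\ge1}$ are sequences of positive numbers strictly increasing to $\infty$; $(a(n))_{n\ge1}$, $(b(n))_{n\ge1}$ are complex sequences, not identically zero; $\phi(s)=\sum_{n\ge1}a(n)\lambda_n^{-s}$ and $\psi(s)=\sum_{n\ge1}b(n)\mu_n^{-s}$ have finite abscissas of absolute convergence $\sigma_a$, $\sigma_b$; and there is a meromorphic function $\chi$ on $\mathbb C$ such that (1) $\chi(s)=\Gamma(s)\phi(s)$ for $\mathrm{Re}(s)>\sigma_a$ and $\chi(s)=\Gamma(r-s)\psi(r-s)$ for $\mathrm{Re}(s)<r-\sigma_b$; (2) $\lim_{|\mathrm{Im}(s)|\to\infty}\chi(s)=0$ uniformly in every strip $\sigma_1\le\mathrm{Re}(s)\le\sigma_2$; (3) the singularities of $\chi$ are at most poles and are confined to some compact set. Class $\mathcal A$: $\phi$ belongs to $\mathcal A$ (with parameter $r$ and dual series $\psi$) if $(\phi,\psi)$ is a Hecke pair with parameter $r$; $\phi$ and $\psi$ have analytic continuations to $\mathbb C$, analytic except for possible simple poles at $s=r$; and the coefficients are extended to $n=0$ by $a(0):=-\phi(0)$, $b(0):=-\psi(0)$. *)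

theory Defs
  imports "HOL-Complex_Analysis.Complex_Analysis" "HOL-Library.Landau_Symbols"
begin

text \<open>
  All sequences are indexed by \<open>n \<ge> 1\<close>, so every series is written with \<open>Suc n\<close>.
  The value of a coefficient sequence at \<open>0\<close> is constrained only by \<open>class_A\<close> below; the
  values at \<open>0\<close> of the exponents \<open>\<lambda>\<close> and of \<open>c\<close>, \<open>\<tau>\<close> are never used.
\<close>

definition gen_dirichlet :: "(nat \<Rightarrow> complex) \<Rightarrow> (nat \<Rightarrow> real) \<Rightarrow> complex \<Rightarrow> complex" where
  "gen_dirichlet a l s = (\<Sum>n. a (Suc n) * of_real (l (Suc n)) powr (- s))"

text \<open>The value is \<open>\<infinity>\<close> or \<open>-\<infinity>\<close> if the series converges absolutely nowhere or everywhere.\<close>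

definition abs_conv_abscissa :: "(nat \<Rightarrow> complex) \<Rightarrow> (nat \<Rightarrow> real) \<Rightarrow> ereal" where
  "abs_conv_abscissa a l =
     Inf {ereal (Re s) | s. summable (\<lambda>n. norm (a (Suc n) * of_real (l (Suc n)) powr (- s)))}"

definition exponent_seq :: "(nat \<Rightarrow> real) \<Rightarrow> bool" where
  "exponent_seq l \<longleftrightarrow>
     (\<forall>n\<ge>1. 0 < l n) \<and> strict_mono_on {1..} l \<and> filterlim l at_top sequentially"

text \<open>
  \<open>Gamma\<close> takes the value \<open>0\<close> at its poles, so the identities between \<open>X\<close> and the
  completed series, which are identities of meromorphic functions, are required only where the
  Gamma factor is finite. \<open>meromorphic_on\<close> says that the singularities of \<open>X\<close> are at most
  poles.
\<close>

definition hecke_pair ::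
  "real \<Rightarrow> (nat \<Rightarrow> complex) \<Rightarrow> (nat \<Rightarrow> real) \<Rightarrow> (nat \<Rightarrow> complex) \<Rightarrow> (nat \<Rightarrow> real) \<Rightarrow> bool" where
  "hecke_pair r a l b m \<longleftrightarrow>
     0 < r \<and> exponent_seq l \<and> exponent_seq m \<and>
     (\<exists>n\<ge>1. a n \<noteq> 0) \<and> (\<exists>n\<ge>1. b n \<noteq> 0) \<and>
     \<bar>abs_conv_abscissa a l\<bar> \<noteq> \<infinity> \<and> \<bar>abs_conv_abscissa b m\<bar> \<noteq> \<infinity> \<and>
     (\<exists>X. X meromorphic_on UNIV \<and>
        (\<forall>s. ereal (Re s) > abs_conv_abscissa a l \<longrightarrow> s \<notin> \<int>\<^sub>\<le>\<^sub>0 \<longrightarrow>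
           X s = Gamma s * gen_dirichlet a l s) \<and>
        (\<forall>s. ereal (Re s) < ereal r - abs_conv_abscissa b m \<longrightarrow> of_real r - s \<notin> \<int>\<^sub>\<le>\<^sub>0 \<longrightarrow>
           X s = Gamma (of_real r - s) * gen_dirichlet b m (of_real r - s)) \<and>
        (\<forall>\<sigma>1 \<sigma>2. \<forall>\<epsilon>>0. \<exists>T. \<forall>s. \<sigma>1 \<le> Re s \<longrightarrow> Re s \<le> \<sigma>2 \<longrightarrow> T \<le> \<bar>Im s\<bar> \<longrightarrow>
           norm (X s) < \<epsilon>) \<and>
        (\<exists>K. compact K \<and> X analytic_on (- K)))"

definition is_continuation ::
  "real \<Rightarrow> (nat \<Rightarrow> complex) \<Rightarrow> (nat \<Rightarrow> real) \<Rightarrow> (complex \<Rightarrow> complex) \<Rightarrow> bool" where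
  "is_continuation r a l \<phi> \<longleftrightarrow>
     (\<forall>s. ereal (Re s) > abs_conv_abscissa a l \<longrightarrow> \<phi> s = gen_dirichlet a l s) \<and>
     \<phi> analytic_on (UNIV - {of_real r}) \<and>
     (\<phi> analytic_on {of_real r} \<or>
      is_pole \<phi> (of_real r) \<and> zorder \<phi> (of_real r) = -1)"

text \<open>
  \<open>\<phi>\<close> and \<open>\<psi>\<close> are the continued functions; they are determined by the coefficients and
  exponents, except for their irrelevant value at \<open>r\<close> in case of a pole there.
\<close>

definition class_A ::
  "real \<Rightarrow> (nat \<Rightarrow> complex) \<Rightarrow> (nat \<Rightarrow> real) \<Rightarrow> (complex \<Rightarrow> complex) \<Rightarrow>
   (nat \<Rightarrow> complex) \<Rightarrow> (nat \<Rightarrow> real) \<Rightarrow> (complex \<Rightarrow> complex) \<Rightarrow> bool" where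
  "class_A r a l \<phi> b m \<psi> \<longleftrightarrow>
     hecke_pair r a l b m \<and> is_continuation r a l \<phi> \<and> is_continuation r b m \<psi> \<and>
     a 0 = - \<phi> 0 \<and> b 0 = - \<psi> 0"

definition Theta :: "(nat \<Rightarrow> complex) \<Rightarrow> (nat \<Rightarrow> real) \<Rightarrow> complex \<Rightarrow> complex" where
  "Theta a l z = (\<Sum>n. a (Suc n) * exp (- (of_real (l (Suc n)) * z)))"

text \<open>
  On the line \<open>Re s = r / 2\<close> no term meets a pole of \<open>Gamma\<close> or of the continued series
  \<open>\<phi>\<close>, and the sum converges absolutely whenever \<open>\<phi>\<close> is in the class above, \<open>c\<close> is
  absolutely summable and \<open>\<tau>\<close> is real.
\<close>

definition F_shift ::
  "(nat \<Rightarrow> real) \<Rightarrow> (nat \<Rightarrow> real) \<Rightarrow> (complex \<Rightarrow> complex) \<Rightarrow> complex \<Rightarrow> complex" where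
  "F_shift c \<tau> \<phi> s =
     (\<Sum>j. of_real (c (Suc j)) * Gamma (s + \<i> * of_real (\<tau> (Suc j)))
            * \<phi> (s + \<i> * of_real (\<tau> (Suc j))))"

end

theory Submission
  imports Defs
begin

text \<open>
  On the line \<open>Re s = r / 2\<close> the functional equation and \<open>b n = cnj (a n)\<close> make
  \<open>Gamma s * \<phi> s\<close> real, hence \<open>G t = F_shift c \<tau> \<phi> (r / 2 + \<i> t)\<close> is real. If
  \<open>G\<close> had finitely many zeros, it would have constant sign for large \<open>t\<close>, so
  \<open>\<integral> \<bar>G t\<bar> exp (\<theta> t) dt\<close> would be at most \<open>\<bar>\<integral> G t exp (\<theta> t) dt\<bar> + O(1)\<close>. For
  \<open>\<theta> = pi / 2 - \<epsilon>\<close> Mellin inversion turns the last integral into values of \<open>Theta\<close> at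
  \<open>exp (\<i> \<theta>)\<close>, so it is \<open>o (\<epsilon> powr (- (r + 1) / 2))\<close>.

  For the opposite bound, let \<open>h\<close> be the Mellin transform of \<open>exp (- \<nu> exp (- \<i> \<theta>) y)\<close>, with
  \<open>\<nu> = lam n\<close> for some \<open>n\<close> with \<open>a n \<noteq> 0\<close>, taken on the line of abscissa \<open>N + 1 / 2\<close>. Then
  \<open>h\<close> is \<open>O (\<epsilon> powr (- N))\<close> uniformly in \<open>t\<close>, whereas in
  \<open>\<integral> G t exp (\<theta> t) h t dt\<close> the \<open>n\<close>-th term of the Dirichlet series is singular as
  \<open>\<epsilon>\<close> tends to \<open>0\<close> and all other terms stay bounded. Comparing the two bounds shows that
  \<open>\<Sum>j. c j * Gamma (q j) * exp (- pi \<tau> j / 2) * exp (\<i> \<tau> j u)\<close>, with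
  \<open>q j = N + (r + 1) / 2 + \<i> \<tau> j\<close>, tends to \<open>0\<close> as \<open>u\<close> tends to infinity. This is
  impossible for an almost periodic function with a non-zero coefficient.
\<close>

section \<open>Shifting vertical lines\<close>

text \<open>The absolute value blocks a direct evaluation of the integral of
  \<open>norm (G t) * exp (\<theta> * t)\<close>, so a lower bound has to come from duality: the
  integral is at least a pairing of \<open>G\<close> with a bounded function divided by the sup norm
  of that function. The test function is shaped so that the pairing can be computed and exactly one
  term resonates. Pairing turns the term with exponent \<open>l n\<close> into a power of a number
  \<open>W n\<close> with real part \<open>(l n + \<nu>) * cos \<theta>\<close> and imaginary part
  \<open>(l n - \<nu>) * sin \<theta>\<close>; as \<theta> tends to pi / 2 this number tends to 0
  only if \<open>l n = \<nu>\<close>. The powers of \<epsilon> then match without slack. The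
  resonant term has order -(N + (r + 1) / 2), where N + 1/2 comes from the test function and r / 2
  from the critical line. The test function costs order -N. What is left is the order -(r + 1) / 2
  of the growth condition on \<open>Theta\<close>, and N itself is free to be large enough for
  absolute convergence. Positive quantities are handled through their logarithms throughout, so
  complex powers have no branches and scalings become translations of the real line.\<close>

lemma integrable_exp_neg_abs:
  assumes "0 < (\<eta>::real)"
  shows "integrable lborel (\<lambda>t::real. exp (- \<eta> * \<bar>t\<bar>))"
proof -
  have pos: "set_integrable lborel {0..} (\<lambda>t. exp (- \<eta> * \<bar>t\<bar>))"
  proof -
    have "(\<lambda>t. exp (- \<eta> * t)) absolutely_integrable_on {0..}"
      using has_integral_exp_minus_to_infinity[OF assms, of 0]
      by (intro nonnegative_absolutely_integrable_1) (auto simp: has_integral_integrable)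
    hence "(\<lambda>t. exp (- \<eta> * \<bar>t\<bar>)) absolutely_integrable_on {0..}"
      by (rule set_integrable_cong[THEN iffD1, rotated -1]) auto
    thus ?thesis
      unfolding set_integrable_def by (subst (asm) integrable_completion) auto
  qed
  have neg: "set_integrable lborel {..0} (\<lambda>t. exp (- \<eta> * \<bar>t\<bar>))"
  proof -
    have "integrable lborel (\<lambda>x. indicator {0..} (0 + (-1) * x) *\<^sub>R exp (- \<eta> * \<bar>0 + (-1) * x\<bar>))"
      using pos unfolding set_integrable_def
      by (intro lborel_integrable_real_affine) auto
    also have "(\<lambda>x::real. indicator {0..} (0 + (-1) * x) *\<^sub>R exp (- \<eta> * \<bar>0 + (-1) * x\<bar>)) =
               (\<lambda>x. indicator {..0} x *\<^sub>R exp (- \<eta> * \<bar>x\<bar>))"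
      by (auto simp: indicator_def)
    finally show ?thesis unfolding set_integrable_def .
  qed
  have "set_integrable lborel ({0..} \<union> {..0}) (\<lambda>t. exp (- \<eta> * \<bar>t\<bar>))"
    using pos neg by (rule set_integrable_Un) auto
  moreover have "{0..} \<union> {..0::real} = UNIV" by auto
  ultimately show ?thesis by (simp add: set_integrable_def)
qed

text \<open>Continuity controls the compact middle part, so a bound known only for large
  \<open>t\<close> holds everywhere after enlarging the constant.\<close>

lemma exp_decay_bound:
  fixes f :: "real \<Rightarrow> complex"
  assumes "continuous_on UNIV f"
    and "\<And>t. T \<le> \<bar>t\<bar> \<Longrightarrow> norm (f t) \<le> C * exp (- \<eta> * \<bar>t\<bar>)"
  obtains K where "0 \<le> K" "\<And>t. norm (f t) \<le> K * exp (- \<eta> * \<bar>t\<bar>)"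
proof -
  have "compact ((\<lambda>t. norm (f t) * exp (\<eta> * \<bar>t\<bar>)) ` {-\<bar>T\<bar>..\<bar>T\<bar>})"
    by (intro compact_continuous_image continuous_intros continuous_on_subset[OF assms(1)]) auto
  then obtain B where B: "\<And>t. t \<in> {-\<bar>T\<bar>..\<bar>T\<bar>} \<Longrightarrow> norm (f t) * exp (\<eta> * \<bar>t\<bar>) \<le> B"
    unfolding compact_eq_bounded_closed bounded_real by (fastforce simp: abs_le_iff)
  have "norm (f t) \<le> max 0 (max B C) * exp (- \<eta> * \<bar>t\<bar>)" for t
  proof (cases "T \<le> \<bar>t\<bar>")
    case True
    have "C * exp (- \<eta> * \<bar>t\<bar>) \<le> max 0 (max B C) * exp (- \<eta> * \<bar>t\<bar>)"
      by (intro mult_right_mono) auto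
    with assms(2)[OF True] show ?thesis by linarith
  next
    case False
    hence "norm (f t) * exp (\<eta> * \<bar>t\<bar>) \<le> B" by (intro B) auto
    hence "norm (f t) * exp (\<eta> * \<bar>t\<bar>) \<le> max 0 (max B C)" by linarith
    thus ?thesis by (simp add: exp_minus field_simps)
  qed
  thus ?thesis using that[of "max 0 (max B C)"] by auto
qed

lemma integrable_exp_decay:
  fixes f :: "real \<Rightarrow> complex"
  assumes "continuous_on UNIV f" "0 < \<eta>"
    and "\<And>t. T \<le> \<bar>t\<bar> \<Longrightarrow> norm (f t) \<le> C * exp (- \<eta> * \<bar>t\<bar>)"
  shows "integrable lborel f"
proof -
  obtain K where K: "0 \<le> K" "\<And>t. norm (f t) \<le> K * exp (- \<eta> * \<bar>t\<bar>)"
    using exp_decay_bound[OF assms(1,3)] by metis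
  have "integrable lborel (\<lambda>t. K * exp (- \<eta> * \<bar>t\<bar>))"
    using integrable_exp_neg_abs[OF assms(2)] by simp
  thus ?thesis
    by (rule Bochner_Integration.integrable_bound)
       (use K assms(1) in \<open>auto intro: borel_measurable_continuous_onI\<close>)
qed

lemma integrable_mult_exp:
  fixes f :: "real \<Rightarrow> complex"
  assumes "continuous_on UNIV f" "\<bar>x\<bar> < \<eta>" and f: "0 \<le> K" "\<And>t. norm (f t) \<le> K * exp (- \<eta> * \<bar>t\<bar>)"
  shows "integrable lborel (\<lambda>t. f t * exp (of_real (x * t)))"
proof (rule integrable_exp_decay[of _ "\<eta> - \<bar>x\<bar>" 0 K])
  show "continuous_on UNIV (\<lambda>t. f t * exp (of_real (x * t)))" by (intro continuous_intros assms)
  show "norm (f t * exp (of_real (x * t))) \<le> K * exp (- (\<eta> - \<bar>x\<bar>) * \<bar>t\<bar>)" for t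
  proof -
    have "x * t \<le> \<bar>x\<bar> * \<bar>t\<bar>" by (metis abs_ge_self abs_mult)
    hence "norm (f t * exp (of_real (x * t))) \<le> (K * exp (- \<eta> * \<bar>t\<bar>)) * exp (\<bar>x\<bar> * \<bar>t\<bar>)"
      unfolding norm_mult using f by (intro mult_mono) auto
    thus ?thesis by (simp add: mult.assoc algebra_simps flip: exp_add)
  qed
qed (use assms in auto)

text \<open>Contour integrals along vertical segments come out as gauge integrals over
  \<open>{-X..X}\<close>; this connects their limit with the Lebesgue integral over the whole
  line.\<close>

lemma integral_symmetric_tendsto:
  fixes g :: "real \<Rightarrow> complex"
  assumes g: "integrable lborel g"
  shows "((\<lambda>X. integral {-X..X} g) \<longlongrightarrow> (LINT t|lborel. g t)) at_top"
proof -
  have *: "integral {-X..X} g = (LINT t|lborel. indicator {-X..X} t *\<^sub>R g t)" for X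
  proof -
    have "set_integrable lborel {-X..X} g"
      unfolding set_integrable_def using g by (intro integrable_mult_indicator) auto
    from set_borel_integral_eq_integral(2)[OF this] show ?thesis
      by (simp add: set_lebesgue_integral_def)
  qed
  show ?thesis unfolding *
  proof (rule integral_dominated_convergence_at_top[where w = "\<lambda>t. norm (g t)"])
    show "AE x in lborel. ((\<lambda>X. indicator {-X..X} x *\<^sub>R g x) \<longlongrightarrow> g x) at_top"
    proof (rule AE_I2)
      fix x :: real
      have "eventually (\<lambda>X. indicator {-X..X} x *\<^sub>R g x = g x) at_top"
        using eventually_ge_at_top[of "\<bar>x\<bar>"] by eventually_elim (auto simp: indicator_def)
      thus "((\<lambda>X. indicator {-X..X} x *\<^sub>R g x) \<longlongrightarrow> g x) at_top"
        by (rule tendsto_eventually)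
    qed
    show "\<forall>\<^sub>F X in at_top. AE x in lborel. norm (indicator {-X..X} x *\<^sub>R g x) \<le> norm (g x)"
      by (auto simp: indicator_def)
  qed (use g in auto)
qed

lemma continuous_on_vertical_line:
  assumes "f holomorphic_on S" "\<And>t. Complex \<sigma> t \<in> S"
  shows "continuous_on A (\<lambda>t. f (Complex \<sigma> t))"
proof -
  have "continuous_on S f" using assms(1) by (rule holomorphic_on_imp_continuous_on)
  moreover have "continuous_on A (Complex \<sigma>)" unfolding Complex_eq by (intro continuous_intros)
  ultimately show ?thesis
    using assms(2) by (intro continuous_on_compose2[of S f A "Complex \<sigma>"]) auto
qed

lemma vertical_strip:
  shows open_vertical_strip: "open {s. \<alpha> < Re s \<and> Re s < \<beta>}"
    and convex_vertical_strip: "convex {s. \<alpha> < Re s \<and> Re s < \<beta>}"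
  unfolding Collect_conj_eq
  by (intro open_Int open_halfspace_Re_gt open_halfspace_Re_lt)
     (intro convex_Int convex_halfspace_Re_gt convex_halfspace_Re_lt)

text \<open>Residue theorem on rectangles of growing height, whose horizontal sides vanish by the
  exponential decay. The usual factor \<open>\<i>\<close> is cancelled by
  \<open>ds = \<i> dt\<close>. The bounds \<alpha>' and \<beta>' provide an open strip around the
  closed one.\<close>

lemma vertical_line_shift:
  fixes f :: "complex \<Rightarrow> complex"
  assumes ab: "\<alpha>' < \<alpha>" "\<alpha> < Re p" "Re p < \<beta>" "\<beta> < \<beta>'"
    and holo: "f holomorphic_on {s. \<alpha>' < Re s \<and> Re s < \<beta>'} - {p}"
    and "0 < \<eta>"
    and decay: "\<And>s. \<alpha> \<le> Re s \<Longrightarrow> Re s \<le> \<beta> \<Longrightarrow> T \<le> \<bar>Im s\<bar> \<Longrightarrow> norm (f s) \<le> C * exp (- \<eta> * \<bar>Im s\<bar>)"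
  shows "(LINT t|lborel. f (Complex \<beta> t)) - (LINT t|lborel. f (Complex \<alpha> t)) = 2 * pi * residue f p"
proof -
  let ?S = "{s. \<alpha>' < Re s \<and> Re s < \<beta>'}"
  note S = vertical_strip[of \<alpha>' \<beta>']
  have cont: "continuous_on (?S - {p}) f" using holo by (rule holomorphic_on_imp_continuous_on)
  have int\<beta>: "integrable lborel (\<lambda>t. f (Complex \<beta> t))"
    by (rule integrable_exp_decay[OF continuous_on_vertical_line[OF holo] \<open>0 < \<eta>\<close>, of _ T C])
       (use ab decay[of "Complex \<beta> _"] in \<open>auto simp: complex_eq_iff\<close>)
  have int\<alpha>: "integrable lborel (\<lambda>t. f (Complex \<alpha> t))"
    by (rule integrable_exp_decay[OF continuous_on_vertical_line[OF holo] \<open>0 < \<eta>\<close>, of _ T C])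
       (use ab decay[of "Complex \<alpha> _"] in \<open>auto simp: complex_eq_iff\<close>)
  have rect: "norm (\<i> * integral {-X..X} (\<lambda>t. f (Complex \<beta> t)) - \<i> * integral {-X..X} (\<lambda>t. f (Complex \<alpha> t))
      - 2 * pi * \<i> * residue f p) \<le> 2 * (\<bar>C\<bar> * exp (- \<eta> * X) * (\<beta> - \<alpha>))"
    if X: "X > \<bar>T\<bar>" "X > \<bar>Im p\<bar>" for X
  proof -
    define a1 a2 a3 a4 where "a1 = Complex \<alpha> (-X)" and "a2 = Complex \<beta> (-X)"
      and "a3 = Complex \<beta> X" and "a4 = Complex \<alpha> X"
    have X0: "X > 0" using X by auto
    have pin: "p \<in> box a1 a3" using X ab by (auto simp: in_box_complex_iff a1_def a3_def)
    have cbox: "cbox a1 a3 \<subseteq> ?S" using ab by (auto simp: in_cbox_complex_iff a1_def a3_def)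
    have pim: "path_image (rectpath a1 a3) = cbox a1 a3 - box a1 a3"
      using ab X0 by (intro path_image_rectpath_cbox_minus_box) (auto simp: a1_def a3_def)
    have pimS: "path_image (rectpath a1 a3) \<subseteq> ?S - {p}" using pim pin cbox by auto
    have rp: "rectpath a1 a3 = linepath a1 a2 +++ linepath a2 a3 +++ linepath a3 a4 +++ linepath a4 a1"
      by (simp add: rectpath_def Let_def a1_def a2_def a3_def a4_def)
    have segs: "closed_segment a1 a2 \<subseteq> ?S - {p}" "closed_segment a2 a3 \<subseteq> ?S - {p}"
      "closed_segment a3 a4 \<subseteq> ?S - {p}" "closed_segment a4 a1 \<subseteq> ?S - {p}"
      using pimS unfolding rp by (auto simp: path_image_join)
    have ci: "f contour_integrable_on linepath a1 a2" "f contour_integrable_on linepath a2 a3"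
      "f contour_integrable_on linepath a3 a4" "f contour_integrable_on linepath a4 a1"
      using segs by (auto intro!: contour_integrable_continuous_linepath continuous_on_subset[OF cont])
    have "contour_integral (rectpath a1 a3) f
        = 2 * pi * \<i> * (\<Sum>q\<in>{p}. winding_number (rectpath a1 a3) q * residue f q)"
    proof (rule Residue_theorem[OF S(1)])
      show "\<forall>z. z \<notin> ?S \<longrightarrow> winding_number (rectpath a1 a3) z = 0"
        using cbox ab X0 by (auto intro!: winding_number_rectpath_outside simp: a1_def a3_def)
    qed (use S pimS holo in \<open>auto intro: convex_connected\<close>)
    also have "\<dots> = 2 * pi * \<i> * residue f p" using winding_number_rectpath[OF pin] by simp
    finally have 1: "contour_integral (rectpath a1 a3) f = 2 * pi * \<i> * residue f p" .
    have 2: "contour_integral (rectpath a1 a3) f = contour_integral (linepath a1 a2) f +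
       (contour_integral (linepath a2 a3) f +
       (contour_integral (linepath a3 a4) f + contour_integral (linepath a4 a1) f))"
      unfolding rp using ci by (simp add: contour_integrable_joinI)
    have 3: "contour_integral (linepath a2 a3) f = \<i> * integral {-X..X} (\<lambda>t. f (Complex \<beta> t))"
      using X0 by (intro contour_integral_linepath_same_Re) (auto simp: a2_def a3_def)
    have "contour_integral (linepath a4 a1) f = - contour_integral (linepath a1 a4) f"
      using segs(4) by (intro contour_integral_reverse_linepath continuous_on_subset[OF cont]) auto
    also have "contour_integral (linepath a1 a4) f = \<i> * integral {-X..X} (\<lambda>t. f (Complex \<alpha> t))"
      using X0 by (intro contour_integral_linepath_same_Re) (auto simp: a1_def a4_def)
    finally have 4: "contour_integral (linepath a4 a1) f = - (\<i> * integral {-X..X} (\<lambda>t. f (Complex \<alpha> t)))" .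
    have bnd: "norm (f s) \<le> \<bar>C\<bar> * exp (- \<eta> * X)" if "\<alpha> \<le> Re s" "Re s \<le> \<beta>" "\<bar>Im s\<bar> = X" for s
    proof -
      have "norm (f s) \<le> C * exp (- \<eta> * \<bar>Im s\<bar>)" using that X by (intro decay) auto
      also have "\<dots> \<le> \<bar>C\<bar> * exp (- \<eta> * X)" using that by (simp add: mult_right_mono)
      finally show ?thesis .
    qed
    have 5: "norm (contour_integral (linepath a1 a2) f) \<le> \<bar>C\<bar> * exp (- \<eta> * X) * norm (a2 - a1)"
    proof (rule contour_integral_bound_linepath[OF ci(1)])
      show "norm (f s) \<le> \<bar>C\<bar> * exp (- \<eta> * X)" if "s \<in> closed_segment a1 a2" for s
        using that X0 ab by (intro bnd) (auto simp: a1_def a2_def closed_segment_same_Im closed_segment_eq_real_ivl)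
    qed auto
    have 6: "norm (contour_integral (linepath a3 a4) f) \<le> \<bar>C\<bar> * exp (- \<eta> * X) * norm (a4 - a3)"
    proof (rule contour_integral_bound_linepath[OF ci(3)])
      show "norm (f s) \<le> \<bar>C\<bar> * exp (- \<eta> * X)" if "s \<in> closed_segment a3 a4" for s
        using that X0 ab by (intro bnd) (auto simp: a3_def a4_def closed_segment_same_Im closed_segment_eq_real_ivl split: if_splits)
    qed auto
    have "a2 - a1 = of_real (\<beta> - \<alpha>)" "a4 - a3 = of_real (\<alpha> - \<beta>)"
      by (auto simp: a1_def a2_def a3_def a4_def complex_eq_iff)
    hence n: "norm (a2 - a1) = \<beta> - \<alpha>" "norm (a4 - a3) = \<beta> - \<alpha>" using ab by (auto simp del: of_real_diff)
    have "\<i> * integral {-X..X} (\<lambda>t. f (Complex \<beta> t)) - \<i> * integral {-X..X} (\<lambda>t. f (Complex \<alpha> t))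
      - 2 * pi * \<i> * residue f p = - contour_integral (linepath a1 a2) f - contour_integral (linepath a3 a4) f"
      using 1 2 3 4 by (simp add: algebra_simps)
    also have "norm \<dots> \<le> norm (contour_integral (linepath a1 a2) f) + norm (contour_integral (linepath a3 a4) f)"
      by (metis norm_minus_cancel norm_triangle_ineq4)
    also have "\<dots> \<le> \<bar>C\<bar> * exp (- \<eta> * X) * (\<beta> - \<alpha>) + \<bar>C\<bar> * exp (- \<eta> * X) * (\<beta> - \<alpha>)"
      using 5 6 unfolding n by (rule add_mono)
    finally show ?thesis by (simp only: mult_2)
  qed
  let ?L = "\<lambda>X. \<i> * integral {-X..X} (\<lambda>t. f (Complex \<beta> t)) - \<i> * integral {-X..X} (\<lambda>t. f (Complex \<alpha> t))
      - 2 * pi * \<i> * residue f p"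
  have "((\<lambda>X. exp (- (\<eta> * X))) \<longlongrightarrow> 0) at_top"
    by (intro filterlim_compose[OF exp_at_bot] filterlim_uminus_at_bot[THEN iffD2])
       (use \<open>0 < \<eta>\<close> in \<open>auto intro!: filterlim_tendsto_pos_mult_at_top filterlim_ident\<close>)
  hence "((\<lambda>X. 2 * (\<bar>C\<bar> * exp (- \<eta> * X) * (\<beta> - \<alpha>))) \<longlongrightarrow> 2 * (\<bar>C\<bar> * 0 * (\<beta> - \<alpha>))) at_top"
    by (intro tendsto_intros) simp
  hence "((\<lambda>X. 2 * (\<bar>C\<bar> * exp (- \<eta> * X) * (\<beta> - \<alpha>))) \<longlongrightarrow> 0) at_top" by simp
  moreover have "eventually (\<lambda>X. norm (?L X) \<le> 2 * (\<bar>C\<bar> * exp (- \<eta> * X) * (\<beta> - \<alpha>))) at_top"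
    using eventually_gt_at_top[of "\<bar>T\<bar>"] eventually_gt_at_top[of "\<bar>Im p\<bar>"]
    by eventually_elim (rule rect)
  ultimately have "(?L \<longlongrightarrow> 0) at_top" by (rule Lim_null_comparison[rotated])
  moreover have "(?L \<longlongrightarrow> \<i> * (LINT t|lborel. f (Complex \<beta> t)) - \<i> * (LINT t|lborel. f (Complex \<alpha> t))
      - 2 * pi * \<i> * residue f p) at_top"
    by (intro tendsto_intros integral_symmetric_tendsto int\<alpha> int\<beta>)
  ultimately have "\<i> * (LINT t|lborel. f (Complex \<beta> t)) - \<i> * (LINT t|lborel. f (Complex \<alpha> t))
      - 2 * pi * \<i> * residue f p = 0"
    using tendsto_unique trivial_limit_at_top_linorder by blast
  hence "\<i> * ((LINT t|lborel. f (Complex \<beta> t)) - (LINT t|lborel. f (Complex \<alpha> t)) - 2 * pi * residue f p) = 0"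
    by (simp add: algebra_simps)
  thus ?thesis by simp
qed

section \<open>The Gamma integral with complex parameter\<close>

text \<open>Euler's integral after the substitution \<open>t = exp v\<close>, which moves it to the
  whole line, where translations replace scalings.\<close>

lemma Gamma_integral_log:
  fixes q :: complex
  assumes q: "Re q > 0"
  shows "integrable lborel (\<lambda>v. exp (q * v - exp (complex_of_real v)))" (is "integrable lborel ?g")
    and "(LINT v|lborel. exp (q * v - exp (complex_of_real v))) = Gamma q"
proof -
  define f where "f = (\<lambda>t. complex_of_real t powr (q - 1) / of_real (exp t))"
  have f1: "f absolutely_integrable_on {0<..}"
    unfolding f_def using absolutely_integrable_Gamma_integral'[OF q] .
  have f2: "integral {0<..} f = Gamma q"
    unfolding f_def using Gamma_integral_complex'[OF q] by (rule integral_unique)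
  have img: "range (exp :: real \<Rightarrow> real) = {0<..}"
    by (metis exp_gt_zero exp_ln image_subset_iff UNIV_I greaterThan_iff rangeI subsetI subset_antisym)
  have eq: "\<bar>exp v\<bar> *\<^sub>R f (exp v) = ?g v" for v :: real
    by (simp add: f_def powr_def scaleR_conv_of_real exp_diff algebra_simps flip: exp_of_real Ln_of_real)
  have "(\<lambda>v. \<bar>exp v\<bar> *\<^sub>R f (exp v)) absolutely_integrable_on UNIV \<and>
        integral UNIV (\<lambda>v. \<bar>exp v\<bar> *\<^sub>R f (exp v)) = Gamma q"
    by (subst has_absolute_integral_change_of_variables_real)
       (use f1 f2 in \<open>auto simp: img inj_on_def intro!: derivative_eq_intros\<close>)
  hence abs: "?g absolutely_integrable_on UNIV" and int: "integral UNIV ?g = Gamma q"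
    unfolding eq by auto
  show int': "integrable lborel ?g"
    using abs unfolding set_integrable_def
    by (subst (asm) integrable_completion) (auto intro: borel_measurable_continuous_onI continuous_intros)
  have hi: "(?g has_integral (LINT v|lborel. ?g v)) UNIV"
    using has_integral_integral_lborel[OF int'] .
  thus "(LINT v|lborel. exp (q * v - exp (complex_of_real v))) = Gamma q"
    using int integral_unique[OF hi] by (simp add: exp_of_real)
qed

text \<open>Taking absolute values inside the integral replaces \<open>q\<close> by
  \<open>Re q\<close>. The real integral is recorded as well because it evaluates the L1 norms
  needed for termwise integration.\<close>

lemma norm_Gamma_le:
  fixes q :: complex
  assumes "Re q > 0"
  shows "norm (Gamma q) \<le> Gamma (Re q)"
    and Gamma_integral_log_real: "(LINT v|lborel. exp (Re q * v - exp v)) = Gamma (Re q)"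
proof -
  have "of_real (LINT v|lborel. exp (Re q * v - exp v)) = (LINT v|lborel. complex_of_real (exp (Re q * v - exp v)))"
    by simp
  also have "\<dots> = (LINT v|lborel. exp (of_real (Re q) * complex_of_real v - exp (complex_of_real v)))"
    by (simp flip: exp_of_real)
  also have "\<dots> = of_real (Gamma (Re q))"
    using Gamma_integral_log(2)[of "of_real (Re q)"] assms by (simp add: Gamma_complex_of_real)
  finally show *: "(LINT v|lborel. exp (Re q * v - exp v)) = Gamma (Re q)" by simp
  have "norm (Gamma q) = norm (LINT v|lborel. exp (q * v - exp (complex_of_real v)))"
    using Gamma_integral_log(2)[OF assms] by simp
  also have "\<dots> \<le> (LINT v|lborel. norm (exp (q * v - exp (complex_of_real v))))"
    by (rule integral_norm_bound)
  also have "(\<lambda>v. norm (exp (q * v - exp (complex_of_real v)))) = (\<lambda>v. exp (Re q * v - exp v))"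
    by (simp add: norm_exp_eq_Re exp_of_real flip: of_real_exp)
  finally show "norm (Gamma q) \<le> Gamma (Re q)" using * by simp
qed

text \<open>Expanding \<open>exp (u * exp v)\<close> and integrating termwise gives the series of
  \<open>u ^ n / fact n * Gamma (q + n)\<close>, which is \<open>Gamma q\<close> times the binomial
  series of \<open>(1 - u) powr (- q)\<close>.\<close>

lemma Gamma_integral_series:
  fixes q u :: complex
  assumes q: "Re q > 0" and u: "norm u < 1"
  shows "integrable lborel (\<lambda>v. exp (q * v - (1 - u) * exp (complex_of_real v)))"
    and "(LINT v|lborel. exp (q * v - (1 - u) * exp (complex_of_real v))) = Gamma q * exp (- q * Ln (1 - u))"
proof -
  \<comment> \<open>This identity and the next are stated for fresh \<open>q\<close> and
    \<open>u\<close>, since they are used a second time at \<open>Re q\<close> and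
    \<open>norm u\<close>.\<close>
  have term_eq: "u ^ n / fact n * Gamma (q + of_nat n) = Gamma q * (((-q) gchoose n) * (-u) ^ n)"
    if "Re q > 0" for n and q u :: complex
  proof -
    have q': "q \<notin> \<int>\<^sub>\<le>\<^sub>0" using that by (auto elim!: nonpos_Ints_cases)
    have "Gamma (q + of_nat n) = Gamma q * pochhammer q n"
      using pochhammer_Gamma[OF q', of n] Gamma_nonzero[OF q'] by (simp add: field_simps)
    moreover have "(-1) ^ n * (-u) ^ n = u ^ n" by (simp flip: power_mult_distrib)
    hence "((-q) gchoose n) * (-u) ^ n = pochhammer q n / fact n * u ^ n"
      by (simp add: gbinomial_pochhammer)
    ultimately show ?thesis by simp
  qed
  have sums: "(\<lambda>n. u ^ n / fact n * Gamma (q + of_nat n)) sums (Gamma q * (1 - u) powr (-q))"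
    if "Re q > 0" "norm u < 1" for q u :: complex
    unfolding term_eq[OF that(1)] using gen_binomial_complex[of "-u" "-q"] that by (intro sums_mult) auto
  define f where "f = (\<lambda>n (v::real). u ^ n / fact n * exp ((q + of_nat n) * v - exp (complex_of_real v)))"
  have f_int: "integrable lborel (f n)" for n
    unfolding f_def using Gamma_integral_log(1)[of "q + of_nat n"] q
    by (intro integrable_mult_right) (simp flip: exp_of_real)
  have f_val: "(LINT v|lborel. f n v) = u ^ n / fact n * Gamma (q + of_nat n)" for n
    unfolding f_def using Gamma_integral_log(2)[of "q + of_nat n"] q by simp
  have f_norm: "norm (f n v) = norm u ^ n / fact n * exp ((Re q + n) * v - exp v)" for n v
    by (simp add: f_def norm_mult norm_divide norm_power Re_exp)
  have f_sums: "f n v = exp (q * v - exp (complex_of_real v)) * ((u * exp (complex_of_real v)) ^ n / fact n)" for n v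
    by (simp add: f_def algebra_simps exp_add exp_diff exp_of_nat_mult power_mult_distrib)
  have f_suminf: "(\<Sum>n. f n v) = exp (q * v - (1 - u) * exp (complex_of_real v))" for v
  proof -
    have "(\<lambda>n. (u * exp (complex_of_real v)) ^ n / fact n) sums exp (u * exp (complex_of_real v))"
      using exp_converges[of "u * exp (complex_of_real v)"] by (simp add: scaleR_conv_of_real divide_inverse mult_ac)
    hence "(\<lambda>n. f n v) sums (exp (q * v - exp (complex_of_real v)) * exp (u * exp (complex_of_real v)))"
      unfolding f_sums by (rule sums_mult)
    thus ?thesis by (simp add: sums_iff algebra_simps flip: exp_add)
  qed
  have S1: "AE v in lborel. summable (\<lambda>n. norm (f n v))"
  proof (rule AE_I2)
    fix v :: real
    have "summable (\<lambda>n. norm ((u * exp (complex_of_real v)) ^ n /\<^sub>R fact n))" by (rule summable_norm_exp)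
    hence "summable (\<lambda>n. norm (exp (q * v - exp (complex_of_real v))) * norm ((u * exp (complex_of_real v)) ^ n /\<^sub>R fact n))"
      by (rule summable_mult)
    thus "summable (\<lambda>n. norm (f n v))"
      unfolding f_sums by (simp add: norm_mult norm_divide norm_power norm_inverse divide_inverse mult_ac)
  qed
  \<comment> \<open>The L1 norms form the same series at the real parameters \<open>Re q\<close> and
    \<open>norm u\<close>, whose convergence is already known.\<close>
  have S2: "summable (\<lambda>n. LINT v|lborel. norm (f n v))"
  proof -
    have "(LINT v|lborel. norm (f n v)) = norm u ^ n / fact n * Gamma (Re q + n)" for n
      unfolding f_norm using Gamma_integral_log_real[of "q + of_nat n"] q by simp
    moreover have "summable (\<lambda>n. complex_of_real (norm u ^ n / fact n * Gamma (Re q + n)))"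
      using sums_summable[OF sums[of "of_real (Re q)" "of_real (norm u)"]] q u
      by (simp flip: Gamma_complex_of_real)
    ultimately show ?thesis by (simp only: summable_complex_of_real)
  qed
  have "integrable lborel (\<lambda>v. \<Sum>n. f n v)" by (rule integrable_suminf[OF f_int S1 S2])
  thus "integrable lborel (\<lambda>v. exp (q * v - (1 - u) * exp (complex_of_real v)))" unfolding f_suminf by (simp add: exp_of_real)
  have "(LINT v|lborel. (\<Sum>n. f n v)) = (\<Sum>n. (LINT v|lborel. f n v))" by (rule integral_suminf[OF f_int S1 S2])
  also have "\<dots> = Gamma q * (1 - u) powr (-q)" unfolding f_val using sums[OF q u] by (simp add: sums_iff)
  also have "(1 - u) powr (-q) = exp (- q * Ln (1 - u))" using u by (auto simp: powr_def)
  finally show "(LINT v|lborel. exp (q * v - (1 - u) * exp (complex_of_real v))) = Gamma q * exp (- q * Ln (1 - u))"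
    unfolding f_suminf .
qed

text \<open>
  For large real \<open>X\<close> the point \<open>exp \<omega> / X\<close> lies in the disc of radius 1 around 1, so the series
  expansion reaches the whole right half-plane and no contour rotation is needed.
\<close>

lemma Gamma_integral_half_plane:
  fixes q \<omega> :: complex
  assumes q: "Re q > 0" and \<omega>: "\<bar>Im \<omega>\<bar> < pi / 2"
  shows "integrable lborel (\<lambda>v::real. exp (q * v - exp (\<omega> + v)))"
    and "(LINT v|lborel. exp (q * v - exp (\<omega> + complex_of_real v))) = Gamma q * exp (- q * \<omega>)"
proof -
  define W where "W = exp \<omega>"
  have ReW: "Re W > 0"
    unfolding W_def Re_exp using \<omega> by (intro mult_pos_pos cos_gt_zero_pi) auto
  have LnW: "Ln W = \<omega>" unfolding W_def using \<omega> pi_gt_zero by (intro Ln_exp) (auto simp: abs_if split: if_splits)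
  \<comment> \<open>The point \<open>W / X\<close> lies in the unit disc around 1 as soon as
    \<open>(norm W)^2 < 2 * X * Re W\<close>; this choice makes the right side twice the
    left.\<close>
  define X where "X = (norm W)\<^sup>2 / Re W"
  have X: "X > 0" unfolding X_def using ReW by (intro divide_pos_pos) auto
  define u where "u = 1 - W / X"
  have u: "norm u < 1"
  proof -
    have "norm u = norm (of_real X - W) / X"
      using X by (simp add: u_def field_simps norm_divide flip: norm_minus_commute)
    moreover have "(norm (of_real X - W))\<^sup>2 < X\<^sup>2"
    proof -
      have "(norm (of_real X - W))\<^sup>2 = X\<^sup>2 - 2 * X * Re W + (norm W)\<^sup>2"
        unfolding cmod_power2 by (simp add: power2_eq_square algebra_simps)
      also have "(norm W)\<^sup>2 = X * Re W" using ReW by (simp add: X_def)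
      finally show ?thesis using X ReW by simp
    qed
    ultimately show ?thesis using X by (simp add: power2_less_imp_less)
  qed
  have u': "1 - u = W / X" by (simp add: u_def)
  \<comment> \<open>On the logarithmic scale the division by \<open>X\<close> is undone by
    translating by \<open>x\<close>.\<close>
  define x where "x = ln X"
  have Xx: "of_real X = exp (complex_of_real x)" using X by (metis exp_ln exp_of_real x_def)
  have Wx: "W / X = exp (\<omega> - x)" by (simp add: Xx W_def exp_diff)
  have Ln: "Ln (W / X) = \<omega> - x" unfolding Wx using \<omega> pi_gt_zero by (intro Ln_exp) (auto simp: abs_if split: if_splits)
  have int: "integrable lborel (\<lambda>v::real. exp (q * v - exp (\<omega> - x + v)))"
    and val: "(LINT v|lborel. exp (q * v - exp (\<omega> - x + complex_of_real v))) = Gamma q * exp (- q * (\<omega> - x))"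
    using Gamma_integral_series[OF q u] unfolding u' Ln unfolding Wx by (simp_all flip: exp_add exp_of_real)
  have shift: "exp (q * (x + 1 * v) - exp (\<omega> - x + of_real (x + 1 * v))) = exp (q * x) * exp (q * v - exp (\<omega> + v))" for v :: real
    by (simp add: algebra_simps flip: exp_add)
  have "integrable lborel (\<lambda>v::real. exp (q * x) * exp (q * v - exp (\<omega> + v)))"
    using lborel_integrable_real_affine[OF int, of 1 x] unfolding shift by simp
  hence "integrable lborel (\<lambda>v::real. exp (- q * x) * (exp (q * x) * exp (q * v - exp (\<omega> + v))))"
    by (rule integrable_mult_right)
  thus "integrable lborel (\<lambda>v::real. exp (q * v - exp (\<omega> + v)))"
    by (simp add: mult.assoc[symmetric] flip: exp_add)
  have "(LINT v|lborel. exp (q * v - exp (\<omega> - x + complex_of_real v))) =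
        (LINT v|lborel. exp (q * x) * exp (q * v - exp (\<omega> + complex_of_real v)))"
    using lborel_integral_real_affine[of 1 "\<lambda>v. exp (q * v - exp (\<omega> - x + complex_of_real v))" x]
    unfolding shift by simp
  hence "exp (q * x) * (LINT v|lborel. exp (q * v - exp (\<omega> + complex_of_real v))) =
      Gamma q * exp (- q * (\<omega> - x))"
    unfolding val by simp
  also have "exp (- q * (\<omega> - x)) = exp (q * x) * exp (- q * \<omega>)"
    by (simp add: algebra_simps flip: exp_add)
  finally have "exp (q * x) * (LINT v|lborel. exp (q * v - exp (\<omega> + complex_of_real v))) =
      exp (q * x) * (Gamma q * exp (- q * \<omega>))" by simp
  thus "(LINT v|lborel. exp (q * v - exp (\<omega> + complex_of_real v))) = Gamma q * exp (- q * \<omega>)" by simp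
qed

text \<open>The parameter \<open>W\<close> replaces its logarithm. The L1 norm is again such an
  integral because the absolute value of the integrand depends only on \<open>Re q\<close> and
  \<open>Re W\<close>.\<close>

lemma Gamma_integral_Re_pos:
  fixes q W :: complex
  assumes "Re q > 0" "Re W > 0"
  shows "integrable lborel (\<lambda>v. exp (q * v - W * exp (complex_of_real v)))"
    and "(LINT v|lborel. exp (q * v - W * exp (complex_of_real v))) = Gamma q * exp (- q * Ln W)"
    and "(LINT v|lborel. norm (exp (q * v - W * exp (complex_of_real v)))) = Gamma (Re q) * Re W powr (- Re q)"
proof -
  have *: "\<bar>Im (Ln W)\<bar> < pi / 2" if "Re W > 0" for W
    using that Re_Ln_pos_lt[of W] by force
  have W: "exp (Ln W + complex_of_real v) = W * exp (complex_of_real v)" if "Re W > 0" for W v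
    using that by (subst exp_add, subst exp_Ln) auto
  show "integrable lborel (\<lambda>v. exp (q * v - W * exp (complex_of_real v)))"
    and "(LINT v|lborel. exp (q * v - W * exp (complex_of_real v))) = Gamma q * exp (- q * Ln W)"
    using Gamma_integral_half_plane[OF assms(1) *[OF assms(2)]] unfolding W[OF assms(2)] by auto
  have "complex_of_real (LINT v|lborel. exp (Re q * v - Re W * exp v)) =
        (LINT v|lborel. complex_of_real (exp (Re q * v - Re W * exp v)))" by simp
  also have "\<dots> = (LINT v|lborel. exp (of_real (Re q) * of_real v - of_real (Re W) * exp (complex_of_real v)))"
    by (simp flip: exp_of_real)
  also have "\<dots> = Gamma (of_real (Re q)) * exp (- of_real (Re q) * Ln (of_real (Re W)))"
    using Gamma_integral_half_plane(2)[of "of_real (Re q)", OF _ *[of "of_real (Re W)"]] W[of "of_real (Re W)"] assms by simp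
  also have "\<dots> = complex_of_real (Gamma (Re q) * Re W powr (- Re q))"
    using assms by (simp add: Gamma_complex_of_real Ln_of_real powr_def flip: exp_of_real)
  finally have "(LINT v|lborel. exp (Re q * v - Re W * exp v)) = Gamma (Re q) * Re W powr (- Re q)"
    by (simp only: of_real_eq_iff)
  moreover have "norm (exp (q * v - W * exp (complex_of_real v))) = exp (Re q * v - Re W * exp v)" for v
    by (simp add: Re_exp Im_exp)
  ultimately show "(LINT v|lborel. norm (exp (q * v - W * exp (complex_of_real v)))) = Gamma (Re q) * Re W powr (- Re q)"
    by (simp only:)
qed

section \<open>Decay of the Gamma function in vertical strips\<close>

text \<open>The maximum principle is applied to
  \<open>f s * exp (- \<i> * \<eta> * s + \<delta> * s^2)\<close>: the linear term compensates the
  expected decay, and the quadratic one is a Gaussian in \<open>Im s\<close> that forces smallness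
  at the top. Letting \<delta> tend to 0 removes it again.\<close>

lemma phragmen_lindelof_upper:
  fixes f :: "complex \<Rightarrow> complex"
  assumes holo: "f holomorphic_on {s. 0 < Im s}" and T: "0 < T" and "0 \<le> \<eta>" and "\<alpha> \<le> \<beta>"
    and bnd: "\<And>s. \<alpha> \<le> Re s \<Longrightarrow> Re s \<le> \<beta> \<Longrightarrow> T \<le> Im s \<Longrightarrow> norm (f s) \<le> B"
    and edge\<alpha>: "\<And>t. T \<le> t \<Longrightarrow> norm (f (Complex \<alpha> t)) \<le> C * exp (- \<eta> * t)"
    and edge\<beta>: "\<And>t. T \<le> t \<Longrightarrow> norm (f (Complex \<beta> t)) \<le> C * exp (- \<eta> * t)"
  obtains K where "0 \<le> K"
    "\<And>s. \<alpha> \<le> Re s \<Longrightarrow> Re s \<le> \<beta> \<Longrightarrow> T \<le> Im s \<Longrightarrow> norm (f s) \<le> K * exp (- \<eta> * Im s)"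
proof -
  \<comment> \<open>The maximum covers the vertical sides through \<open>C\<close> and the bottom
    side through \<open>B * exp (\<eta> * T)\<close>.\<close>
  define K where "K = max (max 0 C) (B * exp (\<eta> * T))"
  define m where "m = \<alpha>\<^sup>2 + \<beta>\<^sup>2"
  have m: "(Re s)\<^sup>2 \<le> m" if "\<alpha> \<le> Re s" "Re s \<le> \<beta>" for s
  proof (cases "Re s \<ge> 0")
    case True
    hence "(Re s)\<^sup>2 \<le> \<beta>\<^sup>2" using that by (intro power_mono) auto
    thus ?thesis by (simp add: m_def add_increasing)
  next
    case False
    hence "(- Re s)\<^sup>2 \<le> (- \<alpha>)\<^sup>2" using that by (intro power_mono) auto
    thus ?thesis by (simp add: m_def add_increasing2)
  qed
  have B: "0 \<le> B" using bnd[of "Complex \<alpha> T"] \<open>\<alpha> \<le> \<beta>\<close> by (auto intro: order_trans[OF norm_ge_zero])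
  have K: "0 \<le> K" "C \<le> K" "B * exp (\<eta> * T) \<le> K" unfolding K_def by auto
  have main: "norm (f s) * exp (\<eta> * Im s + \<delta> * ((Re s)\<^sup>2 - (Im s)\<^sup>2)) \<le> K * exp (\<delta> * m)"
    if s: "\<alpha> \<le> Re s" "Re s \<le> \<beta>" "T \<le> Im s" and \<delta>: "0 < \<delta>" for s \<delta>
  proof -
    define g where "g = (\<lambda>s::complex. f s * exp (- \<i> * \<eta> * s + \<delta> * s\<^sup>2))"
    have g: "norm (g s) = norm (f s) * exp (\<eta> * Im s + \<delta> * ((Re s)\<^sup>2 - (Im s)\<^sup>2))" for s
      by (simp add: g_def norm_mult power2_eq_square)
    have g_holo: "g holomorphic_on {s. 0 < Im s}"
      unfolding g_def by (intro holomorphic_intros holo)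
    define Y where "Y = Im s + 1 + \<eta> / \<delta>"
    define Q where "Q = cbox (Complex \<alpha> T) (Complex \<beta> Y)"
    have low: "norm (f s) * exp (\<eta> * Im s) \<le> K \<Longrightarrow> \<alpha> \<le> Re s \<Longrightarrow> Re s \<le> \<beta> \<Longrightarrow> norm (g s) \<le> K * exp (\<delta> * m)" for s
    proof -
      assume *: "norm (f s) * exp (\<eta> * Im s) \<le> K" "\<alpha> \<le> Re s" "Re s \<le> \<beta>"
      have "norm (g s) = norm (f s) * exp (\<eta> * Im s) * exp (\<delta> * ((Re s)\<^sup>2 - (Im s)\<^sup>2))"
        unfolding g by (simp add: exp_add)
      also have "\<dots> \<le> K * exp (\<delta> * m)"
      proof (intro mult_mono)
        have "(Re s)\<^sup>2 - (Im s)\<^sup>2 \<le> m" using m[OF *(2,3)] by (simp add: algebra_simps add_increasing2)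
        thus "exp (\<delta> * ((Re s)\<^sup>2 - (Im s)\<^sup>2)) \<le> exp (\<delta> * m)" using \<delta> by simp
      qed (use * K in auto)
      finally show ?thesis .
    qed
    have Y: "Y \<ge> 1" "Im s < Y" "\<delta> * Y \<ge> \<eta> + \<delta>"
    proof -
      have "\<eta> / \<delta> \<ge> 0" using \<open>0 \<le> \<eta>\<close> \<delta> by simp
      thus "Y \<ge> 1" "Im s < Y" using T s unfolding Y_def by linarith+
      have "Y \<ge> 1 + \<eta> / \<delta>" using T s unfolding Y_def by linarith
      hence "\<delta> * Y \<ge> \<delta> * (1 + \<eta> / \<delta>)" using \<delta> by (intro mult_left_mono) auto
      moreover have "\<delta> * (1 + \<eta> / \<delta>) = \<eta> + \<delta>" using \<delta> by (simp add: field_simps)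
      ultimately show "\<delta> * Y \<ge> \<eta> + \<delta>" by simp
    qed
    have "norm (g s) \<le> K * exp (\<delta> * m)"
    proof (rule maximum_modulus_frontier[where S = Q and f = g and \<xi> = s])
      have sub: "cbox (Complex \<alpha> T) (Complex \<beta> Y) \<subseteq> {s. 0 < Im s}"
        using T by (auto simp: in_cbox_complex_iff)
      show "g holomorphic_on interior Q"
        using sub interior_subset[of Q] unfolding Q_def by (intro holomorphic_on_subset[OF g_holo]) blast
      show "continuous_on (closure Q) g"
        unfolding Q_def closure_cbox
        using sub by (intro holomorphic_on_imp_continuous_on holomorphic_on_subset[OF g_holo])
      show "bounded Q" unfolding Q_def by (rule bounded_cbox)
      show "s \<in> Q" using s Y by (auto simp: Q_def in_cbox_complex_iff)
      fix z assume "z \<in> frontier Q"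
      hence z: "\<alpha> \<le> Re z" "Re z \<le> \<beta>" "T \<le> Im z" "Im z \<le> Y"
        and "Re z = \<alpha> \<or> Re z = \<beta> \<or> Im z = T \<or> Im z = Y"
        unfolding Q_def frontier_cbox by (auto simp: in_cbox_complex_iff in_box_complex_iff)
      then consider "Re z = \<alpha> \<or> Re z = \<beta>" | "Im z = T" | "Im z = Y" by blast
      thus "norm (g z) \<le> K * exp (\<delta> * m)"
      proof cases
        case 1
        hence "norm (f z) \<le> C * exp (- \<eta> * Im z)"
          using edge\<alpha>[of "Im z"] edge\<beta>[of "Im z"] z by (metis complex.collapse)
        also have "\<dots> \<le> K * exp (- \<eta> * Im z)" using K by (intro mult_right_mono) auto
        finally have "norm (f z) * exp (\<eta> * Im z) \<le> K" by (simp add: exp_minus field_simps)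
        thus ?thesis using z by (intro low)
      next
        case 2
        have "norm (f z) * exp (\<eta> * Im z) \<le> B * exp (\<eta> * T)"
          unfolding 2 using bnd z by (intro mult_right_mono) auto
        thus ?thesis using z K by (intro low) auto
      next
        case 3
        have "\<eta> * Y + \<delta> * ((Re z)\<^sup>2 - Y\<^sup>2) \<le> \<delta> * m"
        proof -
          have "(\<eta> + \<delta>) * Y \<le> \<delta> * Y * Y" using Y by (intro mult_right_mono) auto
          moreover have "0 \<le> \<delta> * Y" using Y \<delta> by simp
          moreover have "\<delta> * (Re z)\<^sup>2 \<le> \<delta> * m" using m[OF z(1,2)] \<delta> by (intro mult_left_mono) auto
          ultimately show ?thesis by (simp add: algebra_simps power2_eq_square)
        qed
        moreover have "B * 1 \<le> B * exp (\<eta> * T)" using B \<open>0 \<le> \<eta>\<close> T by (intro mult_left_mono) auto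
        moreover have "norm (f z) \<le> B" using bnd z by auto
        ultimately show ?thesis unfolding g 3 using K B by (intro mult_mono) auto
      qed
    qed
    thus ?thesis unfolding g .
  qed
  have "norm (f s) \<le> K * exp (- \<eta> * Im s)" if s: "\<alpha> \<le> Re s" "Re s \<le> \<beta>" "T \<le> Im s" for s
  proof -
    have "((\<lambda>\<delta>. norm (f s) * exp (\<eta> * Im s + \<delta> * ((Re s)\<^sup>2 - (Im s)\<^sup>2))) \<longlongrightarrow>
            norm (f s) * exp (\<eta> * Im s + 0 * ((Re s)\<^sup>2 - (Im s)\<^sup>2))) (at_right 0)"
      by (intro tendsto_intros)
    moreover have "((\<lambda>\<delta>. K * exp (\<delta> * m)) \<longlongrightarrow> K * exp (0 * m)) (at_right 0)"
      by (intro tendsto_intros)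
    moreover have "\<forall>\<^sub>F \<delta> in at_right 0. norm (f s) * exp (\<eta> * Im s + \<delta> * ((Re s)\<^sup>2 - (Im s)\<^sup>2)) \<le> K * exp (\<delta> * m)"
      using eventually_at_right_less[of 0] by eventually_elim (rule main[OF s])
    ultimately have "norm (f s) * exp (\<eta> * Im s) \<le> K"
      using tendsto_le[of "at_right 0"] by force
    thus ?thesis by (simp add: exp_minus field_simps)
  qed
  thus ?thesis using that K by blast
qed

text \<open>The lower half follows from the upper one by \<open>s \<mapsto> - s\<close>, which
  exchanges the two edges.\<close>

lemma phragmen_lindelof_strip:
  fixes f :: "complex \<Rightarrow> complex"
  assumes holo: "f holomorphic_on {s. Im s \<noteq> 0}" and T: "0 < T" and "0 \<le> \<eta>" and "\<alpha> \<le> \<beta>"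
    and bnd: "\<And>s. \<alpha> \<le> Re s \<Longrightarrow> Re s \<le> \<beta> \<Longrightarrow> T \<le> \<bar>Im s\<bar> \<Longrightarrow> norm (f s) \<le> B"
    and edge\<alpha>: "\<And>t. T \<le> \<bar>t\<bar> \<Longrightarrow> norm (f (Complex \<alpha> t)) \<le> C * exp (- \<eta> * \<bar>t\<bar>)"
    and edge\<beta>: "\<And>t. T \<le> \<bar>t\<bar> \<Longrightarrow> norm (f (Complex \<beta> t)) \<le> C * exp (- \<eta> * \<bar>t\<bar>)"
  obtains K where "0 \<le> K"
    "\<And>s. \<alpha> \<le> Re s \<Longrightarrow> Re s \<le> \<beta> \<Longrightarrow> T \<le> \<bar>Im s\<bar> \<Longrightarrow> norm (f s) \<le> K * exp (- \<eta> * \<bar>Im s\<bar>)"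
proof -
  have "f holomorphic_on {s. 0 < Im s}" by (rule holomorphic_on_subset[OF holo]) auto
  then obtain K1 where K1: "0 \<le> K1"
    "\<And>s. \<alpha> \<le> Re s \<Longrightarrow> Re s \<le> \<beta> \<Longrightarrow> T \<le> Im s \<Longrightarrow> norm (f s) \<le> K1 * exp (- \<eta> * Im s)"
  proof (rule phragmen_lindelof_upper[OF _ T \<open>0 \<le> \<eta>\<close> \<open>\<alpha> \<le> \<beta>\<close>])
    show "norm (f s) \<le> B" if "\<alpha> \<le> Re s" "Re s \<le> \<beta>" "T \<le> Im s" for s using bnd that by auto
    show "norm (f (Complex \<alpha> t)) \<le> C * exp (- \<eta> * t)" if "T \<le> t" for t using edge\<alpha>[of t] that T by simp
    show "norm (f (Complex \<beta> t)) \<le> C * exp (- \<eta> * t)" if "T \<le> t" for t using edge\<beta>[of t] that T by simp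
  qed blast
  have "(\<lambda>s. - s) holomorphic_on {s::complex. 0 < Im s}" by (intro holomorphic_intros)
  moreover have "(\<lambda>s. - s) ` {s::complex. 0 < Im s} \<subseteq> {s. Im s \<noteq> 0}" by auto
  ultimately have "(f \<circ> (\<lambda>s. - s)) holomorphic_on {s. 0 < Im s}"
    by (intro holomorphic_on_compose_gen[OF _ holo])
  hence "(\<lambda>s. f (- s)) holomorphic_on {s. 0 < Im s}" by (simp add: o_def)
  then obtain K2 where K2: "0 \<le> K2"
    "\<And>s. - \<beta> \<le> Re s \<Longrightarrow> Re s \<le> - \<alpha> \<Longrightarrow> T \<le> Im s \<Longrightarrow> norm (f (- s)) \<le> K2 * exp (- \<eta> * Im s)"
  proof (rule phragmen_lindelof_upper[OF _ T \<open>0 \<le> \<eta>\<close>])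
    show "- \<beta> \<le> - \<alpha>" using \<open>\<alpha> \<le> \<beta>\<close> by simp
    show "norm (f (- s)) \<le> B" if "- \<beta> \<le> Re s" "Re s \<le> - \<alpha>" "T \<le> Im s" for s
      using bnd[of "- s"] that by auto
    have neg: "- Complex (- x) t = Complex x (- t)" for x t by (simp add: complex_eq_iff)
    show "norm (f (- Complex (- \<beta>) t)) \<le> C * exp (- \<eta> * t)" if "T \<le> t" for t
      using edge\<beta>[of "- t"] that T unfolding neg by simp
    show "norm (f (- Complex (- \<alpha>) t)) \<le> C * exp (- \<eta> * t)" if "T \<le> t" for t
      using edge\<alpha>[of "- t"] that T unfolding neg by simp
  qed blast
  show ?thesis
  proof (rule that[of "K1 + K2"])
    fix s assume s: "\<alpha> \<le> Re s" "Re s \<le> \<beta>" "T \<le> \<bar>Im s\<bar>"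
    show "norm (f s) \<le> (K1 + K2) * exp (- \<eta> * \<bar>Im s\<bar>)"
    proof (cases "Im s \<ge> 0")
      case True
      have "norm (f s) \<le> K1 * exp (- \<eta> * Im s)" using True s by (intro K1(2)) auto
      also have "\<dots> \<le> (K1 + K2) * exp (- \<eta> * Im s)" using K2(1) by (intro mult_right_mono) auto
      finally show ?thesis using True by simp
    next
      case False
      have "norm (f (- (- s))) \<le> K2 * exp (- \<eta> * Im (- s))" using False s by (intro K2(2)) auto
      also have "\<dots> \<le> (K1 + K2) * exp (- \<eta> * Im (- s))" using K1(1) by (intro mult_right_mono) auto
      finally show ?thesis using False by simp
    qed
  qed (use K1 K2 in auto)
qed

text \<open>On this line \<open>1 - z\<close> is the conjugate of \<open>z\<close>, so the
  reflection formula gives the exact value \<open>pi / cosh (pi * t)\<close> for the squared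
  modulus.\<close>

lemma norm_Gamma_half: "norm (Gamma (Complex (1/2) t)) \<le> sqrt (2 * pi) * exp (- (pi / 2) * \<bar>t\<bar>)"
proof -
  let ?z = "Complex (1/2) t"
  have c: "1 - ?z = cnj ?z" by (simp add: complex_eq_iff)
  have "of_real pi * ?z = of_real pi / 2 - (- (\<i> * of_real (pi * t)))" by (simp add: complex_eq_iff)
  hence "sin (of_real pi * ?z) = cos (\<i> * of_real (pi * t))"
    by (simp only: cos_sin_eq[symmetric] cos_minus)
  also have "\<dots> = of_real (cosh (pi * t))"
    by (simp add: cosh_conv_cos[symmetric] cosh_field_def flip: exp_of_real)
  finally have s: "sin (of_real pi * ?z) = of_real (cosh (pi * t))" .
  have "of_real ((norm (Gamma ?z))\<^sup>2) = Gamma ?z * Gamma (1 - ?z)"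
    unfolding c cnj_Gamma[symmetric] by (rule complex_norm_square)
  also have "\<dots> = of_real (pi / cosh (pi * t))" unfolding Gamma_reflection_complex s by simp
  finally have sq: "(norm (Gamma ?z))\<^sup>2 = pi / cosh (pi * t)" by (simp only: of_real_eq_iff)
  have "exp (pi * \<bar>t\<bar>) / 2 \<le> cosh (pi * t)"
  proof -
    have "exp (pi * \<bar>t\<bar>) \<le> exp (pi * t) + exp (- (pi * t))" by (cases "t \<ge> 0") auto
    thus ?thesis by (simp add: cosh_field_def)
  qed
  hence "pi / cosh (pi * t) \<le> pi / (exp (pi * \<bar>t\<bar>) / 2)"
    by (intro divide_left_mono mult_pos_pos) (auto simp: cosh_real_pos)
  also have "\<dots> = (sqrt (2 * pi) * exp (- (pi / 2) * \<bar>t\<bar>))\<^sup>2"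
    by (simp add: power_mult_distrib exp_minus field_simps flip: exp_double)
  finally have "(norm (Gamma ?z))\<^sup>2 \<le> (sqrt (2 * pi) * exp (- (pi / 2) * \<bar>t\<bar>))\<^sup>2" unfolding sq .
  thus ?thesis by (rule power2_le_imp_le) auto
qed

lemma Complex_not_nonpos_Ints: "0 < x \<or> t \<noteq> 0 \<Longrightarrow> Complex x t \<notin> \<int>\<^sub>\<le>\<^sub>0"
  by (auto elim!: nonpos_Ints_cases simp: complex_eq_iff)

text \<open>Each use of \<open>Gamma (z + 1) = z * Gamma z\<close> costs one factor of size
  \<open>1 + \<bar>t\<bar>\<close>. The power \<open>N\<close> collected here is the order in
  \<epsilon> that the test function loses.\<close>

lemma norm_Gamma_half_integer:
  obtains C where "0 \<le> C"
    "\<And>t. norm (Gamma (Complex (real N + 1/2) t)) \<le> C * (1 + \<bar>t\<bar>) ^ N * exp (- (pi / 2) * \<bar>t\<bar>)"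
proof -
  have "\<exists>C\<ge>0. \<forall>t. norm (Gamma (Complex (real N + 1/2) t)) \<le> C * (1 + \<bar>t\<bar>) ^ N * exp (- (pi / 2) * \<bar>t\<bar>)"
  proof (induction N)
    case 0
    show ?case using norm_Gamma_half by (intro exI[of _ "sqrt (2 * pi)"]) auto
  next
    case (Suc N)
    then obtain C where C: "C \<ge> 0"
      "\<And>t. norm (Gamma (Complex (real N + 1/2) t)) \<le> C * (1 + \<bar>t\<bar>) ^ N * exp (- (pi / 2) * \<bar>t\<bar>)" by blast
    have "norm (Gamma (Complex (real (Suc N) + 1/2) t)) \<le> (real N + 1) * C * (1 + \<bar>t\<bar>) ^ Suc N * exp (- (pi / 2) * \<bar>t\<bar>)" for t
    proof -
      let ?z = "Complex (real N + 1/2) t"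
      have "Complex (real (Suc N) + 1/2) t = ?z + 1" by (simp add: complex_eq_iff)
      hence "norm (Gamma (Complex (real (Suc N) + 1/2) t)) = norm ?z * norm (Gamma ?z)"
        using Gamma_plus1[of ?z] by (simp add: Complex_not_nonpos_Ints norm_mult)
      also have "\<dots> \<le> ((real N + 1) * (1 + \<bar>t\<bar>)) * (C * (1 + \<bar>t\<bar>) ^ N * exp (- (pi / 2) * \<bar>t\<bar>))"
      proof (intro mult_mono C(2))
        have "norm ?z \<le> (real N + 1/2) + \<bar>t\<bar>" using cmod_le[of ?z] by simp
        also have "\<dots> \<le> (real N + 1) * (1 + \<bar>t\<bar>)" by (simp add: algebra_simps)
        finally show "norm ?z \<le> (real N + 1) * (1 + \<bar>t\<bar>)" .
      qed auto
      finally show ?thesis by (simp add: mult_ac)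
    qed
    thus ?case using C(1) by (intro exI[of _ "(real N + 1) * C"]) auto
  qed
  thus ?thesis using that by blast
qed

text \<open>A single term of the exponential series at \<open>\<delta> * (1 + x)\<close> is at most
  its sum. The explicit power of \<delta> in the denominator matters later, with \<delta> tending to
  0.\<close>

lemma power_le_exp:
  assumes "0 < (\<delta>::real)" "0 \<le> x"
  shows "(1 + x) ^ N \<le> fact N * exp \<delta> / \<delta> ^ N * exp (\<delta> * x)"
proof -
  have "(\<delta> * (1 + x)) ^ N / fact N \<le> exp (\<delta> * (1 + x))"
  proof -
    have "(\<Sum>k\<in>{N}. (\<delta> * (1 + x)) ^ k /\<^sub>R fact k) \<le> (\<Sum>k. (\<delta> * (1 + x)) ^ k /\<^sub>R fact k)"
      using assms by (intro sum_le_suminf summable_exp_generic) auto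
    thus ?thesis by (simp add: exp_def divide_inverse mult.commute)
  qed
  moreover have "exp (\<delta> * (1 + x)) = exp \<delta> * exp (\<delta> * x)" by (simp add: distrib_left exp_add)
  ultimately show ?thesis using assms unfolding power_mult_distrib by (simp add: divide_simps mult_ac)
qed

lemma norm_Gamma_half_integer_exp:
  assumes "\<eta> < pi / 2"
  obtains C where "0 \<le> C" "\<And>t. norm (Gamma (Complex (real N + 1/2) t)) \<le> C * exp (- \<eta> * \<bar>t\<bar>)"
proof -
  obtain C where C: "0 \<le> C"
    "\<And>t. norm (Gamma (Complex (real N + 1/2) t)) \<le> C * (1 + \<bar>t\<bar>) ^ N * exp (- (pi / 2) * \<bar>t\<bar>)"
    using norm_Gamma_half_integer by blast
  define \<delta> where "\<delta> = pi / 2 - \<eta>"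
  define D where "D = fact N * exp \<delta> / \<delta> ^ N"
  have \<delta>: "\<delta> > 0" using assms by (simp add: \<delta>_def)
  have "norm (Gamma (Complex (real N + 1/2) t)) \<le> (C * D) * exp (- \<eta> * \<bar>t\<bar>)" for t
  proof -
    have "norm (Gamma (Complex (real N + 1/2) t)) \<le> C * (1 + \<bar>t\<bar>) ^ N * exp (- (pi / 2) * \<bar>t\<bar>)" by (rule C)
    also have "\<dots> \<le> C * (D * exp (\<delta> * \<bar>t\<bar>)) * exp (- (pi / 2) * \<bar>t\<bar>)"
      unfolding D_def using C \<delta> by (intro mult_right_mono mult_left_mono power_le_exp) auto
    also have "\<dots> = C * D * (exp (\<delta> * \<bar>t\<bar>) * exp (- (pi / 2) * \<bar>t\<bar>))" by simp
    also have "exp (\<delta> * \<bar>t\<bar>) * exp (- (pi / 2) * \<bar>t\<bar>) = exp (- \<eta> * \<bar>t\<bar>)"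
      unfolding \<delta>_def by (simp add: algebra_simps flip: exp_add)
    finally show ?thesis .
  qed
  moreover have "C * D \<ge> 0" using C \<delta> by (auto simp: D_def)
  ultimately show ?thesis using that by blast
qed

lemma Gamma_holomorphic_off_real: "Gamma holomorphic_on {s. Im s \<noteq> 0}"
  by (rule holomorphic_Gamma) (auto elim!: nonpos_Ints_cases)

text \<open>The half-integer edges have the decay, \<open>Gamma (Re s)\<close> bounds the interior,
  and the Phragmen-Lindelof principle carries the decay inside.\<close>

lemma norm_Gamma_strip:
  assumes "0 \<le> \<eta>" "\<eta> < pi / 2"
  obtains K where "0 \<le> K"
    "\<And>s. 1/2 \<le> Re s \<Longrightarrow> Re s \<le> real N + 1/2 \<Longrightarrow> 1 \<le> \<bar>Im s\<bar> \<Longrightarrow> norm (Gamma s) \<le> K * exp (- \<eta> * \<bar>Im s\<bar>)"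
proof -
  obtain C0 where C0: "0 \<le> C0" "\<And>t. norm (Gamma (Complex (real 0 + 1/2) t)) \<le> C0 * exp (- \<eta> * \<bar>t\<bar>)"
    using norm_Gamma_half_integer_exp[OF assms(2)] by blast
  obtain C1 where C1: "0 \<le> C1" "\<And>t. norm (Gamma (Complex (real N + 1/2) t)) \<le> C1 * exp (- \<eta> * \<bar>t\<bar>)"
    using norm_Gamma_half_integer_exp[OF assms(2)] by blast
  have "compact (Gamma ` {1/2..real N + 1/2})"
    by (intro compact_continuous_image continuous_intros) (auto elim!: nonpos_Ints_cases)
  then obtain B where B: "\<And>x. x \<in> {1/2..real N + 1/2} \<Longrightarrow> Gamma x \<le> B"
    unfolding compact_eq_bounded_closed bounded_real by (fastforce simp: abs_le_iff)
  show ?thesis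
  proof (rule phragmen_lindelof_strip[OF Gamma_holomorphic_off_real zero_less_one \<open>0 \<le> \<eta>\<close>])
    show "norm (Gamma s) \<le> B" if "1/2 \<le> Re s" "Re s \<le> real N + 1/2" for s
      using norm_Gamma_le[of s] B[of "Re s"] that by force
    have "C0 * exp (- \<eta> * \<bar>t\<bar>) \<le> (C0 + C1) * exp (- \<eta> * \<bar>t\<bar>)" for t using C1 by (intro mult_right_mono) auto
    thus "norm (Gamma (Complex (1/2) t)) \<le> (C0 + C1) * exp (- \<eta> * \<bar>t\<bar>)" for t
      using C0(2)[of t] by (force intro: order_trans)
    have "C1 * exp (- \<eta> * \<bar>t\<bar>) \<le> (C0 + C1) * exp (- \<eta> * \<bar>t\<bar>)" for t using C0 by (intro mult_right_mono) auto
    thus "norm (Gamma (Complex (real N + 1/2) t)) \<le> (C0 + C1) * exp (- \<eta> * \<bar>t\<bar>)" for t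
      using C1(2)[of t] by (force intro: order_trans)
  qed (use that in auto)
qed

section \<open>The Cahen--Mellin integral\<close>

lemma norm_exp_mult_le:
  fixes s L :: complex
  shows "norm (exp (- s * L)) \<le> exp (- Re s * Re L) * exp (\<bar>Im L\<bar> * \<bar>Im s\<bar>)"
proof -
  have "Im s * Im L \<le> \<bar>Im L\<bar> * \<bar>Im s\<bar>" by (metis abs_ge_self abs_mult mult.commute)
  thus ?thesis by (simp flip: exp_add)
qed

text \<open>Every factor \<open>s + k\<close> of the functional equation has modulus at least
  \<open>\<bar>Im s\<bar> \<ge> 1\<close>. This carries bounds from the right half-plane to the left
  one.\<close>

lemma norm_Gamma_shift:
  assumes "1 \<le> \<bar>Im s\<bar>"
  shows "norm (Gamma s) \<le> norm (Gamma (s + of_nat n))"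
proof (induction n)
  case (Suc n)
  let ?z = "s + of_nat n"
  have z: "?z \<notin> \<int>\<^sub>\<le>\<^sub>0" using assms by (auto elim!: nonpos_Ints_cases simp: complex_eq_iff)
  have "1 \<le> norm ?z" using assms abs_Im_le_cmod[of ?z] by simp
  hence "1 * norm (Gamma ?z) \<le> norm ?z * norm (Gamma ?z)" by (intro mult_right_mono) auto
  also have "\<dots> = norm (Gamma (s + of_nat (Suc n)))"
    using Gamma_plus1[OF z] by (simp add: norm_mult add_ac)
  finally show ?case using Suc by simp
qed simp

text \<open>Moving left divides by numbers of modulus at least \<open>(n + 1) / 2\<close>. The
  resulting factorial makes the remainder integrals of \<open>cahen_mellin\<close> vanish.\<close>

lemma norm_Gamma_half_minus:
  "norm (Gamma (Complex (1/2 - real n) t)) \<le> 2 ^ n / fact n * sqrt (2 * pi) * exp (- (pi / 2) * \<bar>t\<bar>)"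
proof (induction n)
  case 0
  show ?case using norm_Gamma_half[of t] by simp
next
  case (Suc n)
  let ?z = "Complex (1/2 - real (Suc n)) t"
  have z: "?z \<notin> \<int>\<^sub>\<le>\<^sub>0"
  proof
    assume "?z \<in> \<int>\<^sub>\<le>\<^sub>0"
    then obtain k :: int where "?z = of_int k" by (auto elim!: nonpos_Ints_cases)
    hence "1/2 - real (Suc n) = of_int k" by (simp add: complex_eq_iff)
    hence "of_int (2 * (k + int (Suc n))) = (1::real)" by simp
    hence "2 * (k + int (Suc n)) = 1" by (simp only: of_int_eq_1_iff)
    thus False by presburger
  qed
  have "?z + 1 = Complex (1/2 - real n) t" by (simp add: complex_eq_iff)
  hence G: "norm (Gamma (Complex (1/2 - real n) t)) = norm ?z * norm (Gamma ?z)"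
    using Gamma_plus1[OF z] by (simp add: norm_mult)
  have "(real n + 1) / 2 \<le> norm ?z" using abs_Re_le_cmod[of ?z] by simp
  hence "(real n + 1) / 2 * norm (Gamma ?z) \<le> norm ?z * norm (Gamma ?z)" by (intro mult_right_mono) auto
  also have "\<dots> \<le> 2 ^ n / fact n * sqrt (2 * pi) * exp (- (pi / 2) * \<bar>t\<bar>)" using Suc G by simp
  finally have "2 / (real n + 1) * ((real n + 1) / 2 * norm (Gamma ?z))
      \<le> 2 / (real n + 1) * (2 ^ n / fact n * sqrt (2 * pi) * exp (- (pi / 2) * \<bar>t\<bar>))"
    by (intro mult_left_mono) auto
  also have "2 / (real n + 1) * ((real n + 1) / 2 * norm (Gamma ?z)) = norm (Gamma ?z)"
    by (simp add: add_eq_0_iff)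
  also have "2 / (real n + 1) * (2 ^ n / fact n * sqrt (2 * pi) * exp (- (pi / 2) * \<bar>t\<bar>)) = 2 ^ Suc n / fact (Suc n) * sqrt (2 * pi) * exp (- (pi / 2) * \<bar>t\<bar>)"
    by (simp add: field_simps)
  finally show ?case .
qed

lemma norm_Gamma_exp_strip:
  fixes L :: complex
  assumes L: "\<bar>Im L\<bar> < pi / 2"
  obtains K \<delta> where "0 < \<delta>"
    "\<And>s. 1/2 \<le> Re s \<Longrightarrow> Re s \<le> real N + 1/2 \<Longrightarrow> 1 \<le> \<bar>Im s\<bar> \<Longrightarrow>
       norm (Gamma s * exp (- s * L)) \<le> K * exp (- \<delta> * \<bar>Im s\<bar>)"
    "\<And>s. - real n - 1/2 \<le> Re s \<Longrightarrow> Re s \<le> - real n + 1/2 \<Longrightarrow> 1 \<le> \<bar>Im s\<bar> \<Longrightarrow>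
       norm (Gamma s * exp (- s * L)) \<le> K * exp (- \<delta> * \<bar>Im s\<bar>)"
proof -
  \<comment> \<open>Midway between \<open>\<bar>Im L\<bar>\<close> and \<open>pi / 2\<close>: below
    the decay rate of Gamma and above the growth rate of the exponential factor.\<close>
  define \<eta> where "\<eta> = (\<bar>Im L\<bar> + pi / 2) / 2"
  have \<eta>: "0 \<le> \<eta>" "\<eta> < pi / 2" "\<bar>Im L\<bar> < \<eta>" using L by (auto simp: \<eta>_def)
  \<comment> \<open>\<open>Suc N\<close> rather than \<open>N\<close>: the second strip is shifted
    by \<open>Suc n\<close> into real parts from 1/2 to 3/2, which must be covered even for
    \<open>N = 0\<close>.\<close>
  obtain K where K: "0 \<le> K" "\<And>s. 1/2 \<le> Re s \<Longrightarrow> Re s \<le> real (Suc N) + 1/2 \<Longrightarrow> 1 \<le> \<bar>Im s\<bar> \<Longrightarrow> norm (Gamma s) \<le> K * exp (- \<eta> * \<bar>Im s\<bar>)"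
    using norm_Gamma_strip[OF \<eta>(1,2)] by blast
  define K' where "K' = K * exp ((real N + real n + 1) * \<bar>Re L\<bar>)"
  have main: "norm (Gamma s * exp (- s * L)) \<le> K' * exp (- (\<eta> - \<bar>Im L\<bar>) * \<bar>Im s\<bar>)"
    if "norm (Gamma s) \<le> K * exp (- \<eta> * \<bar>Im s\<bar>)" "\<bar>Re s\<bar> \<le> real N + real n + 1" for s
  proof -
    have "\<bar>Re s * Re L\<bar> \<le> (real N + real n + 1) * \<bar>Re L\<bar>"
      unfolding abs_mult using that by (intro mult_right_mono) auto
    hence "exp (- Re s * Re L) \<le> exp ((real N + real n + 1) * \<bar>Re L\<bar>)" by (simp add: abs_le_iff)
    hence "norm (exp (- s * L)) \<le> exp ((real N + real n + 1) * \<bar>Re L\<bar>) * exp (\<bar>Im L\<bar> * \<bar>Im s\<bar>)"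
      by (intro order_trans[OF norm_exp_mult_le] mult_right_mono) auto
    hence "norm (Gamma s * exp (- s * L)) \<le> (K * exp (- \<eta> * \<bar>Im s\<bar>)) * (exp ((real N + real n + 1) * \<bar>Re L\<bar>) * exp (\<bar>Im L\<bar> * \<bar>Im s\<bar>))"
      unfolding norm_mult using that K by (intro mult_mono) auto
    also have "\<dots> = K' * (exp (- \<eta> * \<bar>Im s\<bar>) * exp (\<bar>Im L\<bar> * \<bar>Im s\<bar>))" by (simp add: K'_def)
    also have "exp (- \<eta> * \<bar>Im s\<bar>) * exp (\<bar>Im L\<bar> * \<bar>Im s\<bar>) = exp (- (\<eta> - \<bar>Im L\<bar>) * \<bar>Im s\<bar>)"
      by (simp add: algebra_simps flip: exp_add)
    finally show ?thesis .
  qed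
  show ?thesis
  proof (rule that[of "\<eta> - \<bar>Im L\<bar>" K'])
    show "norm (Gamma s * exp (- s * L)) \<le> K' * exp (- (\<eta> - \<bar>Im L\<bar>) * \<bar>Im s\<bar>)"
      if "1/2 \<le> Re s" "Re s \<le> real N + 1/2" "1 \<le> \<bar>Im s\<bar>" for s
      using that by (intro main K(2)) auto
    show "norm (Gamma s * exp (- s * L)) \<le> K' * exp (- (\<eta> - \<bar>Im L\<bar>) * \<bar>Im s\<bar>)"
      if "- real n - 1/2 \<le> Re s" "Re s \<le> - real n + 1/2" "1 \<le> \<bar>Im s\<bar>" for s
    proof (rule main)
      have "norm (Gamma s) \<le> norm (Gamma (s + of_nat (Suc n)))" using that by (intro norm_Gamma_shift)
      also have "\<dots> \<le> K * exp (- \<eta> * \<bar>Im (s + of_nat (Suc n))\<bar>)" using that by (intro K(2)) auto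
      finally show "norm (Gamma s) \<le> K * exp (- \<eta> * \<bar>Im s\<bar>)" by simp
    qed (use that in auto)
  qed (use \<eta> in auto)
qed

text \<open>Moving the line to the left past the poles of Gamma collects the residues
  \<open>(- exp L) ^ n / fact n\<close>, the terms of the series of \<open>exp (- exp L)\<close>,
  while the remaining integral tends to 0.\<close>

theorem cahen_mellin:
  fixes L :: complex
  assumes L: "\<bar>Im L\<bar> < pi / 2"
  shows "integrable lborel (\<lambda>t. Gamma (Complex (real N + 1/2) t) * exp (- Complex (real N + 1/2) t * L))"
    and "(LINT t|lborel. Gamma (Complex (real N + 1/2) t) * exp (- Complex (real N + 1/2) t * L)) = 2 * pi * exp (- exp L)"
proof -
  define g where "g = (\<lambda>s. Gamma s * exp (- s * L))"
  define J where "J = (\<lambda>\<sigma>. LINT t|lborel. g (Complex \<sigma> t))"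
  have g_holo: "g holomorphic_on A" if "A \<inter> \<int>\<^sub>\<le>\<^sub>0 = {}" for A
    unfolding g_def using that by (intro holomorphic_intros)
  have no_pole: "{s. 0 < Re s} \<inter> \<int>\<^sub>\<le>\<^sub>0 = {}" by (auto elim!: nonpos_Ints_cases)
  obtain K \<delta> where K: "0 < \<delta>"
    "\<And>s. 1/2 \<le> Re s \<Longrightarrow> Re s \<le> real N + 1/2 \<Longrightarrow> 1 \<le> \<bar>Im s\<bar> \<Longrightarrow> norm (g s) \<le> K * exp (- \<delta> * \<bar>Im s\<bar>)"
    unfolding g_def using norm_Gamma_exp_strip[OF L, of N 0] by metis
  show "integrable lborel (\<lambda>t. Gamma (Complex (real N + 1/2) t) * exp (- Complex (real N + 1/2) t * L))"
  proof (rule integrable_exp_decay[where T = 1 and C = K, OF _ K(1)])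
    show "continuous_on UNIV (\<lambda>t. Gamma (Complex (real N + 1/2) t) * exp (- Complex (real N + 1/2) t * L))"
      using continuous_on_vertical_line[OF g_holo[OF no_pole], of "real N + 1/2"] by (simp add: g_def)
    show "norm (Gamma (Complex (real N + 1/2) t) * exp (- Complex (real N + 1/2) t * L)) \<le> K * exp (- \<delta> * \<bar>t\<bar>)"
      if "1 \<le> \<bar>t\<bar>" for t using K(2)[of "Complex (real N + 1/2) t"] that by (simp add: g_def)
  qed
  \<comment> \<open>No pole lies between these lines; the shift lemma is used at the regular point
    1, where the residue is 0.\<close>
  have right: "J (real N + 1/2) = J (1/2)"
  proof (cases "N = 0")
    case False
    have "J (real N + 1/2) - J (1/2) = 2 * pi * residue g 1"
      unfolding J_def
    proof (rule vertical_line_shift[where \<alpha>' = 0 and \<beta>' = "real N + 1"])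
      have "{s. 0 < Re s \<and> Re s < real N + 1} - {1} \<subseteq> {s. 0 < Re s}" by auto
      thus "g holomorphic_on {s. 0 < Re s \<and> Re s < real N + 1} - {1}"
        using g_holo[OF no_pole] holomorphic_on_subset by blast
    qed (use K False in auto)
    also have "residue g 1 = 0"
      by (rule residue_holo[OF _ _ g_holo[OF no_pole]]) (auto simp: open_halfspace_Re_gt)
    finally show ?thesis by simp
  qed simp
  have step: "J (1/2 - real n) - J (1/2 - real (Suc n)) = 2 * pi * ((- exp L) ^ n / fact n)" for n
  proof -
    obtain K \<delta> where K: "0 < \<delta>"
      "\<And>s. - real n - 1/2 \<le> Re s \<Longrightarrow> Re s \<le> - real n + 1/2 \<Longrightarrow> 1 \<le> \<bar>Im s\<bar> \<Longrightarrow> norm (g s) \<le> K * exp (- \<delta> * \<bar>Im s\<bar>)"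
      unfolding g_def using norm_Gamma_exp_strip[OF L, of 0 n] by metis
    \<comment> \<open>The margin 3/4 exceeds the 1/2 needed to contain both lines and stays below
      the distance 1 to the neighbouring poles.\<close>
    let ?S = "{s. - real n - 3/4 < Re s \<and> Re s < - real n + 3/4}"
    have "s = - of_nat n" if s: "s \<in> ?S" "s \<in> \<int>\<^sub>\<le>\<^sub>0" for s
    proof -
      obtain k where k: "s = - of_nat k" using s(2) by (auto elim!: nonpos_Ints_cases')
      with s have "real k < real n + 1" "real n < real k + 1" by simp_all
      hence "k = n" by linarith
      with k show ?thesis by simp
    qed
    hence "(?S - {- of_nat n}) \<inter> \<int>\<^sub>\<le>\<^sub>0 = {}" by blast
    hence holo: "g holomorphic_on ?S - {- of_nat n}" by (rule g_holo)
    have J1: "1/2 - real n = - real n + 1/2" "1/2 - real (Suc n) = - real n - 1/2" by simp_all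
    have "J (1/2 - real n) - J (1/2 - real (Suc n)) = 2 * pi * residue g (- of_nat n)"
      unfolding J_def J1 by (rule vertical_line_shift[OF _ _ _ _ holo K(1,2)]) auto
    also have "residue g (- of_nat n) = (- exp L) ^ n / fact n"
    proof (rule residue_simple'[OF open_vertical_strip _ holo])
      have "((\<lambda>w. exp (- w * L) * (Gamma w * (w + of_nat n))) \<longlongrightarrow>
              exp (- (- of_nat n) * L) * ((- 1) ^ n / fact n)) (at (- of_nat n))"
        by (intro tendsto_intros Gamma_residues)
      also have "exp (- (- of_nat n) * L) * ((- 1) ^ n / fact n) = (- exp L) ^ n / fact n"
        by (simp add: exp_of_nat_mult power_minus[of "exp L"])
      finally show "((\<lambda>w. g w * (w - - of_nat n)) \<longlongrightarrow> (- exp L) ^ n / fact n) (at (- of_nat n))"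
        by (simp add: g_def mult_ac)
    qed auto
    finally show ?thesis .
  qed
  have partial: "J (1/2) = 2 * pi * (\<Sum>k<n. (- exp L) ^ k / fact k) + J (1/2 - real n)" for n
  proof (induction n)
    case (Suc n)
    thus ?case using step[of n] by (simp add: algebra_simps)
  qed simp
  \<comment> \<open>The factorial in \<open>norm_Gamma_half_minus\<close> outweighs the geometric
    growth of \<open>(2 * exp (Re L)) ^ n\<close>.\<close>
  have "(\<lambda>n. J (1/2 - real n)) \<longlonglongrightarrow> 0"
  proof -
    define \<delta> where "\<delta> = pi / 2 - \<bar>Im L\<bar>"
    have \<delta>: "\<delta> > 0" using L by (simp add: \<delta>_def)
    define D where "D = sqrt (2 * pi) * exp (- Re L / 2)"
    have D: "D \<ge> 0" by (simp add: D_def)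
    have bnd: "norm (g (Complex (1/2 - real n) t)) \<le> (2 * exp (Re L)) ^ n / fact n * D * exp (- \<delta> * \<bar>t\<bar>)" for n t
    proof -
      let ?s = "Complex (1/2 - real n) t"
      have "norm (g ?s) \<le> (2 ^ n / fact n * sqrt (2 * pi) * exp (- (pi / 2) * \<bar>t\<bar>)) * (exp (- Re ?s * Re L) * exp (\<bar>Im L\<bar> * \<bar>Im ?s\<bar>))"
        unfolding g_def norm_mult by (intro mult_mono norm_Gamma_half_minus norm_exp_mult_le) auto
      also have "exp (- Re ?s * Re L) = exp (- Re L / 2) * exp (Re L) ^ n"
        by (simp add: algebra_simps diff_divide_distrib flip: exp_add exp_of_nat_mult)
      also have "(2 ^ n / fact n * sqrt (2 * pi) * exp (- (pi / 2) * \<bar>t\<bar>)) * (exp (- Re L / 2) * exp (Re L) ^ n * exp (\<bar>Im L\<bar> * \<bar>Im ?s\<bar>))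
          = (2 * exp (Re L)) ^ n / fact n * D * (exp (- (pi / 2) * \<bar>t\<bar>) * exp (\<bar>Im L\<bar> * \<bar>t\<bar>))"
        by (simp add: D_def power_mult_distrib mult_ac)
      also have "exp (- (pi / 2) * \<bar>t\<bar>) * exp (\<bar>Im L\<bar> * \<bar>t\<bar>) = exp (- \<delta> * \<bar>t\<bar>)"
        by (simp add: \<delta>_def algebra_simps flip: exp_add)
      finally show ?thesis .
    qed
    have Jb: "norm (J (1/2 - real n)) \<le> (2 * exp (Re L)) ^ n / fact n * (D * (LINT t|lborel. exp (- \<delta> * \<bar>t\<bar>)))" for n
    proof -
      have "norm (J (1/2 - real n)) \<le> (LINT t|lborel. norm (g (Complex (1/2 - real n) t)))"
        unfolding J_def by (rule integral_norm_bound)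
      also have "\<dots> \<le> (LINT t|lborel. (2 * exp (Re L)) ^ n / fact n * D * exp (- \<delta> * \<bar>t\<bar>))"
        using bnd D integrable_exp_neg_abs[OF \<delta>]
        by (intro integral_mono_AE' AE_I2) (auto intro!: integrable_mult_right simp del: mult_minus_left)
      finally show ?thesis by simp
    qed
    have "(\<lambda>n. (2 * exp (Re L)) ^ n / fact n) \<longlonglongrightarrow> 0"
      using summable_LIMSEQ_zero[OF summable_exp[of "2 * exp (Re L)"]] by (simp add: divide_inverse mult.commute)
    hence "(\<lambda>n. (2 * exp (Re L)) ^ n / fact n * (D * (LINT t|lborel. exp (- \<delta> * \<bar>t\<bar>)))) \<longlonglongrightarrow> 0"
      by (rule tendsto_mult_left_zero)
    thus ?thesis by (rule Lim_null_comparison[rotated]) (use Jb in \<open>auto intro: always_eventually\<close>)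
  qed
  moreover have "(\<lambda>n. \<Sum>k<n. (- exp L) ^ k / fact k) \<longlonglongrightarrow> exp (- exp L)"
    using exp_converges[of "- exp L"] by (simp add: sums_def scaleR_conv_of_real divide_inverse mult.commute)
  ultimately have "(\<lambda>n. 2 * pi * (\<Sum>k<n. (- exp L) ^ k / fact k) + J (1/2 - real n)) \<longlonglongrightarrow> 2 * pi * exp (- exp L) + 0"
    by (intro tendsto_intros)
  hence "(\<lambda>n. J (1/2)) \<longlonglongrightarrow> 2 * pi * exp (- exp L)" unfolding partial[symmetric] by simp
  hence "J (1/2) = 2 * pi * exp (- exp L)" using LIMSEQ_unique tendsto_const by blast
  with right show "(LINT t|lborel. Gamma (Complex (real N + 1/2) t) * exp (- Complex (real N + 1/2) t * L)) = 2 * pi * exp (- exp L)"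
    by (simp add: J_def g_def)
qed

section \<open>Completed Dirichlet series on the critical line\<close>

lemma powr_le_exp:
  assumes "0 < (y::real)" "0 < c"
  shows "y powr c \<le> c powr c * exp y"
proof -
  have "y / c \<le> exp (y / c)" using exp_ge_add_one_self[of "y / c"] by linarith
  hence "(y / c) powr c \<le> exp (y / c) powr c" using assms by (intro powr_mono2) auto
  also have "\<dots> = exp y" using assms by (simp add: powr_def)
  finally show ?thesis using assms by (simp add: powr_divide field_simps)
qed

text \<open>Trades an exponential for a power, so that absolute convergence of a Dirichlet series
  controls the associated exponential series.\<close>

lemma exp_neg_le_powr:
  assumes "0 < (x::real)" "0 < y" "0 < c"
  shows "exp (- (y * x)) \<le> c powr c * x powr (- c) * y powr (- c)"
proof -
  have "(y * x) powr c \<le> c powr c * exp (y * x)" using assms by (intro powr_le_exp) auto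
  hence "y powr c * x powr c * exp (- (y * x)) \<le> c powr c"
    using assms by (simp add: powr_mult exp_minus field_simps)
  thus ?thesis using assms by (simp add: powr_minus field_simps)
qed

text \<open>The hypothesis of Fubini's theorem for a Fourier-type kernel: a factor of modulus 1 does
  not affect absolute integrability of a product.\<close>

lemma integrable_mult_pair:
  fixes f g :: "real \<Rightarrow> complex" and e :: "real \<Rightarrow> real \<Rightarrow> complex"
  assumes f: "integrable lborel f" and g: "integrable lborel g"
    and e: "continuous_on UNIV (\<lambda>(x, y). e x y)" "\<And>x y. norm (e x y) = 1"
  shows "integrable (lborel \<Otimes>\<^sub>M lborel) (\<lambda>(x, y). f x * g y * e x y)"
proof -
  have fm [measurable]: "f \<in> borel_measurable borel" and gm [measurable]: "g \<in> borel_measurable borel"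
    using f g by (auto dest: borel_measurable_integrable)
  have em [measurable]: "(\<lambda>(x, y). e x y) \<in> borel_measurable (borel \<Otimes>\<^sub>M borel)"
    unfolding borel_prod using e(1) by (rule borel_measurable_continuous_onI)
  show ?thesis
  proof (rule lborel_pair.Fubini_integrable)
    show "(\<lambda>(x, y). f x * g y * e x y) \<in> borel_measurable (lborel \<Otimes>\<^sub>M lborel)"
      by (simp add: split_beta') measurable
    show "integrable lborel (\<lambda>x. LINT y|lborel. norm (case (x, y) of (x, y) \<Rightarrow> f x * g y * e x y))"
      using f by (simp add: norm_mult e)
    have "integrable lborel (\<lambda>y. f x * g y * e x y)" for x
    proof (rule Bochner_Integration.integrable_bound[OF integrable_mult_right[OF g, of "f x"]])
      have "(\<lambda>y. e x y) \<in> borel_measurable borel"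
        using continuous_on_compose2[OF e(1) continuous_on_Pair[OF continuous_on_const[of UNIV x] continuous_on_id]]
        by (intro borel_measurable_continuous_onI) auto
      thus "(\<lambda>y. f x * g y * e x y) \<in> borel_measurable lborel" by simp
    qed (auto simp: norm_mult e)
    thus "AE x in lborel. integrable lborel (\<lambda>y. case (x, y) of (x, y) \<Rightarrow> f x * g y * e x y)" by simp
  qed
qed

text \<open>The range ends where the derivative \<open>cos x - 1 / 2\<close> reaches 0.\<close>

lemma half_le_sin:
  assumes "0 \<le> x" "x \<le> pi / 3"
  shows "x / 2 \<le> sin x"
proof -
  have "sin 0 - 0 / 2 \<le> sin x - x / 2"
  proof (rule DERIV_nonneg_imp_nondecreasing[OF assms(1)])
    fix y assume y: "0 \<le> y" "y \<le> x"
    have "cos (pi / 3) \<le> cos y" using y assms by (intro cos_monotone_0_pi_le) auto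
    hence "0 \<le> cos y - 1 / 2" by (simp add: cos_60)
    moreover have "((\<lambda>x. sin x - x / 2) has_real_derivative cos y - 1 / 2) (at y)"
      by (auto intro!: derivative_eq_intros)
    ultimately show "\<exists>d. ((\<lambda>x. sin x - x / 2) has_real_derivative d) (at y) \<and> 0 \<le> d" by blast
  qed
  thus ?thesis by simp
qed

lemma norm_exp_Ln:
  assumes "W \<noteq> 0" "\<bar>Im q\<bar> \<le> M"
  shows "norm (exp (- q * Ln W)) \<le> norm W powr (- Re q) * exp (M * pi)"
proof -
  have "norm (exp (- q * Ln W)) = norm W powr (- Re q) * exp (Im q * Im (Ln W))"
    using assms(1) by (simp add: powr_def algebra_simps flip: exp_add)
  moreover have "Im q * Im (Ln W) \<le> M * pi"
  proof -
    have "\<bar>Im (Ln W)\<bar> \<le> pi" using Im_Ln_le_pi[OF assms(1)] mpi_less_Im_Ln[OF assms(1)] by linarith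
    hence "\<bar>Im q\<bar> * \<bar>Im (Ln W)\<bar> \<le> M * pi" using assms(2) by (intro mult_mono) auto
    thus ?thesis by (simp flip: abs_mult)
  qed
  ultimately show ?thesis by (simp add: mult_left_mono)
qed

text \<open>
  Here \<open>a n\<close> and \<open>l n\<close> stand for the coefficient and exponent with index \<open>Suc n\<close>, and \<open>Y\<close>
  for the completed series. The line of absolute convergence is taken at a half-integer, where the
  reflection formula bounds \<open>Gamma\<close> without Stirling's formula.
\<close>

locale completed_dirichlet =
  fixes a :: "nat \<Rightarrow> complex" and l :: "nat \<Rightarrow> real" and Y :: "complex \<Rightarrow> complex"
    and r T :: real and \<rho> :: complex and N :: nat
  assumes l_pos: "\<And>n. 0 < l n"
    and a_summable: "\<And>\<sigma>. real N + 1/2 \<le> \<sigma> \<Longrightarrow> summable (\<lambda>n. norm (a n) * l n powr (- \<sigma>))"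
    and r: "0 < r" "r < real N + 1/2"
    and Y_right: "\<And>t. Y (Complex (real N + 1/2) t) =
      Gamma (Complex (real N + 1/2) t) * (\<Sum>n. a n * exp (- Complex (real N + 1/2) t * of_real (ln (l n))))"
    and Y_holo: "Y holomorphic_on {s. 0 < Re s} - {of_real r}"
    and Y_lim: "((\<lambda>s. Y s * (s - of_real r)) \<longlongrightarrow> \<rho>) (at (of_real r))"
    and Y_decay: "\<And>\<eta>. 0 \<le> \<eta> \<Longrightarrow> \<eta> < pi / 2 \<Longrightarrow> \<exists>K. \<forall>s. r / 2 \<le> Re s \<longrightarrow> Re s \<le> real N + 1/2 \<longrightarrow>
      T \<le> \<bar>Im s\<bar> \<longrightarrow> norm (Y s) \<le> K * exp (- \<eta> * \<bar>Im s\<bar>)"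
begin

abbreviation c :: real where "c \<equiv> real N + 1/2"

text \<open>The argument is a logarithm of the variable of the theta series, so that its powers can
  be written \<open>exp (- s * L)\<close>.\<close>

definition theta :: "complex \<Rightarrow> complex" where
  "theta L = (\<Sum>n. a n * exp (- (of_real (l n) * exp L)))"

definition Z :: "real \<Rightarrow> complex" where "Z t = Y (Complex (r / 2) t)"

lemma c_pos: "c > 0" by (simp add: add_nonneg_pos)

lemma Re_exp_pos: "\<bar>Im L\<bar> < pi / 2 \<Longrightarrow> 0 < Re (exp L)"
  unfolding Re_exp by (intro mult_pos_pos cos_gt_zero_pi) auto

lemma theta_term_bound:
  fixes L :: complex
  assumes "\<bar>Im L\<bar> < pi / 2" "0 < \<sigma>"
  shows "norm (a n * exp (- (of_real (l n) * exp L))) \<le>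
    \<sigma> powr \<sigma> * Re (exp L) powr (- \<sigma>) * (norm (a n) * l n powr (- \<sigma>))"
proof -
  have "exp (- (l n * Re (exp L))) \<le> \<sigma> powr \<sigma> * Re (exp L) powr (- \<sigma>) * l n powr (- \<sigma>)"
    using Re_exp_pos[OF assms(1)] l_pos assms(2) by (intro exp_neg_le_powr) auto
  from mult_left_mono[OF this, of "norm (a n)"] show ?thesis
    by (simp add: norm_mult mult_ac)
qed

lemma theta_summable:
  fixes L :: complex
  assumes "\<bar>Im L\<bar> < pi / 2"
  shows "summable (\<lambda>n. norm (a n * exp (- (of_real (l n) * exp L))))"
proof (rule summable_comparison_test')
  show "summable (\<lambda>n. c powr c * Re (exp L) powr (- c) * (norm (a n) * l n powr (- c)))"
    by (intro summable_mult a_summable) simp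
  show "norm (norm (a n * exp (- (of_real (l n) * exp L)))) \<le>
      c powr c * Re (exp L) powr (- c) * (norm (a n) * l n powr (- c))" if "n \<ge> 0" for n
    using theta_term_bound[OF assms c_pos] by simp
qed

text \<open>Termwise Cahen-Mellin at \<open>L + ln (l n)\<close>. On a vertical line the modulus of
  each term is a fixed function of \<open>t\<close> times
  \<open>norm (a n) * l n powr (- c)\<close>, which settles both summability conditions for the
  exchange.\<close>

lemma theta_integral:
  fixes L :: complex
  assumes L: "\<bar>Im L\<bar> < pi / 2"
  shows "(LINT t|lborel. Y (Complex c t) * exp (- Complex c t * L)) = 2 * pi * theta L"
proof -
  define f where "f = (\<lambda>n t. a n * (Gamma (Complex c t) * exp (- Complex c t * (L + of_real (ln (l n))))))"
  have L': "\<bar>Im (L + of_real (ln (l n)))\<bar> < pi / 2" for n using L by simp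
  have f_eq: "f n t = (Gamma (Complex c t) * exp (- Complex c t * L)) * (a n * exp (- Complex c t * of_real (ln (l n))))" for n t
  proof -
    have "exp (- s * (L + x)) = exp (- s * L) * exp (- s * x)" for s x :: complex
      unfolding distrib_left by (rule exp_add)
    thus ?thesis by (simp only: f_def mult.assoc mult.left_commute)
  qed
  have nrm: "norm (exp (- Complex c t * of_real (ln (l n)))) = l n powr (- c)" for n t
    using l_pos[of n] by (simp add: powr_def algebra_simps)
  have f_norm: "norm (f n t) = norm (Gamma (Complex c t) * exp (- Complex c t * L)) * (norm (a n) * l n powr (- c))" for n t
    unfolding f_eq norm_mult nrm by simp
  have int: "integrable lborel (f n)" for n
    unfolding f_def by (rule integrable_mult_right[OF cahen_mellin(1)[OF L']])
  have S1: "AE t in lborel. summable (\<lambda>n. norm (f n t))"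
    unfolding f_norm by (intro AE_I2 summable_mult a_summable) simp
  have S2: "summable (\<lambda>n. LINT t|lborel. norm (f n t))"
    unfolding f_norm by (simp only: integral_mult_left_zero) (intro summable_mult a_summable, simp)
  have f_val: "(LINT t|lborel. f n t) = 2 * pi * (a n * exp (- (of_real (l n) * exp L)))" for n
    unfolding f_def using cahen_mellin(2)[OF L'[of n], of N] l_pos[of n]
    by (simp add: exp_add exp_of_real mult_ac)
  have "summable (\<lambda>n. a n * exp (- Complex c t * of_real (ln (l n))))" for t
  proof (rule summable_norm_cancel)
    show "summable (\<lambda>n. norm (a n * exp (- Complex c t * of_real (ln (l n)))))"
      unfolding norm_mult nrm by (intro a_summable) simp
  qed
  hence "(\<Sum>n. f n t) = Y (Complex c t) * exp (- Complex c t * L)" for t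
    unfolding f_eq Y_right by (subst suminf_mult) (auto simp: mult_ac)
  hence "(LINT t|lborel. Y (Complex c t) * exp (- Complex c t * L)) = (LINT t|lborel. (\<Sum>n. f n t))" by simp
  also have "\<dots> = (\<Sum>n. (LINT t|lborel. f n t))" by (rule integral_suminf[OF int S1 S2])
  also have "(\<Sum>n. (LINT t|lborel. f n t)) = (\<Sum>n. 2 * pi * (a n * exp (- (of_real (l n) * exp L))))"
    unfolding f_val ..
  also have "(\<Sum>n. 2 * pi * (a n * exp (- (of_real (l n) * exp L)))) = 2 * pi * theta L"
    unfolding theta_def by (rule suminf_mult[OF summable_norm_cancel[OF theta_summable[OF L]]])
  finally show ?thesis .
qed

lemma Z_continuous: "continuous_on A Z"
  unfolding Z_def by (rule continuous_on_vertical_line[OF Y_holo]) (use r in \<open>auto simp: complex_eq_iff\<close>)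

lemma Z_bound:
  assumes "0 \<le> \<eta>" "\<eta> < pi / 2"
  obtains K where "0 \<le> K" "\<And>t. norm (Z t) \<le> K * exp (- \<eta> * \<bar>t\<bar>)"
proof -
  obtain K where K: "\<And>s. r / 2 \<le> Re s \<Longrightarrow> Re s \<le> c \<Longrightarrow> T \<le> \<bar>Im s\<bar> \<Longrightarrow> norm (Y s) \<le> K * exp (- \<eta> * \<bar>Im s\<bar>)"
    using Y_decay[OF assms] by blast
  show ?thesis
  proof (rule exp_decay_bound[OF Z_continuous, of T K \<eta>])
    show "norm (Z t) \<le> K * exp (- \<eta> * \<bar>t\<bar>)" if "T \<le> \<bar>t\<bar>" for t
      unfolding Z_def using K[of "Complex (r / 2) t"] that r by simp
  qed (rule that)
qed

lemma Z_exp_integrable: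
  assumes "\<bar>x\<bar> < pi / 2"
  shows "integrable lborel (\<lambda>t. Z (t + \<tau>) * exp (of_real (x * t)))"
proof -
  obtain \<eta> where \<eta>: "\<bar>x\<bar> < \<eta>" "\<eta> < pi / 2" using dense[OF assms] by blast
  have "0 \<le> \<eta>" using \<eta>(1) by linarith
  then obtain K where K: "0 \<le> K" "\<And>t. norm (Z t) \<le> K * exp (- \<eta> * \<bar>t\<bar>)"
    using Z_bound[OF _ \<eta>(2)] by blast
  have "integrable lborel (\<lambda>t. Z t * exp (of_real (x * t)))" by (rule integrable_mult_exp[OF Z_continuous \<eta>(1) K])
  from lborel_integrable_real_affine[OF this, of 1 \<tau>]
  have "integrable lborel (\<lambda>t. exp (- of_real (x * \<tau>)) * (Z (\<tau> + t) * exp (of_real (x * (\<tau> + t)))))" by simp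
  thus ?thesis by (simp add: algebra_simps flip: exp_add)
qed

text \<open>Moving the line from \<open>c\<close> to \<open>r / 2\<close> crosses the possible pole
  at \<open>r\<close>, whence the correction with \<rho>; the factor \<open>exp (r / 2 * L)\<close>
  is the constant real part of the exponent taken out.\<close>

lemma Z_integral:
  fixes L :: complex
  assumes L: "\<bar>Im L\<bar> < pi / 2"
  shows "(LINT t|lborel. Z t * exp (- \<i> * t * L)) = 2 * pi * exp (r / 2 * L) * (theta L - \<rho> * exp (- r * L))"
proof -
  define f where "f = (\<lambda>s. Y s * exp (- s * L))"
  define \<eta> where "\<eta> = (\<bar>Im L\<bar> + pi / 2) / 2"
  have \<eta>: "0 \<le> \<eta>" "\<eta> < pi / 2" "\<bar>Im L\<bar> < \<eta>" using L by (auto simp: \<eta>_def)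
  obtain K where K: "\<And>s. r / 2 \<le> Re s \<Longrightarrow> Re s \<le> c \<Longrightarrow> T \<le> \<bar>Im s\<bar> \<Longrightarrow> norm (Y s) \<le> K * exp (- \<eta> * \<bar>Im s\<bar>)"
    using Y_decay[OF \<eta>(1,2)] by blast
  have holo: "f holomorphic_on {s. 0 < Re s \<and> Re s < c + 1} - {of_real r}"
    unfolding f_def by (intro holomorphic_intros holomorphic_on_subset[OF Y_holo]) auto
  have "(LINT t|lborel. f (Complex c t)) - (LINT t|lborel. f (Complex (r / 2) t)) = 2 * pi * residue f (of_real r)"
  proof (rule vertical_line_shift[OF _ _ _ _ holo])
    show "0 < \<eta> - \<bar>Im L\<bar>" using \<eta> by simp
    show "norm (f s) \<le> \<bar>K\<bar> * exp (c * \<bar>Re L\<bar>) * exp (- (\<eta> - \<bar>Im L\<bar>) * \<bar>Im s\<bar>)"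
      if s: "r / 2 \<le> Re s" "Re s \<le> c" "T \<le> \<bar>Im s\<bar>" for s
    proof -
      have "norm (Y s) \<le> \<bar>K\<bar> * exp (- \<eta> * \<bar>Im s\<bar>)"
        using K[OF s] by (rule order_trans) (intro mult_right_mono, auto)
      moreover have "norm (exp (- s * L)) \<le> exp (c * \<bar>Re L\<bar>) * exp (\<bar>Im L\<bar> * \<bar>Im s\<bar>)"
      proof -
        have "\<bar>Re s * Re L\<bar> \<le> c * \<bar>Re L\<bar>" unfolding abs_mult using s r by (intro mult_right_mono) auto
        hence "- Re s * Re L \<le> c * \<bar>Re L\<bar>" by (simp add: abs_le_iff)
        hence "exp (- Re s * Re L) \<le> exp (c * \<bar>Re L\<bar>)" by simp
        thus ?thesis by (intro order_trans[OF norm_exp_mult_le] mult_right_mono) auto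
      qed
      ultimately have "norm (f s) \<le> (\<bar>K\<bar> * exp (- \<eta> * \<bar>Im s\<bar>)) * (exp (c * \<bar>Re L\<bar>) * exp (\<bar>Im L\<bar> * \<bar>Im s\<bar>))"
        unfolding f_def norm_mult by (intro mult_mono) auto
      also have "\<dots> = \<bar>K\<bar> * exp (c * \<bar>Re L\<bar>) * (exp (- \<eta> * \<bar>Im s\<bar>) * exp (\<bar>Im L\<bar> * \<bar>Im s\<bar>))" by simp
      also have "exp (- \<eta> * \<bar>Im s\<bar>) * exp (\<bar>Im L\<bar> * \<bar>Im s\<bar>) = exp (- (\<eta> - \<bar>Im L\<bar>) * \<bar>Im s\<bar>)"
        by (simp add: algebra_simps flip: exp_add)
      finally show ?thesis .
    qed
  qed (use r in auto)
  also have "residue f (of_real r) = \<rho> * exp (- r * L)"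
  proof (rule residue_simple'[OF open_halfspace_Re_gt[of 0]])
    show "f holomorphic_on {s. 0 < Re s} - {complex_of_real r}"
      unfolding f_def by (intro holomorphic_intros Y_holo)
    have "((\<lambda>w. (Y w * (w - of_real r)) * exp (- w * L)) \<longlongrightarrow> \<rho> * exp (- of_real r * L)) (at (of_real r))"
      by (intro tendsto_intros Y_lim)
    thus "((\<lambda>w. f w * (w - of_real r)) \<longlongrightarrow> \<rho> * exp (- r * L)) (at (of_real r))"
      by (simp add: f_def mult_ac)
  qed (use r in auto)
  finally have eq: "(LINT t|lborel. f (Complex (r / 2) t)) = 2 * pi * (theta L - \<rho> * exp (- r * L))"
    using theta_integral[OF L] unfolding f_def by (simp add: algebra_simps)
  have fZ: "f (Complex (r / 2) t) = exp (- (r / 2 * L)) * (Z t * exp (- \<i> * t * L))" for t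
  proof -
    have "- Complex (r / 2) t * L = - (r / 2 * L) + (- \<i> * t * L)" by (simp add: Complex_eq algebra_simps)
    thus ?thesis unfolding f_def Z_def by (simp only: exp_add) simp
  qed
  have "exp (- (r / 2 * L)) * (LINT t|lborel. Z t * exp (- \<i> * t * L)) = 2 * pi * (theta L - \<rho> * exp (- r * L))"
    using eq unfolding fZ by simp
  hence "exp (r / 2 * L) * (exp (- (r / 2 * L)) * (LINT t|lborel. Z t * exp (- \<i> * t * L)))
       = exp (r / 2 * L) * (2 * pi * (theta L - \<rho> * exp (- r * L)))" by simp
  thus ?thesis by (simp add: mult.assoc[symmetric] mult_exp_exp)
qed

section \<open>Pairing with the test function\<close>

definition test :: "real \<Rightarrow> real \<Rightarrow> real \<Rightarrow> complex" where
  "test \<nu> \<theta> t = Gamma (of_real c - \<i> * t) * exp (- (of_real c - \<i> * t) * (of_real (ln \<nu>) - \<i> * \<theta>))"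

text \<open>The closed form in the definition serves the size estimate; this integral form serves
  the exchange of integrals.\<close>

lemma test_integral:
  assumes "0 < \<nu>" "\<bar>\<theta>\<bar> < pi / 2"
  shows "test \<nu> \<theta> t = (LINT v|lborel. exp ((of_real c - \<i> * t) * v - exp (of_real (ln \<nu>) - \<i> * \<theta> + complex_of_real v)))"
  unfolding test_def using c_pos assms
  by (intro Gamma_integral_half_plane(2)[symmetric]) auto

text \<open>The abscissa \<open>c\<close> comes from the test function, \<open>r / 2\<close> and
  \<tau> from the shifted critical line; together they are the exponent of the Gamma integrals
  produced by the pairing.\<close>

definition test_exponent :: "real \<Rightarrow> complex" where "test_exponent \<tau> = Complex (c + r / 2) \<tau>"

text \<open>
  Multiplying by the test function and integrating amounts to pairing \<open>theta\<close> on the ray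
  of angle \<open>\<theta>\<close> with \<open>exp (- \<nu> exp (- \<i> \<theta>) y)\<close>, which cancels the oscillation of the
  terms with \<open>l n = \<nu>\<close>.
\<close>

lemma Z_test_integral:
  fixes q \<omega> :: complex and W :: "nat \<Rightarrow> complex" and \<nu> \<theta> \<tau> :: real
  assumes lam: "0 < \<nu>" and \<theta>: "0 < \<theta>" "\<theta> < pi / 2"
  defines "q \<equiv> test_exponent \<tau>" and "\<omega> \<equiv> of_real (ln \<nu>) - \<i> * \<theta>"
  defines "W \<equiv> (\<lambda>n. exp \<omega> + of_real (l n) * exp (\<i> * of_real \<theta>))"
  shows "(LINT t|lborel. Z (t + \<tau>) * exp (of_real (\<theta> * t)) * test \<nu> \<theta> t) =
    2 * pi * exp (\<i> * \<theta> * (q - c)) * ((\<Sum>n. a n * (Gamma q * exp (- q * Ln (W n))))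
      - \<rho> * exp (- (\<i> * \<theta> * r)) * (Gamma (q - r) * exp (- (q - r) * \<omega>)))"
    and "summable (\<lambda>n. norm (a n * (Gamma q * exp (- q * Ln (W n)))))"
proof -
  have Im\<omega>: "\<bar>Im \<omega>\<bar> < pi / 2" using \<theta> by (simp add: \<omega>_def)
  have cos: "cos \<theta> > 0" using \<theta> by (intro cos_gt_zero_pi) auto
  have ReW: "Re (W n) \<ge> l n * cos \<theta>" "Re (W n) > 0" for n
  proof -
    have "Re (W n) = Re (exp \<omega>) + l n * cos \<theta>" by (simp add: W_def Re_exp Im_exp)
    moreover have "l n * cos \<theta> > 0" using cos l_pos by simp
    ultimately show "Re (W n) \<ge> l n * cos \<theta>" "Re (W n) > 0" using Re_exp_pos[OF Im\<omega>] by linarith+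
  qed
  have Req: "Re q = c + r / 2" "Re q > 0" using r c_pos by (auto simp: q_def test_exponent_def)
  define f where "f = (\<lambda>v::real. exp (of_real c * v - exp (\<omega> + v)))"
  define g where "g = (\<lambda>t. Z (t + \<tau>) * exp (of_real (\<theta> * t)))"
  define e where "e = (\<lambda>v t::real. exp (- \<i> * of_real (t * v)))"
  have f_int: "integrable lborel f" unfolding f_def
    using c_pos by (intro Gamma_integral_half_plane(1)[OF _ Im\<omega>]) auto
  have g_int: "integrable lborel g" unfolding g_def using \<theta> by (intro Z_exp_integrable) auto
  have e: "continuous_on UNIV (\<lambda>(x, y). e x y)" "norm (e x y) = 1" for x y
    by (auto simp: e_def case_prod_unfold intro!: continuous_intros)
  have fge: "f v * g t * e v t = g t * exp ((of_real c - \<i> * t) * v - exp (\<omega> + of_real v))" for v t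
  proof -
    have "exp ((of_real c - \<i> * t) * v - exp (\<omega> + of_real v)) = f v * e v t"
      unfolding f_def e_def by (simp add: algebra_simps flip: exp_add)
    thus ?thesis by simp
  qed
  have "(LINT t|lborel. g t * test \<nu> \<theta> t) = (LINT t|lborel. (LINT v|lborel. f v * g t * e v t))"
    unfolding fge using lam \<theta> by (simp add: test_integral \<omega>_def)
  also have "\<dots> = (LINT v|lborel. (LINT t|lborel. f v * g t * e v t))"
    by (rule lborel_pair.Fubini_integral) (use integrable_mult_pair[OF f_int g_int e] in \<open>simp add: case_prod_unfold\<close>)
  also have "\<dots> = (LINT v|lborel. 2 * pi * exp (\<i> * \<theta> * (q - c)) *
      ((\<Sum>n. a n * exp (q * v - W n * exp (complex_of_real v))) -
       \<rho> * exp (- (\<i> * \<theta> * r)) * exp ((q - r) * v - exp (\<omega> + of_real v))))"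
  proof (rule Bochner_Integration.integral_cong[OF refl])
    fix v :: real
    \<comment> \<open>With \<open>v\<close> the logarithm of the radius, \<open>exp L\<close> runs
      along the ray of angle \<theta>.\<close>
    define L where "L = of_real v + \<i> * \<theta>"
    have L: "\<bar>Im L\<bar> < pi / 2" using \<theta> by (simp add: L_def)
    have "(LINT t|lborel. f v * g t * e v t) = f v * (LINT t|lborel. g t * e v t)"
      by (simp add: mult.assoc)
    also have "(LINT t|lborel. g t * e v t) = (LINT t|lborel. Z (t + \<tau>) * exp (- \<i> * t * L))"
      unfolding g_def e_def L_def
      by (intro Bochner_Integration.integral_cong refl) (simp add: algebra_simps flip: exp_add)
    \<comment> \<open>Once the shift is moved into the kernel, \<tau> survives only in
      \<open>exp (\<i> * \<tau> * L)\<close>, which becomes part of the exponent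
      \<open>q\<close>.\<close>
    also have "\<dots> = (LINT t|lborel. Z t * exp (- \<i> * (t - \<tau>) * L))"
      using lborel_integral_real_affine[of 1 "\<lambda>t. Z t * exp (- \<i> * (t - \<tau>) * L)" \<tau>]
      by (simp add: add.commute)
    also have "\<dots> = (LINT t|lborel. exp (\<i> * \<tau> * L) * (Z t * exp (- \<i> * t * L)))"
      by (intro Bochner_Integration.integral_cong refl) (simp add: algebra_simps flip: exp_add)
    also have "\<dots> = exp (\<i> * \<tau> * L) * (2 * pi * exp (r / 2 * L) * (theta L - \<rho> * exp (- r * L)))"
      using Z_integral[OF L] by simp
    finally have 1: "(LINT t|lborel. f v * g t * e v t) = 2 * pi * (f v * exp (\<i> * \<tau> * L) * exp (r / 2 * L)) *
      (theta L - \<rho> * exp (- r * L))" by (simp add: mult_ac)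
    have qc: "q = c + r / 2 + \<i> * \<tau>" by (simp add: q_def test_exponent_def Complex_eq)
    have 2: "f v * exp (\<i> * \<tau> * L) * exp (r / 2 * L) = exp (\<i> * \<theta> * (q - c)) * exp (q * v - exp (\<omega> + of_real v))"
      unfolding f_def qc L_def by (simp add: algebra_simps flip: exp_add)
    \<comment> \<open>The exponential of the test function and that of the n-th theta term share the
      factor \<open>exp v\<close>, so they merge into one Gamma integrand with parameter
      \<open>W n\<close>.\<close>
    have 5: "exp (q * v - exp (\<omega> + of_real v)) * (a n * exp (- (of_real (l n) * exp L)))
        = a n * exp (q * v - W n * exp (complex_of_real v))" for n
      unfolding W_def L_def by (simp add: algebra_simps flip: exp_add)
    have "exp (q * v - exp (\<omega> + of_real v)) * theta L = (\<Sum>n. exp (q * v - exp (\<omega> + of_real v)) * (a n * exp (- (of_real (l n) * exp L))))"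
      unfolding theta_def by (rule suminf_mult[OF summable_norm_cancel[OF theta_summable[OF L]], symmetric])
    hence 3: "exp (q * v - exp (\<omega> + of_real v)) * theta L = (\<Sum>n. a n * exp (q * v - W n * exp (complex_of_real v)))"
      unfolding 5 .
    have 4: "exp (q * v - exp (\<omega> + of_real v)) * (\<rho> * exp (- r * L)) =
        \<rho> * exp (- (\<i> * \<theta> * r)) * exp ((q - r) * v - exp (\<omega> + of_real v))"
      unfolding L_def by (simp add: algebra_simps flip: exp_add)
    show "(LINT t|lborel. f v * g t * e v t) = 2 * pi * exp (\<i> * \<theta> * (q - c)) *
      ((\<Sum>n. a n * exp (q * v - W n * exp (complex_of_real v))) -
       \<rho> * exp (- (\<i> * \<theta> * r)) * exp ((q - r) * v - exp (\<omega> + of_real v)))"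
      unfolding 1 2 3[symmetric] 4[symmetric] by (simp add: right_diff_distrib mult.assoc)
  qed
  finally have I1: "(LINT t|lborel. g t * test \<nu> \<theta> t) = (LINT v|lborel. 2 * pi * exp (\<i> * \<theta> * (q - c)) *
      ((\<Sum>n. a n * exp (q * v - W n * exp (complex_of_real v))) -
       \<rho> * exp (- (\<i> * \<theta> * r)) * exp ((q - r) * v - exp (\<omega> + of_real v))))" .
  define k where "k = (\<lambda>n v. a n * exp (q * of_real v - W n * exp (complex_of_real v)))"
  have k_int: "integrable lborel (k n)" for n
    unfolding k_def by (intro integrable_mult_right Gamma_integral_Re_pos(1) Req(2) ReW(2))
  have k_val: "(LINT v|lborel. k n v) = a n * (Gamma q * exp (- q * Ln (W n)))" for n
    unfolding k_def using Gamma_integral_Re_pos(2)[OF Req(2) ReW(2), of n] by simp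
  have k_norm: "(LINT v|lborel. norm (k n v)) = norm (a n) * (Gamma (Re q) * Re (W n) powr (- Re q))" for n
    unfolding k_def norm_mult[of "a n"] using Gamma_integral_Re_pos(3)[OF Req(2) ReW(2), of n] by simp
  \<comment> \<open>Sufficient for summability at fixed \<theta>. The power of
    \<open>cos \<theta>\<close> is unbounded near \<open>pi / 2\<close>; uniform bounds are the
    matter of \<open>Z_test_asymptotics\<close>.\<close>
  have k_norm_le: "(LINT v|lborel. norm (k n v)) \<le> Gamma (Re q) * cos \<theta> powr (- Re q) * (norm (a n) * l n powr (- Re q))" for n
  proof -
    have "Re (W n) powr (- Re q) \<le> (l n * cos \<theta>) powr (- Re q)"
      using ReW(1)[of n] cos l_pos[of n] Req by (intro powr_mono2') auto
    also have "\<dots> = l n powr (- Re q) * cos \<theta> powr (- Re q)"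
      using l_pos[of n] cos by (simp add: powr_mult)
    finally have "Gamma (Re q) * Re (W n) powr (- Re q) \<le> Gamma (Re q) * (l n powr (- Re q) * cos \<theta> powr (- Re q))"
      using Gamma_real_pos[OF Req(2)] by (intro mult_left_mono) auto
    from mult_left_mono[OF this, of "norm (a n)"] show ?thesis
      unfolding k_norm by (simp add: mult_ac)
  qed
  have S2: "summable (\<lambda>n. LINT v|lborel. norm (k n v))"
  proof (rule summable_comparison_test')
    show "summable (\<lambda>n. Gamma (Re q) * cos \<theta> powr (- Re q) * (norm (a n) * l n powr (- Re q)))"
      using r by (intro summable_mult a_summable) (simp add: Req)
    show "norm (LINT v|lborel. norm (k n v)) \<le> Gamma (Re q) * cos \<theta> powr (- Re q) * (norm (a n) * l n powr (- Re q))"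
      if "n \<ge> 0" for n using k_norm_le[of n] by (simp add: integral_nonneg_AE)
  qed
  have S1: "AE v in lborel. summable (\<lambda>n. norm (k n v))"
  proof (rule AE_I2)
    fix v :: real
    define L where "L = of_real v + \<i> * \<theta>"
    have L: "\<bar>Im L\<bar> < pi / 2" using \<theta> by (simp add: L_def)
    have "k n v = exp (q * v - exp (\<omega> + of_real v)) * (a n * exp (- (of_real (l n) * exp L)))" for n
      unfolding k_def W_def L_def by (simp add: algebra_simps flip: exp_add)
    thus "summable (\<lambda>n. norm (k n v))"
      unfolding norm_mult[of "exp _" "_ * _"] by (simp only: norm_mult[of "exp (q * v - exp (\<omega> + of_real v))"])
        (intro summable_mult theta_summable L)
  qed
  have ks_int: "integrable lborel (\<lambda>v. \<Sum>n. k n v)" by (rule integrable_suminf[OF k_int S1 S2])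
  have ks_val: "(LINT v|lborel. (\<Sum>n. k n v)) = (\<Sum>n. a n * (Gamma q * exp (- q * Ln (W n))))"
    using integral_suminf[OF k_int S1 S2] unfolding k_val .
  have p: "Re (q - r) > 0" using r by (simp add: Req)
  note p_int = Gamma_integral_half_plane(1)[OF p Im\<omega>] and p_val = Gamma_integral_half_plane(2)[OF p Im\<omega>]
  have "(LINT t|lborel. g t * test \<nu> \<theta> t) = 2 * pi * exp (\<i> * \<theta> * (q - c)) *
      ((LINT v|lborel. (\<Sum>n. k n v)) -
       \<rho> * exp (- (\<i> * \<theta> * r)) * (LINT v|lborel. exp ((q - r) * v - exp (\<omega> + complex_of_real v))))"
  proof -
    have "(\<Sum>n. a n * exp (q * v - W n * exp (complex_of_real v))) = (\<Sum>n. k n v)" for v :: real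
      by (simp add: k_def)
    thus ?thesis unfolding I1 using ks_int p_int by simp
  qed
  thus "(LINT t|lborel. Z (t + \<tau>) * exp (of_real (\<theta> * t)) * test \<nu> \<theta> t) =
    2 * pi * exp (\<i> * \<theta> * (q - c)) * ((\<Sum>n. a n * (Gamma q * exp (- q * Ln (W n))))
      - \<rho> * exp (- (\<i> * \<theta> * r)) * (Gamma (q - r) * exp (- (q - r) * \<omega>)))"
    unfolding ks_val p_val g_def .
  show "summable (\<lambda>n. norm (a n * (Gamma q * exp (- q * Ln (W n)))))"
  proof (rule summable_comparison_test'[OF S2])
    show "norm (norm (a n * (Gamma q * exp (- q * Ln (W n))))) \<le> (LINT v|lborel. norm (k n v))" if "n \<ge> 0" for n
      unfolding k_val[symmetric] by simp
  qed
qed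

text \<open>The factor \<open>exp (\<theta> * t)\<close> consumes all but
  \<open>exp (- \<epsilon> * \<bar>t\<bar>)\<close> of the decay of Gamma, where
  \<open>\<epsilon> = pi / 2 - \<theta>\<close>, and \<open>power_le_exp\<close> trades that
  remainder against \<open>(1 + \<bar>t\<bar>) ^ N\<close>.\<close>

lemma norm_test_le:
  assumes "0 < \<nu>"
  obtains C where "0 \<le> C" "\<And>\<theta> t. 0 < \<theta> \<Longrightarrow> \<theta> < pi / 2 \<Longrightarrow> norm (test \<nu> \<theta> t) \<le> C / (pi / 2 - \<theta>) ^ N"
proof -
  obtain C0 where C0: "0 \<le> C0"
    "\<And>t. norm (Gamma (Complex c t)) \<le> C0 * (1 + \<bar>t\<bar>) ^ N * exp (- (pi / 2) * \<bar>t\<bar>)"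
    using norm_Gamma_half_integer by blast
  define C where "C = \<nu> powr (- c) * (C0 * (fact N * exp (pi / 2)))"
  have "norm (test \<nu> \<theta> t) \<le> C / (pi / 2 - \<theta>) ^ N" if \<theta>: "0 < \<theta>" "\<theta> < pi / 2" for \<theta> t
  proof -
    define \<epsilon> where "\<epsilon> = pi / 2 - \<theta>"
    have \<epsilon>: "0 < \<epsilon>" "\<epsilon> \<le> pi / 2" using \<theta> by (auto simp: \<epsilon>_def)
    have "of_real c - \<i> * t = Complex c (- t)" by (simp add: complex_eq_iff)
    hence "norm (test \<nu> \<theta> t) = norm (Gamma (Complex c (- t))) * norm (exp (- (of_real c - \<i> * t) * (of_real (ln \<nu>) - \<i> * \<theta>)))"
      by (simp add: test_def norm_mult)
    also have "norm (exp (- (of_real c - \<i> * t) * (of_real (ln \<nu>) - \<i> * \<theta>))) = \<nu> powr (- c) * exp (\<theta> * t)"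
      using assms by (simp add: powr_def algebra_simps flip: exp_add)
    also have "norm (Gamma (Complex c (- t))) * (\<nu> powr (- c) * exp (\<theta> * t)) \<le>
        (C0 * (1 + \<bar>t\<bar>) ^ N * exp (- (pi / 2) * \<bar>t\<bar>)) * (\<nu> powr (- c) * exp (\<theta> * \<bar>t\<bar>))"
      using C0(2)[of "- t"] C0(1) \<theta> by (intro mult_mono) auto
    also have "\<dots> = \<nu> powr (- c) * C0 * ((1 + \<bar>t\<bar>) ^ N * (exp (- (pi / 2) * \<bar>t\<bar>) * exp (\<theta> * \<bar>t\<bar>)))" by simp
    also have "\<dots> \<le> \<nu> powr (- c) * C0 * (fact N * exp (pi / 2) / \<epsilon> ^ N)"
    proof (intro mult_left_mono)
      have "exp (- (pi / 2) * \<bar>t\<bar>) * exp (\<theta> * \<bar>t\<bar>) = exp (- \<epsilon> * \<bar>t\<bar>)"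
        by (simp add: \<epsilon>_def algebra_simps flip: exp_add)
      hence "(1 + \<bar>t\<bar>) ^ N * (exp (- (pi / 2) * \<bar>t\<bar>) * exp (\<theta> * \<bar>t\<bar>))
          \<le> (fact N * exp \<epsilon> / \<epsilon> ^ N * exp (\<epsilon> * \<bar>t\<bar>)) * exp (- \<epsilon> * \<bar>t\<bar>)"
        using \<epsilon> by (metis abs_ge_zero exp_ge_zero mult_right_mono power_le_exp)
      also have "\<dots> = fact N * exp \<epsilon> / \<epsilon> ^ N" by (simp add: exp_minus)
      also have "\<dots> \<le> fact N * exp (pi / 2) / \<epsilon> ^ N" using \<epsilon> by (intro divide_right_mono mult_left_mono) auto
      finally show "(1 + \<bar>t\<bar>) ^ N * (exp (- (pi / 2) * \<bar>t\<bar>) * exp (\<theta> * \<bar>t\<bar>)) \<le> fact N * exp (pi / 2) / \<epsilon> ^ N" .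
    qed (use C0 in auto)
    finally show ?thesis by (simp add: C_def \<epsilon>_def mult_ac)
  qed
  moreover have "C \<ge> 0" using C0 by (simp add: C_def)
  ultimately show ?thesis using that by blast
qed

text \<open>For \<open>n \<noteq> n0\<close> the imaginary part keeps \<open>W n\<close> at least
  \<open>k / 2 * l n\<close> in modulus, because \<open>\<theta> \<ge> pi / 6\<close> gives
  \<open>sin \<theta> \<ge> 1 / 2\<close>. The gap \<open>k\<close> is relative to
  \<open>l n\<close>, so the bounds remain summable against \<open>a n\<close>.\<close>

lemma Z_test_asymptotics:
  assumes k: "0 < k" "\<And>n. n \<noteq> n0 \<Longrightarrow> k * l n \<le> \<bar>l n - l n0\<bar>"
  obtains K where "\<And>\<tau> \<theta>. \<bar>\<tau>\<bar> \<le> M \<Longrightarrow> pi / 6 \<le> \<theta> \<Longrightarrow> \<theta> < pi / 2 \<Longrightarrow>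
    norm ((LINT t|lborel. Z (t + \<tau>) * exp (of_real (\<theta> * t)) * test (l n0) \<theta> t) -
      2 * pi * exp (\<i> * \<theta> * (test_exponent \<tau> - c)) *
        (a n0 * (Gamma (test_exponent \<tau>) * exp (- test_exponent \<tau> * of_real (ln (2 * l n0 * cos \<theta>)))))) \<le> K"
proof -
  define p where "p = c + r / 2"
  have p: "0 < p" "c \<le> p" "0 < p - r" "0 < c" using r by (auto simp: p_def)
  define D where "D = Gamma p * ((k / 2) powr (- p) * exp (M * pi))"
  define E where "E = D * (\<Sum>n. norm (a n) * l n powr (- p))"
  define E' where "E' = norm \<rho> * (Gamma (p - r) * (exp (- ((p - r) * ln (l n0))) * exp (2 * M)))"
  have sum_a: "summable (\<lambda>n. norm (a n) * l n powr (- p))" using p by (intro a_summable)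
  have D: "D \<ge> 0" using Gamma_real_pos[OF p(1)] by (simp add: D_def)
  have main: "norm ((LINT t|lborel. Z (t + \<tau>) * exp (of_real (\<theta> * t)) * test (l n0) \<theta> t) -
      2 * pi * exp (\<i> * \<theta> * (test_exponent \<tau> - c)) *
        (a n0 * (Gamma (test_exponent \<tau>) * exp (- test_exponent \<tau> * of_real (ln (2 * l n0 * cos \<theta>))))))
      \<le> 2 * pi * exp (2 * M) * (E + E')"
    if \<tau>: "\<bar>\<tau>\<bar> \<le> M" and \<theta>': "pi / 6 \<le> \<theta>" "\<theta> < pi / 2" for \<tau> \<theta>
  proof -
    have \<theta>: "0 < \<theta>" "\<theta> < pi / 2" using \<theta>' pi_gt_zero by linarith+
    have cos: "cos \<theta> > 0" using \<theta> by (intro cos_gt_zero_pi) auto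
    have "sin (pi / 6) \<le> sin \<theta>" using \<theta>' pi_gt_zero by (intro sin_monotone_2pi_le) auto
    hence sin: "sin \<theta> \<ge> 1 / 2" by (simp add: sin_30)
    have M: "0 \<le> M" using \<tau> by linarith
    \<comment> \<open>Here and in later estimates 2 is a convenient upper bound for
      \<open>pi / 2\<close>.\<close>
    have \<tau>\<theta>: "\<bar>\<theta> * \<tau>\<bar> \<le> 2 * M"
    proof -
      have "\<bar>\<theta>\<bar> * \<bar>\<tau>\<bar> \<le> 2 * M" using \<theta> \<tau> pi_less_4 by (intro mult_mono) auto
      thus ?thesis by (simp add: abs_mult)
    qed
    define q where "q = test_exponent \<tau>"
    have q: "Re q = p" "Im q = \<tau>" by (auto simp: q_def test_exponent_def p_def)
    define \<omega> where "\<omega> = of_real (ln (l n0)) - \<i> * \<theta>"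
    define W where "W = (\<lambda>n. exp \<omega> + of_real (l n) * exp (\<i> * of_real \<theta>))"
    define f where "f = (\<lambda>n. a n * (Gamma q * exp (- q * Ln (W n))))"
    \<comment> \<open>The series without its resonant term.\<close>
    define g where "g = (\<lambda>n. if n = n0 then 0 else f n)"
    have f_sum: "summable (\<lambda>n. norm (f n))"
      unfolding f_def W_def \<omega>_def q_def by (rule Z_test_integral(2)[OF l_pos[of n0] \<theta>])
    have exp\<omega>: "exp \<omega> = Complex (l n0 * cos \<theta>) (- (l n0 * sin \<theta>))"
      using l_pos[of n0] by (simp add: \<omega>_def exp_diff complex_eq_iff Re_exp Im_exp exp_eq_polar cis.ctr)
    have W_eq: "W n = Complex ((l n0 + l n) * cos \<theta>) ((l n - l n0) * sin \<theta>)" for n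
      unfolding W_def exp\<omega> by (simp add: complex_eq_iff Re_exp Im_exp algebra_simps)
    have W0: "W n0 = of_real (2 * l n0 * cos \<theta>)" unfolding W_eq by (simp add: complex_eq_iff)
    have g_bound: "norm (g n) \<le> D * (norm (a n) * l n powr (- p))" for n
    proof (cases "n = n0")
      case True
      thus ?thesis using D by (simp add: g_def)
    next
      case False
      have "k / 2 * l n = (k * l n) * (1 / 2)" by simp
      also have "\<dots> \<le> \<bar>l n - l n0\<bar> * \<bar>sin \<theta>\<bar>"
        using k(2)[OF False] k(1) l_pos[of n] sin by (intro mult_mono) auto
      also have "\<dots> = \<bar>Im (W n)\<bar>" unfolding W_eq by (simp add: abs_mult)
      also have "\<dots> \<le> norm (W n)" by (rule abs_Im_le_cmod)
      finally have W_ge: "k / 2 * l n \<le> norm (W n)" .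
      have kl: "0 < k / 2 * l n" using k(1) l_pos[of n] by simp
      hence W_nz: "W n \<noteq> 0" using W_ge by auto
      have "norm (exp (- q * Ln (W n))) \<le> norm (W n) powr (- p) * exp (M * pi)"
        using norm_exp_Ln[OF W_nz, of q M] \<tau> by (simp add: q)
      also have "\<dots> \<le> (k / 2 * l n) powr (- p) * exp (M * pi)"
        using W_ge kl p by (intro mult_right_mono powr_mono2') auto
      also have "\<dots> = (k / 2) powr (- p) * exp (M * pi) * l n powr (- p)"
        using k(1) l_pos[of n] by (subst powr_mult) auto
      finally have 1: "norm (exp (- q * Ln (W n))) \<le> (k / 2) powr (- p) * exp (M * pi) * l n powr (- p)" .
      have 2: "norm (Gamma q) \<le> Gamma p" using norm_Gamma_le[of q] p by (simp add: q)
      have "norm (Gamma q * exp (- q * Ln (W n))) \<le> Gamma p * ((k / 2) powr (- p) * exp (M * pi) * l n powr (- p))"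
        unfolding norm_mult using 1 2 Gamma_real_pos[OF p(1)] by (intro mult_mono) auto
      from mult_left_mono[OF this, of "norm (a n)"] show ?thesis
        using False by (simp add: g_def f_def norm_mult D_def mult_ac)
    qed
    have g_sum: "summable (\<lambda>n. norm (g n))"
      by (rule summable_comparison_test'[OF summable_mult[OF sum_a, of D]]) (use g_bound in simp)
    have "norm (\<Sum>n. g n) \<le> (\<Sum>n. norm (g n))" by (rule summable_norm[OF g_sum])
    also have "\<dots> \<le> (\<Sum>n. D * (norm (a n) * l n powr (- p)))"
      by (intro suminf_le g_bound g_sum summable_mult sum_a)
    also have "\<dots> = E" unfolding E_def by (rule suminf_mult[OF sum_a])
    finally have gE: "norm (\<Sum>n. g n) \<le> E" .
    have "(\<lambda>n. if n = n0 then f n else 0) sums f n0" by (rule sums_single)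
    moreover have "g sums (\<Sum>n. g n)" by (rule summable_sums[OF summable_norm_cancel[OF g_sum]])
    ultimately have "(\<lambda>n. (if n = n0 then f n else 0) + g n) sums (f n0 + (\<Sum>n. g n))" by (rule sums_add)
    moreover have "(if n = n0 then f n else 0) + g n = f n" for n by (simp add: g_def)
    ultimately have f_split: "(\<Sum>n. f n) = f n0 + (\<Sum>n. g n)" by (simp add: sums_iff)
    have f0: "f n0 = a n0 * (Gamma q * exp (- q * of_real (ln (2 * l n0 * cos \<theta>))))"
      unfolding f_def W0 using l_pos[of n0] cos by (subst Ln_of_real) auto
    \<comment> \<open>The contribution of the pole at \<open>r\<close>; it stays bounded because
      \<omega> does.\<close>
    define h where "h = \<rho> * exp (- (\<i> * \<theta> * r)) * (Gamma (q - r) * exp (- (q - r) * \<omega>))"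
    have I: "(LINT t|lborel. Z (t + \<tau>) * exp (of_real (\<theta> * t)) * test (l n0) \<theta> t) =
        2 * pi * exp (\<i> * \<theta> * (q - c)) * ((\<Sum>n. f n) - h)"
      unfolding h_def f_def W_def \<omega>_def q_def by (rule Z_test_integral(1)[OF l_pos[of n0] \<theta>])
    have h: "norm h \<le> E'"
    proof -
      have 1: "norm (Gamma (q - r)) \<le> Gamma (p - r)" using norm_Gamma_le[of "q - r"] p by (simp add: q)
      have "norm (exp (- (q - r) * \<omega>)) = exp (- ((p - r) * ln (l n0))) * exp (- (\<theta> * \<tau>))"
        by (simp add: q \<omega>_def algebra_simps flip: exp_add)
      also have "\<dots> \<le> exp (- ((p - r) * ln (l n0))) * exp (2 * M)" using \<tau>\<theta> by (simp add: abs_le_iff)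
      finally have 2: "norm (exp (- (q - r) * \<omega>)) \<le> exp (- ((p - r) * ln (l n0))) * exp (2 * M)" .
      have "norm (Gamma (q - r) * exp (- (q - r) * \<omega>)) \<le> Gamma (p - r) * (exp (- ((p - r) * ln (l n0))) * exp (2 * M))"
        unfolding norm_mult using 1 2 Gamma_real_pos[OF p(3)] by (intro mult_mono) auto
      from mult_left_mono[OF this, of "norm \<rho>"] show ?thesis
        unfolding h_def E'_def by (simp add: norm_mult)
    qed
    have pre: "norm (exp (\<i> * \<theta> * (q - c))) \<le> exp (2 * M)" using \<tau>\<theta> by (simp add: q abs_le_iff)
    have "(LINT t|lborel. Z (t + \<tau>) * exp (of_real (\<theta> * t)) * test (l n0) \<theta> t) - 2 * pi * exp (\<i> * \<theta> * (q - c)) * f n0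
        = 2 * pi * exp (\<i> * \<theta> * (q - c)) * ((\<Sum>n. g n) - h)"
      unfolding I f_split by (simp add: algebra_simps)
    also have "norm \<dots> = 2 * pi * (norm (exp (\<i> * \<theta> * (q - c))) * norm ((\<Sum>n. g n) - h))"
      by (simp add: norm_mult)
    also have "\<dots> \<le> 2 * pi * (exp (2 * M) * (E + E'))"
    proof (intro mult_left_mono mult_mono pre)
      show "norm ((\<Sum>n. g n) - h) \<le> E + E'" using gE h norm_triangle_ineq4[of "\<Sum>n. g n" h] by linarith
    qed auto
    finally show ?thesis unfolding f0 q_def by simp
  qed
  show ?thesis by (rule that) (rule main)
qed

section \<open>Growth of the theta series near the imaginary axis\<close>

lemma norm_theta_le:
  fixes L :: complex
  assumes L: "\<bar>Im L\<bar> < pi / 2" and \<sigma>: "0 < \<sigma>" and sum: "summable (\<lambda>n. norm (a n) * l n powr (- \<sigma>))"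
  shows "norm (theta L) \<le> \<sigma> powr \<sigma> * Re (exp L) powr (- \<sigma>) * (\<Sum>n. norm (a n) * l n powr (- \<sigma>))"
proof -
  have "norm (theta L) \<le> (\<Sum>n. norm (a n * exp (- (of_real (l n) * exp L))))"
    unfolding theta_def by (rule summable_norm[OF theta_summable[OF L]])
  also have "\<dots> \<le> (\<Sum>n. \<sigma> powr \<sigma> * Re (exp L) powr (- \<sigma>) * (norm (a n) * l n powr (- \<sigma>)))"
    by (intro suminf_le theta_term_bound[OF L \<sigma>] theta_summable L summable_mult sum)
  also have "\<dots> = \<sigma> powr \<sigma> * Re (exp L) powr (- \<sigma>) * (\<Sum>n. norm (a n) * l n powr (- \<sigma>))"
    by (rule suminf_mult[OF sum])
  finally show ?thesis .
qed

text \<open>On the ray at distance \<epsilon> from the imaginary axis the real part is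
  \<open>sin \<epsilon> \<ge> \<epsilon> / 2\<close>, so theta is of order at most
  \<open>\<epsilon> powr (- \<sigma>)\<close>, and \<open>\<sigma> < x\<close> leaves a positive
  power.\<close>

lemma theta_small_of_summable:
  assumes \<sigma>: "0 < \<sigma>" "\<sigma> < x" and sum: "summable (\<lambda>n. norm (a n) * l n powr (- \<sigma>))"
  shows "((\<lambda>\<epsilon>. norm (theta (\<i> * of_real (pi / 2 - \<epsilon>))) * \<epsilon> powr x) \<longlongrightarrow> 0) (at_right 0)"
proof -
  define S where "S = (\<Sum>n. norm (a n) * l n powr (- \<sigma>))"
  have S: "0 \<le> S" unfolding S_def by (intro suminf_nonneg sum) simp
  have bound: "norm (norm (theta (\<i> * of_real (pi / 2 - \<epsilon>))) * \<epsilon> powr x) \<le> \<sigma> powr \<sigma> * (1 / 2) powr (- \<sigma>) * S * \<epsilon> powr (x - \<sigma>)"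
    if \<epsilon>: "0 < \<epsilon>" "\<epsilon> < pi / 3" for \<epsilon>
  proof -
    have Re: "Re (exp (\<i> * of_real (pi / 2 - \<epsilon>))) = sin \<epsilon>" by (simp add: Re_exp cos_diff)
    have "norm (theta (\<i> * of_real (pi / 2 - \<epsilon>))) \<le> \<sigma> powr \<sigma> * sin \<epsilon> powr (- \<sigma>) * S"
      using norm_theta_le[OF _ \<sigma>(1) sum, of "\<i> * of_real (pi / 2 - \<epsilon>)"] \<epsilon> unfolding Re S_def by simp
    also have "\<dots> \<le> \<sigma> powr \<sigma> * (\<epsilon> / 2) powr (- \<sigma>) * S"
      using half_le_sin[of \<epsilon>] \<epsilon> \<sigma> S by (intro mult_right_mono mult_left_mono powr_mono2') auto
    also have "(\<epsilon> / 2) powr (- \<sigma>) = (1 / 2) powr (- \<sigma>) * \<epsilon> powr (- \<sigma>)"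
      using \<epsilon> powr_mult[of "1/2" \<epsilon> "- \<sigma>"] by simp
    finally have "norm (theta (\<i> * of_real (pi / 2 - \<epsilon>))) * \<epsilon> powr x \<le> \<sigma> powr \<sigma> * ((1 / 2) powr (- \<sigma>) * \<epsilon> powr (- \<sigma>)) * S * \<epsilon> powr x"
      by (rule mult_right_mono) simp
    also have "\<dots> = \<sigma> powr \<sigma> * (1 / 2) powr (- \<sigma>) * S * (\<epsilon> powr (- \<sigma>) * \<epsilon> powr x)" by simp
    also have "\<epsilon> powr (- \<sigma>) * \<epsilon> powr x = \<epsilon> powr (x - \<sigma>)" by (simp flip: powr_add)
    finally show ?thesis by simp
  qed
  have "((\<lambda>\<epsilon>. \<epsilon> powr (x - \<sigma>)) \<longlongrightarrow> 0) (at_right 0)"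
    using \<sigma> eventually_at_right_less[of "0::real"]
    by (intro tendsto_zero_powrI[where b = "x - \<sigma>"]) (auto intro: tendsto_eq_intros elim: eventually_mono)
  hence "((\<lambda>\<epsilon>. \<sigma> powr \<sigma> * (1 / 2) powr (- \<sigma>) * S * \<epsilon> powr (x - \<sigma>)) \<longlongrightarrow> 0) (at_right 0)"
    by (rule tendsto_mult_right_zero)
  moreover have "eventually (\<lambda>\<epsilon>. norm (norm (theta (\<i> * of_real (pi / 2 - \<epsilon>))) * \<epsilon> powr x) \<le> \<sigma> powr \<sigma> * (1 / 2) powr (- \<sigma>) * S * \<epsilon> powr (x - \<sigma>)) (at_right 0)"
    by (rule eventually_mono[OF eventually_at_right_real[of 0 "pi / 3"]]) (simp, rule bound, auto)
  ultimately show ?thesis by (rule Lim_null_comparison[rotated])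
qed

end

section \<open>Almost periodic sums\<close>

text \<open>
  Averaging over the window \<open>{n..<2 * n}\<close> instead of an initial segment makes the
  averages of a null sequence trivially null.
\<close>

lemma almost_periodic_tendsto_zero:
  fixes C :: "nat \<Rightarrow> complex" and \<tau> :: "nat \<Rightarrow> real"
  assumes C: "summable (\<lambda>j. norm (C j))" and \<tau>: "\<And>j. \<bar>\<tau> j\<bar> \<le> M" "inj \<tau>"
    and lim: "((\<lambda>u. \<Sum>j. C j * exp (\<i> * of_real (\<tau> j * u))) \<longlongrightarrow> 0) at_top"
  shows "C k = 0"
proof -
  have M: "M \<ge> 0" using \<tau>(1)[of 0] by linarith
  \<comment> \<open>Sampling width: the phases \<open>h * (\<tau> j - \<tau> k)\<close> have modulus
    at most \<open>2 * M / (M + 1)\<close>, less than \<open>2 * pi\<close>, so no other frequency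
    is confused with that of \<open>k\<close>.\<close>
  define h where "h = 1 / (M + 1)"
  have h: "h > 0" using M by (simp add: h_def)
  define z where "z = (\<lambda>j. exp (\<i> * of_real (h * (\<tau> j - \<tau> k))))"
  have z_norm: "norm (z j) = 1" for j by (simp add: z_def)
  have z_k: "z k = 1" by (simp add: z_def)
  have z_ne: "z j \<noteq> 1" if "j \<noteq> k" for j
  proof
    assume "z j = 1"
    then obtain n :: int where n: "h * (\<tau> j - \<tau> k) = of_int (2 * n) * pi"
      unfolding z_def by (auto simp: exp_eq_1)
    have "\<tau> j \<noteq> \<tau> k" using \<tau>(2) that by (auto dest: injD)
    hence "n \<noteq> 0" using n h by auto
    hence "1 \<le> \<bar>of_int n :: real\<bar>" by linarith
    hence "1 * (2 * pi) \<le> \<bar>of_int n\<bar> * (2 * pi)" by (intro mult_right_mono) auto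
    also have "\<dots> = \<bar>h * (\<tau> j - \<tau> k)\<bar>" unfolding n by (simp add: abs_mult)
    also have "\<dots> = h * \<bar>\<tau> j - \<tau> k\<bar>" using h by (simp add: abs_mult)
    also have "\<dots> \<le> h * (2 * M)" using h \<tau>(1)[of j] \<tau>(1)[of k] by (intro mult_left_mono) auto
    also have "\<dots> \<le> 2" using M by (simp add: h_def field_simps)
    finally show False using pi_gt3 by simp
  qed
  \<comment> \<open>For positive \<open>n\<close> these averages are 1 if \<open>j = k\<close>;
    otherwise they are geometric sums divided by \<open>n\<close> and tend to 0. This isolates
    \<open>C k\<close>.\<close>
  define b where "b = (\<lambda>j n. (\<Sum>m<n. z j ^ (n + m)) / of_nat n)"
  have b_norm: "norm (b j n) \<le> 1" for j n
  proof (cases "n = 0")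
    case False
    have "norm (\<Sum>m<n. z j ^ (n + m)) \<le> (\<Sum>m<n. 1)"
      by (rule order_trans[OF norm_sum]) (simp add: norm_power z_norm)
    thus ?thesis using False by (simp add: b_def norm_divide divide_simps)
  qed (simp add: b_def)
  have b_k: "(b k \<longlongrightarrow> 1) sequentially"
    by (rule tendsto_eventually) (auto simp: b_def z_k intro: eventually_mono[OF eventually_gt_at_top[of 0]])
  have b_j: "(b j \<longlongrightarrow> 0) sequentially" if "j \<noteq> k" for j
  proof -
    have "norm (b j n) \<le> 2 / norm (1 - z j) * inverse (real n)" for n
    proof -
      have "(\<Sum>m<n. z j ^ (n + m)) = z j ^ n * (\<Sum>m<n. z j ^ m)" by (simp add: power_add sum_distrib_left)
      also have "\<dots> = z j ^ n * ((1 - z j ^ n) / (1 - z j))" using z_ne[OF that] by (simp add: sum_gp_strict)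
      finally have "norm (\<Sum>m<n. z j ^ (n + m)) = norm (1 - z j ^ n) / norm (1 - z j)"
        by (simp add: norm_mult norm_divide norm_power z_norm)
      also have "\<dots> \<le> 2 / norm (1 - z j)"
        using norm_triangle_ineq4[of 1 "z j ^ n"] by (intro divide_right_mono) (auto simp: norm_power z_norm)
      finally have "norm (\<Sum>m<n. z j ^ (n + m)) * inverse (real n) \<le> 2 / norm (1 - z j) * inverse (real n)"
        by (rule mult_right_mono) simp
      thus ?thesis by (simp add: b_def divide_inverse norm_mult norm_inverse)
    qed
    moreover have "(\<lambda>n. 2 / norm (1 - z j) * inverse (real n)) \<longlonglongrightarrow> 0"
      by (intro tendsto_mult_right_zero lim_inverse_n)
    ultimately show ?thesis by (intro Lim_null_comparison[of "b j"]) (auto intro: always_eventually)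
  qed
  define x where "x = (\<lambda>m. \<Sum>j. C j * z j ^ m)"
  have Cz_sum: "summable (\<lambda>j. C j * z j ^ m)" for m
    by (rule summable_norm_cancel) (use C in \<open>simp add: norm_mult norm_power z_norm\<close>)
  have "x \<longlonglongrightarrow> 0"
  proof -
    \<comment> \<open>A unimodular factor moves the frequency of \<open>k\<close> to 0 and does not
      disturb the limit.\<close>
    have x_eq: "x m = exp (- \<i> * of_real (\<tau> k * (h * real m))) * (\<Sum>j. C j * exp (\<i> * of_real (\<tau> j * (h * real m))))" for m
    proof -
      have "C j * z j ^ m = exp (- \<i> * of_real (\<tau> k * (h * real m))) * (C j * exp (\<i> * of_real (\<tau> j * (h * real m))))" for j
        by (simp add: z_def algebra_simps flip: exp_of_nat_mult exp_add)
      moreover have "summable (\<lambda>j. C j * exp (\<i> * of_real (\<tau> j * (h * real m))))"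
        by (rule summable_norm_cancel) (use C in \<open>simp add: norm_mult\<close>)
      ultimately show ?thesis unfolding x_def by (simp only: suminf_mult)
    qed
    have "filterlim (\<lambda>m. h * real m) at_top sequentially"
      by (rule filterlim_tendsto_pos_mult_at_top[OF tendsto_const h filterlim_real_sequentially])
    from filterlim_compose[OF lim this]
    have "(\<lambda>m. norm (x m)) \<longlonglongrightarrow> 0"
      unfolding x_eq norm_mult by (auto dest: tendsto_norm_zero)
    thus ?thesis by (rule tendsto_norm_zero_cancel)
  qed
  have S: "(\<Sum>m<n. x (n + m)) / of_nat n = (\<Sum>j. C j * b j n)" for n
  proof -
    have "(\<Sum>m<n. x (n + m)) / of_nat n = (\<Sum>j. \<Sum>m<n. C j * z j ^ (n + m)) / of_nat n"
      unfolding x_def by (subst suminf_sum) (use Cz_sum in auto)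
    also have "\<dots> = (\<Sum>j. (\<Sum>m<n. C j * z j ^ (n + m)) / of_nat n)"
      by (intro suminf_divide[symmetric] summable_sum Cz_sum)
    also have "\<dots> = (\<Sum>j. C j * b j n)" by (simp add: b_def sum_distrib_left)
    finally show ?thesis .
  qed
  have "(\<lambda>n. (\<Sum>m<n. x (n + m)) / of_nat n) \<longlonglongrightarrow> 0"
  proof (rule LIMSEQ_I)
    fix e :: real assume "e > 0"
    then obtain n0 where n0: "\<And>m. m \<ge> n0 \<Longrightarrow> norm (x m) < e / 2"
      using LIMSEQ_D[OF \<open>x \<longlonglongrightarrow> 0\<close>, of "e / 2"] by auto
    show "\<exists>no. \<forall>n\<ge>no. norm ((\<Sum>m<n. x (n + m)) / of_nat n - 0) < e"
    proof (intro exI allI impI)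
      fix n assume n: "n \<ge> Suc n0"
      have "norm (\<Sum>m<n. x (n + m)) \<le> (\<Sum>m<n. e / 2)"
        using n n0 by (intro order_trans[OF norm_sum] sum_mono) (auto intro: less_imp_le)
      hence "norm ((\<Sum>m<n. x (n + m)) / of_nat n) \<le> e / 2"
        using n by (simp add: norm_divide divide_simps mult_ac)
      thus "norm ((\<Sum>m<n. x (n + m)) / of_nat n - 0) < e" using \<open>e > 0\<close> by simp
    qed
  qed
  \<comment> \<open>Tannery's theorem with majorant \<open>norm (C j)\<close> takes the limit inside
    the series.\<close>
  moreover have "(\<lambda>n. \<Sum>j. C j * b j n) \<longlonglongrightarrow> (\<Sum>j. if j = k then C k else 0)"
  proof (rule conjunct2[OF conjunct2[OF tannerys_theorem[OF _ _ C]]])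
    show "((\<lambda>n. C j * b j n) \<longlongrightarrow> (if j = k then C k else 0)) sequentially" for j
    proof (cases "j = k")
      case True
      show ?thesis using tendsto_mult_left[OF b_k, of "C k"] True by simp
    next
      case False
      show ?thesis using tendsto_mult_left[OF b_j[OF False], of "C j"] False by simp
    qed
    show "eventually (\<lambda>(j, n). norm (C j * b j n) \<le> norm (C j)) (at_top \<times>\<^sub>F sequentially)"
      using mult_left_mono[OF b_norm norm_ge_zero] by (intro always_eventually) (auto simp: norm_mult)
  qed simp
  ultimately have "(\<Sum>j. if j = k then C k else 0) = 0"
    unfolding S using LIMSEQ_unique by blast
  moreover have "(\<lambda>j. if j = k then C k else 0) sums C k" using sums_single[of k "\<lambda>_. C k"] by simp
  ultimately show ?thesis by (simp add: sums_iff)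
qed

section \<open>Sums of vertical shifts\<close>

lemma abs_exp_minus_1_le: "\<bar>exp x - 1\<bar> \<le> exp \<bar>x\<bar> - (1::real)"
proof (cases "x \<ge> 0")
  case False
  have "1 - exp x = exp x * (exp (- x) - 1)" by (simp add: algebra_simps flip: exp_add)
  also have "\<dots> \<le> 1 * (exp (- x) - 1)" using False by (intro mult_right_mono) auto
  finally show ?thesis using False by simp
qed simp

text \<open>The weights are called \<open>w\<close> because \<open>c\<close> already denotes the
  abscissa.\<close>

locale completed_shift_sum = completed_dirichlet +
  fixes w \<tau> :: "nat \<Rightarrow> real" and M :: real
  assumes w_summable: "summable (\<lambda>j. \<bar>w j\<bar>)" and \<tau>_bound: "\<And>j. \<bar>\<tau> j\<bar> \<le> M"
begin

definition G :: "real \<Rightarrow> complex" where "G t = (\<Sum>j. of_real (w j) * Z (t + \<tau> j))"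

text \<open>Boundedness of the shifts makes the decay uniform in \<open>j\<close>, at the price of a
  factor \<open>exp (\<eta> * M)\<close>.\<close>

lemma Z_shift_bound:
  assumes "0 \<le> \<eta>" "\<eta> < pi / 2"
  obtains K where "0 \<le> K" "\<And>t j. norm (Z (t + \<tau> j)) \<le> K * exp (- \<eta> * \<bar>t\<bar>)"
proof -
  obtain K where K: "0 \<le> K" "\<And>t. norm (Z t) \<le> K * exp (- \<eta> * \<bar>t\<bar>)" using Z_bound[OF assms] by blast
  have "norm (Z (t + \<tau> j)) \<le> K * exp (\<eta> * M) * exp (- \<eta> * \<bar>t\<bar>)" for t j
  proof -
    have "\<eta> * (\<bar>t\<bar> - M) \<le> \<eta> * \<bar>t + \<tau> j\<bar>" using \<tau>_bound[of j] assms by (intro mult_left_mono) auto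
    hence "exp (- \<eta> * \<bar>t + \<tau> j\<bar>) \<le> exp (\<eta> * M) * exp (- \<eta> * \<bar>t\<bar>)" by (simp add: algebra_simps flip: exp_add)
    from mult_left_mono[OF this K(1)] K(2)[of "t + \<tau> j"] show ?thesis by (simp add: mult.assoc)
  qed
  thus ?thesis using that[of "K * exp (\<eta> * M)"] K(1) by simp
qed

lemma G_terms_summable: "summable (\<lambda>j. norm (of_real (w j) * Z (t + \<tau> j)))"
proof -
  obtain K where K: "0 \<le> K" "\<And>t j. norm (Z (t + \<tau> j)) \<le> K * exp (- 0 * \<bar>t\<bar>)" using Z_shift_bound[of 0] by auto
  show ?thesis
    by (rule summable_comparison_test'[OF summable_mult2[OF w_summable, of K]])
       (use K in \<open>auto simp: norm_mult intro!: mult_left_mono\<close>)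
qed

lemma G_bound:
  assumes "0 \<le> \<eta>" "\<eta> < pi / 2"
  obtains K where "0 \<le> K" "\<And>t. norm (G t) \<le> K * exp (- \<eta> * \<bar>t\<bar>)"
proof -
  obtain K where K: "0 \<le> K" "\<And>t j. norm (Z (t + \<tau> j)) \<le> K * exp (- \<eta> * \<bar>t\<bar>)" using Z_shift_bound[OF assms] by blast
  have "norm (G t) \<le> (\<Sum>j. \<bar>w j\<bar>) * K * exp (- \<eta> * \<bar>t\<bar>)" for t
  proof -
    have "norm (G t) \<le> (\<Sum>j. norm (of_real (w j) * Z (t + \<tau> j)))"
      unfolding G_def by (rule summable_norm[OF G_terms_summable])
    also have "\<dots> \<le> (\<Sum>j. \<bar>w j\<bar> * (K * exp (- \<eta> * \<bar>t\<bar>)))"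
      using K by (intro suminf_le G_terms_summable summable_mult2 w_summable) (auto simp: norm_mult intro!: mult_left_mono)
    also have "\<dots> = (\<Sum>j. \<bar>w j\<bar>) * (K * exp (- \<eta> * \<bar>t\<bar>))" by (rule suminf_mult2[OF w_summable, symmetric])
    finally show ?thesis by (simp add: mult.assoc)
  qed
  thus ?thesis using that[of "(\<Sum>j. \<bar>w j\<bar>) * K"] K(1) by (simp add: suminf_nonneg w_summable)
qed

lemma G_continuous: "continuous_on UNIV G"
proof -
  obtain K where K: "0 \<le> K" "\<And>t j. norm (Z (t + \<tau> j)) \<le> K * exp (- 0 * \<bar>t\<bar>)" using Z_shift_bound[of 0] by auto
  have "uniform_limit UNIV (\<lambda>n t. \<Sum>j<n. of_real (w j) * Z (t + \<tau> j)) G sequentially"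
    unfolding G_def[abs_def]
    by (rule Weierstrass_m_test[OF _ summable_mult2[OF w_summable, of K]])
       (use K in \<open>auto simp: norm_mult intro!: mult_left_mono\<close>)
  moreover have "continuous_on UNIV (\<lambda>t. Z (t + \<tau> j))" for j
    by (rule continuous_on_compose2[OF Z_continuous[of UNIV]]) (auto intro!: continuous_intros)
  ultimately show ?thesis
    by (intro uniform_limit_theorem[OF _ _ sequentially_bot]) (auto intro!: always_eventually continuous_intros)
qed

lemma G_exp_integrable:
  assumes "\<bar>x\<bar> < pi / 2"
  shows "integrable lborel (\<lambda>t. G t * exp (of_real (x * t)))"
proof -
  obtain \<eta> where \<eta>: "\<bar>x\<bar> < \<eta>" "\<eta> < pi / 2" using dense[OF assms] by blast
  have "0 \<le> \<eta>" using \<eta>(1) by linarith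
  then obtain K where K: "0 \<le> K" "\<And>t. norm (G t) \<le> K * exp (- \<eta> * \<bar>t\<bar>)"
    using G_bound[OF _ \<eta>(2)] by blast
  show ?thesis by (rule integrable_mult_exp[OF G_continuous \<eta>(1) K])
qed

text \<open>The bounded factor \<phi> covers both uses: the constant 1 for the upper bound and the
  test function for the lower one.\<close>

lemma G_integral_swap:
  assumes x: "\<bar>x\<bar> < pi / 2" and \<phi>: "\<phi> \<in> borel_measurable borel" "\<And>t. norm (\<phi> t) \<le> B"
  shows "(LINT t|lborel. G t * exp (of_real (x * t)) * \<phi> t) =
      (\<Sum>j. of_real (w j) * (LINT t|lborel. Z (t + \<tau> j) * exp (of_real (x * t)) * \<phi> t))"
    and "summable (\<lambda>j. norm (of_real (w j) * (LINT t|lborel. Z (t + \<tau> j) * exp (of_real (x * t)) * \<phi> t)))"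
proof -
  define f where "f = (\<lambda>j t. of_real (w j) * (Z (t + \<tau> j) * exp (of_real (x * t)) * \<phi> t))"
  have B: "B \<ge> 0" using \<phi>(2)[of 0] by (rule order_trans[OF norm_ge_zero])
  define \<eta> where "\<eta> = (\<bar>x\<bar> + pi / 2) / 2"
  have \<eta>: "0 \<le> \<eta>" "\<eta> < pi / 2" "\<bar>x\<bar> < \<eta>" using x by (auto simp: \<eta>_def)
  obtain K where K: "0 \<le> K" "\<And>t j. norm (Z (t + \<tau> j)) \<le> K * exp (- \<eta> * \<bar>t\<bar>)"
    using Z_shift_bound[OF \<eta>(1,2)] by blast
  have int: "integrable lborel (\<lambda>t. Z (t + \<tau> j) * exp (of_real (x * t)) * \<phi> t)" for j
  proof (rule Bochner_Integration.integrable_bound[OF integrable_mult_left[OF Z_exp_integrable[OF x, of "\<tau> j"], of "of_real B"]])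
    have "(\<lambda>t. Z (t + \<tau> j) * exp (of_real (x * t))) \<in> borel_measurable borel"
      using borel_measurable_integrable[OF Z_exp_integrable[OF x, of "\<tau> j"]] by simp
    thus "(\<lambda>t. Z (t + \<tau> j) * exp (of_real (x * t)) * \<phi> t) \<in> borel_measurable lborel"
      using \<phi>(1) by simp
    show "AE t in lborel. norm (Z (t + \<tau> j) * exp (of_real (x * t)) * \<phi> t) \<le> norm (Z (t + \<tau> j) * exp (of_real (x * t)) * of_real B)"
      using \<phi>(2) B by (intro AE_I2) (auto simp: norm_mult intro!: mult_left_mono)
  qed
  have f_int: "integrable lborel (f j)" for j unfolding f_def by (intro integrable_mult_right int)
  have f_norm: "norm (f j t) \<le> \<bar>w j\<bar> * (K * B * exp (- (\<eta> - \<bar>x\<bar>) * \<bar>t\<bar>))" for j t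
  proof -
    have "x * t \<le> \<bar>x\<bar> * \<bar>t\<bar>" by (metis abs_ge_self abs_mult)
    hence "norm (Z (t + \<tau> j) * exp (of_real (x * t)) * \<phi> t) \<le> (K * exp (- \<eta> * \<bar>t\<bar>)) * exp (\<bar>x\<bar> * \<bar>t\<bar>) * B"
      unfolding norm_mult using K \<phi>(2) by (intro mult_mono) auto
    also have "\<dots> = K * B * (exp (- \<eta> * \<bar>t\<bar>) * exp (\<bar>x\<bar> * \<bar>t\<bar>))" by simp
    also have "exp (- \<eta> * \<bar>t\<bar>) * exp (\<bar>x\<bar> * \<bar>t\<bar>) = exp (- (\<eta> - \<bar>x\<bar>) * \<bar>t\<bar>)"
      by (simp add: algebra_simps flip: exp_add)
    finally show ?thesis unfolding f_def norm_mult[of "of_real (w j)"] by (simp add: mult_left_mono)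
  qed
  have S1: "AE t in lborel. summable (\<lambda>j. norm (f j t))"
  proof (rule AE_I2)
    fix t
    show "summable (\<lambda>j. norm (f j t))"
      by (rule summable_comparison_test'[OF summable_mult2[OF w_summable, of "K * B * exp (- (\<eta> - \<bar>x\<bar>) * \<bar>t\<bar>)"]])
         (use f_norm in simp)
  qed
  have E_int: "integrable lborel (\<lambda>t. K * B * exp (- (\<eta> - \<bar>x\<bar>) * \<bar>t\<bar>))"
    using \<eta> by (intro integrable_mult_right integrable_exp_neg_abs) simp
  have S2: "summable (\<lambda>j. LINT t|lborel. norm (f j t))"
  proof (rule summable_comparison_test'[OF summable_mult2[OF w_summable, of "LINT t|lborel. K * B * exp (- (\<eta> - \<bar>x\<bar>) * \<bar>t\<bar>)"]])
    show "norm (LINT t|lborel. norm (f j t)) \<le> \<bar>w j\<bar> * (LINT t|lborel. K * B * exp (- (\<eta> - \<bar>x\<bar>) * \<bar>t\<bar>))" if "j \<ge> 0" for j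
    proof -
      have "(LINT t|lborel. norm (f j t)) \<le> (LINT t|lborel. \<bar>w j\<bar> * (K * B * exp (- (\<eta> - \<bar>x\<bar>) * \<bar>t\<bar>)))"
        by (rule integral_mono[OF integrable_norm[OF f_int] integrable_mult_right[OF E_int] f_norm])
      also have "\<dots> = \<bar>w j\<bar> * (LINT t|lborel. K * B * exp (- (\<eta> - \<bar>x\<bar>) * \<bar>t\<bar>))"
        by (rule integral_mult_right_zero)
      finally show ?thesis by (simp add: integral_nonneg_AE)
    qed
  qed
  have f_val: "(LINT t|lborel. f j t) = of_real (w j) * (LINT t|lborel. Z (t + \<tau> j) * exp (of_real (x * t)) * \<phi> t)" for j
    unfolding f_def by (rule integral_mult_right_zero)
  have "G t * exp (of_real (x * t)) * \<phi> t = (\<Sum>j. f j t)" for t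
  proof -
    have "G t * (exp (of_real (x * t)) * \<phi> t) = (\<Sum>j. of_real (w j) * Z (t + \<tau> j) * (exp (of_real (x * t)) * \<phi> t))"
      unfolding G_def by (rule suminf_mult2[OF summable_norm_cancel[OF G_terms_summable]])
    thus ?thesis by (simp add: f_def mult.assoc)
  qed
  hence "(LINT t|lborel. G t * exp (of_real (x * t)) * \<phi> t) = (LINT t|lborel. (\<Sum>j. f j t))" by simp
  also have "\<dots> = (\<Sum>j. (LINT t|lborel. f j t))" by (rule integral_suminf[OF f_int S1 S2])
  finally show "(LINT t|lborel. G t * exp (of_real (x * t)) * \<phi> t) =
      (\<Sum>j. of_real (w j) * (LINT t|lborel. Z (t + \<tau> j) * exp (of_real (x * t)) * \<phi> t))"
    unfolding f_val .
  show "summable (\<lambda>j. norm (of_real (w j) * (LINT t|lborel. Z (t + \<tau> j) * exp (of_real (x * t)) * \<phi> t)))"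
    unfolding f_val[symmetric] by (rule summable_comparison_test'[OF S2]) simp
qed

text \<open>For \<open>L = \<i> * \<theta>\<close> the kernel \<open>exp (- \<i> * t * L)\<close> is
  \<open>exp (\<theta> * t)\<close>, so \<open>Z_integral\<close> evaluates every shifted integral;
  translating by \<open>\<tau> j\<close> costs at most \<open>exp (2 * M)\<close>.\<close>

lemma G_integral_bound:
  assumes \<theta>: "0 < \<theta>" "\<theta> < pi / 2"
  shows "norm (LINT t|lborel. G t * exp (of_real (\<theta> * t))) \<le>
    (\<Sum>j. \<bar>w j\<bar>) * (2 * pi * exp (2 * M) * (norm (theta (\<i> * \<theta>)) + norm \<rho>))"
proof -
  have x: "\<bar>\<theta>\<bar> < pi / 2" and L: "\<bar>Im (\<i> * \<theta>)\<bar> < pi / 2" using \<theta> by auto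
  define I where "I = (\<lambda>j. (LINT t|lborel. Z (t + \<tau> j) * exp (of_real (\<theta> * t)) * 1))"
  have I: "norm (I j) \<le> 2 * pi * exp (2 * M) * (norm (theta (\<i> * \<theta>)) + norm \<rho>)" for j
  proof -
    have "I j = (LINT t|lborel. exp (of_real (- \<theta> * \<tau> j)) * (Z (\<tau> j + 1 * t) * exp (- \<i> * of_real (\<tau> j + 1 * t) * (\<i> * \<theta>))))"
      unfolding I_def by (intro Bochner_Integration.integral_cong refl) (simp add: algebra_simps flip: exp_add)
    also have "\<dots> = exp (of_real (- \<theta> * \<tau> j)) * (LINT t|lborel. Z t * exp (- \<i> * t * (\<i> * \<theta>)))"
      using lborel_integral_real_affine[of 1 "\<lambda>t. Z t * exp (- \<i> * t * (\<i> * \<theta>))" "\<tau> j"] by simp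
    also have "\<dots> = exp (of_real (- \<theta> * \<tau> j)) * (2 * pi * exp (r / 2 * (\<i> * \<theta>)) * (theta (\<i> * \<theta>) - \<rho> * exp (- r * (\<i> * \<theta>))))"
      by (simp only: Z_integral[OF L])
    also have "norm \<dots> = exp (- \<theta> * \<tau> j) * (2 * pi * norm (theta (\<i> * \<theta>) - \<rho> * exp (- r * (\<i> * \<theta>))))"
      by (simp add: norm_mult)
    also have "\<dots> \<le> exp (2 * M) * (2 * pi * (norm (theta (\<i> * \<theta>)) + norm \<rho>))"
    proof (intro mult_mono mult_left_mono)
      have "\<bar>\<theta>\<bar> * \<bar>\<tau> j\<bar> \<le> 2 * M" using \<theta> \<tau>_bound[of j] pi_less_4 by (intro mult_mono) auto
      hence "\<bar>\<theta> * \<tau> j\<bar> \<le> 2 * M" by (simp add: abs_mult)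
      thus "exp (- \<theta> * \<tau> j) \<le> exp (2 * M)" by (simp add: abs_le_iff)
      show "norm (theta (\<i> * \<theta>) - \<rho> * exp (- r * (\<i> * \<theta>))) \<le> norm (theta (\<i> * \<theta>)) + norm \<rho>"
        using norm_triangle_ineq4[of "theta (\<i> * \<theta>)" "\<rho> * exp (- r * (\<i> * \<theta>))"] by (simp add: norm_mult)
    qed auto
    finally show ?thesis by (simp add: algebra_simps)
  qed
  have swap: "(LINT t|lborel. G t * exp (of_real (\<theta> * t)) * 1) = (\<Sum>j. of_real (w j) * I j)"
    and sum: "summable (\<lambda>j. norm (of_real (w j) * I j))"
    unfolding I_def by (rule G_integral_swap[OF x, of "\<lambda>_. 1" 1]; simp)+
  have "norm (\<Sum>j. of_real (w j) * I j) \<le> (\<Sum>j. norm (of_real (w j) * I j))" by (rule summable_norm[OF sum])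
  also have "\<dots> \<le> (\<Sum>j. \<bar>w j\<bar> * (2 * pi * exp (2 * M) * (norm (theta (\<i> * \<theta>)) + norm \<rho>)))"
    using I by (intro suminf_le sum summable_mult2 w_summable) (auto simp: norm_mult intro!: mult_left_mono)
  also have "\<dots> = (\<Sum>j. \<bar>w j\<bar>) * (2 * pi * exp (2 * M) * (norm (theta (\<i> * \<theta>)) + norm \<rho>))"
    by (rule suminf_mult2[OF w_summable, symmetric])
  finally show ?thesis using swap by simp
qed

lemma G_abs_integral_bound:
  assumes real: "\<And>t. Im (G t) = 0" and fin: "finite {t. G t = 0}"
  obtains C where "\<And>\<theta>. 0 < \<theta> \<Longrightarrow> \<theta> < pi / 2 \<Longrightarrow>
    (LINT t|lborel. norm (G t) * exp (\<theta> * t)) \<le> norm (LINT t|lborel. G t * exp (of_real (\<theta> * t))) + C"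
proof -
  obtain B where B: "\<And>t. G t = 0 \<Longrightarrow> \<bar>t\<bar> \<le> B"
    using finite_imp_bounded[OF fin] unfolding bounded_real by auto
  define T0 where "T0 = \<bar>B\<bar> + 1"
  have T0: "0 < T0" "\<And>t. T0 \<le> t \<Longrightarrow> G t \<noteq> 0" using B by (force simp: T0_def)+
  have G_eq: "G t = of_real (Re (G t))" for t using real by (simp add: complex_eq_iff)
  define s where "s = sgn (Re (G T0))"
  have "Re (G T0) \<noteq> 0" using T0(2)[of T0] G_eq[of T0] by auto
  hence s: "s = 1 \<or> s = -1" and s0: "s * Re (G T0) > 0" by (auto simp: s_def sgn_if)
  have pos: "s * Re (G t) > 0" if t: "T0 \<le> t" for t
  proof (rule ccontr)
    assume "\<not> s * Re (G t) > 0"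
    hence "s * Re (G t) \<le> 0" by simp
    moreover have "continuous_on {T0..t} (\<lambda>t. s * Re (G t))"
      by (intro continuous_intros continuous_on_subset[OF G_continuous]) auto
    ultimately obtain x where "T0 \<le> x" "s * Re (G x) = 0"
      using IVT2'[of "\<lambda>t. s * Re (G t)" t 0 T0] s0 t by auto
    thus False using T0(2)[of x] G_eq[of x] s by auto
  qed
  have norm_eq: "norm (G t) = s * Re (G t)" if "T0 \<le> t" for t
    using pos[OF that] s G_eq[of t] by (metis abs_of_nonneg abs_of_nonpos linear mult_1 mult_minus1 neg_0_le_iff_le norm_of_real not_less order_less_le)
  \<comment> \<open>Left of \<open>T0\<close> the weight is at most \<open>exp (2 * T0)\<close> for
    every \<theta>. The factor 2 pays once for \<open>norm (G t)\<close> itself and once for a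
    possibly wrong sign of \<open>s * Re (G t)\<close>.\<close>
  define C where "C = 2 * exp (2 * T0) * (LINT t|lborel. norm (G t))"
  have bound: "(LINT t|lborel. norm (G t) * exp (\<theta> * t)) \<le> norm (LINT t|lborel. G t * exp (of_real (\<theta> * t))) + C"
    if \<theta>: "0 < \<theta>" "\<theta> < pi / 2" for \<theta>
  proof -
    have int: "integrable lborel (\<lambda>t. G t * exp (of_real (\<theta> * t)))" using \<theta> by (intro G_exp_integrable) auto
    have int_norm: "integrable lborel (\<lambda>t. norm (G t) * exp (\<theta> * t))"
      using integrable_norm[OF int] by (simp add: norm_mult)
    have "integrable lborel (\<lambda>t. G t * exp (of_real (0 * t)))" by (rule G_exp_integrable) simp
    hence int0: "integrable lborel (\<lambda>t. norm (G t))" using integrable_norm by simp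
    have int_Re: "integrable lborel (\<lambda>t. s * Re (G t * exp (of_real (\<theta> * t))))"
      using int by (intro integrable_mult_right integrable_Re)
    have pt: "norm (G t) * exp (\<theta> * t) \<le> s * Re (G t * exp (of_real (\<theta> * t))) + 2 * exp (2 * T0) * norm (G t)" for t
    proof -
      have Re: "s * Re (G t * exp (of_real (\<theta> * t))) = s * Re (G t) * exp (\<theta> * t)"
        unfolding exp_of_real by simp
      show ?thesis
      proof (cases "T0 \<le> t")
        case True
        hence "norm (G t) * exp (\<theta> * t) = s * Re (G t) * exp (\<theta> * t)" using norm_eq by simp
        moreover have "0 \<le> 2 * exp (2 * T0) * norm (G t)" by simp
        ultimately show ?thesis unfolding Re by linarith
      next
        case False
        have "\<theta> * t \<le> 2 * T0"
        proof (cases "t \<ge> 0")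
          case True
          thus ?thesis using False \<theta> pi_less_4 by (intro mult_mono) auto
        next
          case False
          hence "\<theta> * t \<le> 0" using \<theta> by (intro mult_nonneg_nonpos) auto
          thus ?thesis using T0(1) by linarith
        qed
        hence e: "exp (\<theta> * t) \<le> exp (2 * T0)" by simp
        have "- norm (G t) \<le> s * Re (G t)" using s abs_Re_le_cmod[of "G t"] by auto
        hence "- norm (G t) * exp (\<theta> * t) \<le> s * Re (G t) * exp (\<theta> * t)" by (rule mult_right_mono) simp
        moreover have "norm (G t) * exp (\<theta> * t) \<le> norm (G t) * exp (2 * T0)" using e by (rule mult_left_mono) simp
        ultimately show ?thesis unfolding Re by (simp add: algebra_simps)
      qed
    qed
    have "(LINT t|lborel. norm (G t) * exp (\<theta> * t)) \<le>
        (LINT t|lborel. s * Re (G t * exp (of_real (\<theta> * t))) + 2 * exp (2 * T0) * norm (G t))"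
      by (rule integral_mono[OF int_norm Bochner_Integration.integrable_add[OF int_Re integrable_mult_right[OF int0]] pt])
    also have "\<dots> = s * Re (LINT t|lborel. G t * exp (of_real (\<theta> * t))) + C"
      unfolding C_def
      by (simp only: Bochner_Integration.integral_add[OF int_Re integrable_mult_right[OF int0]]
          integral_mult_right_zero integral_Re[OF int])
    also have "s * Re (LINT t|lborel. G t * exp (of_real (\<theta> * t))) \<le> norm (LINT t|lborel. G t * exp (of_real (\<theta> * t)))"
      using s abs_Re_le_cmod[of "LINT t|lborel. G t * exp (of_real (\<theta> * t))"] by auto
    finally show ?thesis by simp
  qed
  show ?thesis by (rule that[OF bound])
qed

lemma test_measurable: "test \<nu> \<theta> \<in> borel_measurable borel"
proof (rule borel_measurable_continuous_onI)
  have "continuous_on UNIV (\<lambda>t. Gamma (of_real c - \<i> * of_real t))"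
  proof (rule continuous_on_compose2[OF continuous_on_Gamma[of "{s. 0 < Re s}"]])
    show "{s. 0 < Re s} \<inter> \<int>\<^sub>\<le>\<^sub>0 = {}" by (auto elim!: nonpos_Ints_cases)
    show "(\<lambda>t. of_real c - \<i> * of_real t) ` UNIV \<subseteq> {s. 0 < Re s}" using c_pos by auto
  qed (intro continuous_intros)
  thus "continuous_on UNIV (test \<nu> \<theta>)"
    unfolding test_def[abs_def] by (intro continuous_intros)
qed

text \<open>With \<open>p = N + (r + 1) / 2\<close>, multiplying the pairing by
  \<open>\<epsilon> powr p\<close> absorbs the loss \<open>\<epsilon> ^ N\<close> of the test
  function and leaves precisely the power that \<open>small\<close> controls.\<close>

theorem infinite_zeros:
  assumes inj: "inj \<tau>" and w: "w j0 \<noteq> 0" and a0: "a n0 \<noteq> 0"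
    and k: "0 < k" "\<And>n. n \<noteq> n0 \<Longrightarrow> k * l n \<le> \<bar>l n - l n0\<bar>"
    and real: "\<And>t. Im (G t) = 0"
    and small: "((\<lambda>\<epsilon>. norm (theta (\<i> * of_real (pi / 2 - \<epsilon>))) * \<epsilon> powr ((r + 1) / 2)) \<longlongrightarrow> 0) (at_right 0)"
  shows "infinite {t. G t = 0}"
proof
  assume fin: "finite {t. G t = 0}"
  define \<nu> where "\<nu> = l n0"
  have \<nu>: "\<nu> > 0" using l_pos by (simp add: \<nu>_def)
  define p where "p = c + r / 2"
  have p: "p > 0" "p = real N + (r + 1) / 2" using r c_pos by (auto simp: p_def field_simps)
  define q where "q = (\<lambda>j. test_exponent (\<tau> j))"
  have q: "Re (q j) = p" "Im (q j) = \<tau> j" for j by (simp_all add: q_def test_exponent_def p_def)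
  define V where "V = (\<Sum>j. \<bar>w j\<bar>)"
  have V: "V \<ge> 0" unfolding V_def by (intro suminf_nonneg w_summable) auto
  have \<Gamma>: "norm (Gamma (q j)) \<le> Gamma p" "Gamma (q j) \<noteq> 0" for j
  proof -
    show "norm (Gamma (q j)) \<le> Gamma p" using norm_Gamma_le[of "q j"] p by (simp add: q)
    have "q j \<notin> \<int>\<^sub>\<le>\<^sub>0" using Complex_not_nonpos_Ints[of p "\<tau> j"] p q[of j] by (metis complex.collapse)
    thus "Gamma (q j) \<noteq> 0" by (rule Gamma_nonzero)
  qed
  obtain C1 where C1: "\<And>\<theta>. 0 < \<theta> \<Longrightarrow> \<theta> < pi / 2 \<Longrightarrow>
      (LINT t|lborel. norm (G t) * exp (\<theta> * t)) \<le> norm (LINT t|lborel. G t * exp (of_real (\<theta> * t))) + C1"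
    using G_abs_integral_bound[OF real fin] by blast
  obtain C2 where C2: "0 \<le> C2" "\<And>\<theta> t. 0 < \<theta> \<Longrightarrow> \<theta> < pi / 2 \<Longrightarrow> norm (test \<nu> \<theta> t) \<le> C2 / (pi / 2 - \<theta>) ^ N"
    using norm_test_le[OF \<nu>] by blast
  obtain K where K: "\<And>\<tau> \<theta>. \<bar>\<tau>\<bar> \<le> M \<Longrightarrow> pi / 6 \<le> \<theta> \<Longrightarrow> \<theta> < pi / 2 \<Longrightarrow>
      norm ((LINT t|lborel. Z (t + \<tau>) * exp (of_real (\<theta> * t)) * test \<nu> \<theta> t) -
        2 * pi * exp (\<i> * \<theta> * (test_exponent \<tau> - c)) *
          (a n0 * (Gamma (test_exponent \<tau>) * exp (- test_exponent \<tau> * of_real (ln (2 * \<nu> * cos \<theta>)))))) \<le> K"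
    using Z_test_asymptotics[of k n0 M, OF k] unfolding \<nu>_def by blast
  \<comment> \<open>Upper bound for the integral of \<open>norm (G t) * exp (\<theta> * t)\<close>
    at \<open>\<theta> = pi / 2 - \<epsilon>\<close>.\<close>
  define A where "A = (\<lambda>\<epsilon>. V * (2 * pi * exp (2 * M) * (norm (theta (\<i> * of_real (pi / 2 - \<epsilon>))) + norm \<rho>)) + C1)"
  \<comment> \<open>The main terms of the pairings, summed over the shifts and freed from their
    common factor, which has the size of a multiple of
    \<open>(2 * \<nu> * sin \<epsilon>) powr (- p)\<close>.\<close>
  define P where "P = (\<lambda>\<epsilon>. \<Sum>j. of_real (w j * exp (- (pi / 2 - \<epsilon>) * \<tau> j)) * Gamma (q j) *
      exp (\<i> * of_real (\<tau> j * - ln (2 * \<nu> * sin \<epsilon>))))"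
  define c1 where "c1 = (2 * \<nu>) powr p / (2 * pi * norm (a n0))"
  have P_summable: "summable (\<lambda>j. norm (of_real (w j * x j) * Gamma (q j) * exp (\<i> * of_real (y j))))"
    if "\<And>j. norm (x j) \<le> X" for x y :: "nat \<Rightarrow> real" and X
  proof (rule summable_comparison_test'[OF summable_mult2[OF w_summable, of "X * Gamma p"]])
    show "norm (norm (of_real (w j * x j) * Gamma (q j) * exp (\<i> * of_real (y j)))) \<le> \<bar>w j\<bar> * (X * Gamma p)" if "j \<ge> 0" for j
    proof -
      have "norm (x j) * norm (Gamma (q j)) \<le> X * Gamma p"
        using \<open>\<And>j. norm (x j) \<le> X\<close> \<Gamma> order_trans[OF norm_ge_zero \<open>\<And>j. norm (x j) \<le> X\<close>] by (intro mult_mono) auto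
      thus ?thesis by (simp add: norm_mult abs_mult mult.assoc mult_left_mono)
    qed
  qed
  have E2: "exp (- \<theta> * \<tau> j) \<le> exp (2 * M)" if "\<bar>\<theta>\<bar> \<le> 2" for \<theta> j
  proof -
    have "\<bar>\<theta>\<bar> * \<bar>\<tau> j\<bar> \<le> 2 * M" using that \<tau>_bound[of j] by (intro mult_mono) auto
    hence "\<bar>\<theta> * \<tau> j\<bar> \<le> 2 * M" by (simp add: abs_mult)
    thus ?thesis by (simp add: abs_le_iff)
  qed
  have main_bound: "norm (P \<epsilon>) \<le> c1 * (C2 * (A \<epsilon> * \<epsilon> powr ((r + 1) / 2)) + K * V * \<epsilon> powr p)"
    if \<epsilon>: "0 < \<epsilon>" "\<epsilon> \<le> pi / 3" for \<epsilon>
  proof -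
    define \<theta> where "\<theta> = pi / 2 - \<epsilon>"
    have \<theta>: "0 < \<theta>" "\<theta> < pi / 2" "pi / 6 \<le> \<theta>" using \<epsilon> by (auto simp: \<theta>_def field_simps)
    have \<theta>': "\<bar>\<theta>\<bar> < pi / 2" using \<theta> by simp
    define D where "D = 2 * \<nu> * sin \<epsilon>"
    have cs: "cos \<theta> = sin \<epsilon>" by (simp add: \<theta>_def cos_diff)
    have "sin \<epsilon> > 0" using \<epsilon> by (intro sin_gt_zero) auto
    hence D: "D > 0" using \<nu> by (simp add: D_def)
    have "sin \<epsilon> \<le> \<epsilon>" using \<epsilon> by (intro sin_x_le_x) auto
    hence D_le: "D \<le> 2 * \<nu> * \<epsilon>" using \<nu> by (simp add: D_def)
    define I where "I = (\<lambda>j. LINT t|lborel. Z (t + \<tau> j) * exp (of_real (\<theta> * t)) * test \<nu> \<theta> t)"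
    define m where "m = (\<lambda>j. 2 * pi * exp (\<i> * \<theta> * (q j - c)) * (a n0 * (Gamma (q j) * exp (- q j * of_real (ln D)))))"
    have Im: "norm (I j - m j) \<le> K" for j
      using K[OF \<tau>_bound[of j] \<theta>(3,2)] by (simp add: I_def m_def q_def cs D_def)
    have test_b: "norm (test \<nu> \<theta> t) \<le> C2 / \<epsilon> ^ N" for t using C2(2)[OF \<theta>(1,2)] by (simp add: \<theta>_def)
    note swap = G_integral_swap[OF \<theta>' test_measurable test_b]
    have I_sum: "summable (\<lambda>j. norm (of_real (w j) * I j))" unfolding I_def by (rule swap(2))
    have IG: "(\<Sum>j. of_real (w j) * I j) = (LINT t|lborel. G t * exp (of_real (\<theta> * t)) * test \<nu> \<theta> t)"
      unfolding I_def by (rule swap(1)[symmetric])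
    have int: "integrable lborel (\<lambda>t. G t * exp (of_real (\<theta> * t)))" by (rule G_exp_integrable[OF \<theta>'])
    have int_norm: "integrable lborel (\<lambda>t. norm (G t) * exp (\<theta> * t))"
      using integrable_norm[OF int] by (simp add: norm_mult)
    have "norm (\<Sum>j. of_real (w j) * I j) \<le> (LINT t|lborel. C2 / \<epsilon> ^ N * (norm (G t) * exp (\<theta> * t)))"
      unfolding IG
    proof (rule Bochner_Integration.integral_norm_bound_integral)
      show "integrable lborel (\<lambda>t. C2 / \<epsilon> ^ N * (norm (G t) * exp (\<theta> * t)))" by (rule integrable_mult_right[OF int_norm])
      show pt: "norm (G t * exp (of_real (\<theta> * t)) * test \<nu> \<theta> t) \<le> C2 / \<epsilon> ^ N * (norm (G t) * exp (\<theta> * t))" for t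
        using mult_left_mono[OF test_b[of t], of "norm (G t) * exp (\<theta> * t)"] by (simp add: norm_mult mult_ac)
      show "integrable lborel (\<lambda>t. G t * exp (of_real (\<theta> * t)) * test \<nu> \<theta> t)"
      proof (rule Bochner_Integration.integrable_bound[OF integrable_mult_right[OF int_norm, of "C2 / \<epsilon> ^ N"]])
        show "(\<lambda>t. G t * exp (of_real (\<theta> * t)) * test \<nu> \<theta> t) \<in> borel_measurable lborel"
          using borel_measurable_integrable[OF int] test_measurable by simp
      qed (rule AE_I2, rule order_trans[OF pt], simp only: real_norm_def abs_ge_self)
    qed
    also have "\<dots> = C2 / \<epsilon> ^ N * (LINT t|lborel. norm (G t) * exp (\<theta> * t))" by simp
    also have "\<dots> \<le> C2 / \<epsilon> ^ N * A \<epsilon>"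
    proof (rule mult_left_mono)
      have "(LINT t|lborel. norm (G t) * exp (\<theta> * t)) \<le> norm (LINT t|lborel. G t * exp (of_real (\<theta> * t))) + C1"
        by (rule C1[OF \<theta>(1,2)])
      also have "\<dots> \<le> A \<epsilon>" using G_integral_bound[OF \<theta>(1,2)] unfolding A_def V_def[symmetric] by (simp add: \<theta>_def)
      finally show "(LINT t|lborel. norm (G t) * exp (\<theta> * t)) \<le> A \<epsilon>" .
    qed (use C2 \<epsilon> in auto)
    finally have sum_I: "norm (\<Sum>j. of_real (w j) * I j) \<le> C2 / \<epsilon> ^ N * A \<epsilon>" .
    have wK: "norm (of_real (w j) * (I j - m j)) \<le> \<bar>w j\<bar> * K" for j
      using Im[of j] by (simp add: norm_mult mult_left_mono)
    have d_sum: "summable (\<lambda>j. norm (of_real (w j) * (I j - m j)))"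
      by (rule summable_comparison_test'[OF summable_mult2[OF w_summable, of K]]) (use wK in simp)
    have "norm (\<Sum>j. of_real (w j) * (I j - m j)) \<le> (\<Sum>j. norm (of_real (w j) * (I j - m j)))"
      by (rule summable_norm[OF d_sum])
    also have "\<dots> \<le> (\<Sum>j. \<bar>w j\<bar> * K)" by (intro suminf_le wK d_sum summable_mult2 w_summable)
    also have "\<dots> = V * K" unfolding V_def by (rule suminf_mult2[OF w_summable, symmetric])
    finally have sum_d: "norm (\<Sum>j. of_real (w j) * (I j - m j)) \<le> V * K" .
    \<comment> \<open>The power of \<open>D\<close> splits into a modulus common to all
      \<open>j\<close> and a phase with frequency \<open>\<tau> j\<close>.\<close>
    have m_eq: "of_real (w j) * m j = (2 * pi * a n0 * exp (\<i> * \<theta> * (r / 2)) * of_real (D powr (- p))) *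
        (of_real (w j * exp (- \<theta> * \<tau> j)) * Gamma (q j) * exp (\<i> * of_real (\<tau> j * - ln D)))" for j
    proof -
      have qj: "q j = of_real p + \<i> * \<tau> j" by (simp add: complex_eq_iff q)
      have e1: "exp (\<i> * \<theta> * (q j - c)) = exp (\<i> * \<theta> * (r / 2)) * of_real (exp (- \<theta> * \<tau> j))"
        unfolding qj p_def by (simp add: algebra_simps flip: exp_add exp_of_real)
      have "- q j * of_real (ln D) = of_real (- p * ln D) + \<i> * of_real (\<tau> j * - ln D)"
        unfolding qj by (simp add: algebra_simps)
      hence e2: "exp (- q j * of_real (ln D)) = of_real (D powr (- p)) * exp (\<i> * of_real (\<tau> j * - ln D))"
        using D by (simp only: exp_add exp_of_real) (simp add: powr_def)
      show ?thesis unfolding m_def e1 e2 by (simp only: of_real_mult mult_ac)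
    qed
    have P_sum: "summable (\<lambda>j. of_real (w j * exp (- \<theta> * \<tau> j)) * Gamma (q j) * exp (\<i> * of_real (\<tau> j * - ln D)))"
    proof (rule summable_norm_cancel, rule P_summable)
      show "norm (exp (- \<theta> * \<tau> j)) \<le> exp (2 * M)" for j
        using E2[of \<theta> j] \<theta> pi_less_4 by simp
    qed
    have P_eq: "P \<epsilon> = (\<Sum>j. of_real (w j * exp (- \<theta> * \<tau> j)) * Gamma (q j) * exp (\<i> * of_real (\<tau> j * - ln D)))"
      by (simp add: P_def \<theta>_def D_def)
    have "(\<Sum>j. of_real (w j) * m j) = (2 * pi * a n0 * exp (\<i> * \<theta> * (r / 2)) * of_real (D powr (- p))) * P \<epsilon>"
      unfolding m_eq P_eq by (rule suminf_mult[OF P_sum])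
    hence norm_m: "norm (\<Sum>j. of_real (w j) * m j) = 2 * pi * norm (a n0) * D powr (- p) * norm (P \<epsilon>)"
      by (simp add: norm_mult)
    have "(\<Sum>j. of_real (w j) * m j) = (\<Sum>j. of_real (w j) * I j) - (\<Sum>j. of_real (w j) * (I j - m j))"
      by (subst suminf_diff[OF summable_norm_cancel[OF I_sum] summable_norm_cancel[OF d_sum]]) (simp add: algebra_simps)
    hence "norm (\<Sum>j. of_real (w j) * m j) \<le> C2 / \<epsilon> ^ N * A \<epsilon> + V * K"
      using sum_I sum_d norm_triangle_ineq4 by (smt (verit) norm_triangle_ineq4)
    hence "D powr p * (2 * pi * norm (a n0) * D powr (- p) * norm (P \<epsilon>)) \<le> D powr p * (C2 / \<epsilon> ^ N * A \<epsilon> + V * K)"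
      unfolding norm_m by (rule mult_left_mono) simp
    also have "D powr p * (2 * pi * norm (a n0) * D powr (- p) * norm (P \<epsilon>)) = 2 * pi * norm (a n0) * norm (P \<epsilon>)"
      using D by (simp add: powr_minus)
    also have "D powr p * (C2 / \<epsilon> ^ N * A \<epsilon> + V * K) \<le> (2 * \<nu>) powr p * \<epsilon> powr p * (C2 / \<epsilon> ^ N * A \<epsilon> + V * K)"
    proof (rule mult_right_mono)
      have "D powr p \<le> (2 * \<nu> * \<epsilon>) powr p" using D D_le p by (intro powr_mono2) auto
      thus "D powr p \<le> (2 * \<nu>) powr p * \<epsilon> powr p" using \<nu> \<epsilon> by (simp add: powr_mult)
      show "0 \<le> C2 / \<epsilon> ^ N * A \<epsilon> + V * K"
        using \<open>norm (\<Sum>j. of_real (w j) * m j) \<le> C2 / \<epsilon> ^ N * A \<epsilon> + V * K\<close> by (rule order_trans[OF norm_ge_zero])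
    qed
    \<comment> \<open>The factor \<open>\<epsilon> ^ N\<close> is there to cancel the denominator
      from the bound of the test function.\<close>
    also have "\<epsilon> powr p = \<epsilon> ^ N * \<epsilon> powr ((r + 1) / 2)"
      using \<epsilon> by (simp add: p(2) powr_add powr_realpow)
    finally have "2 * pi * norm (a n0) * norm (P \<epsilon>) \<le>
        (2 * \<nu>) powr p * (\<epsilon> ^ N * \<epsilon> powr ((r + 1) / 2)) * (C2 / \<epsilon> ^ N * A \<epsilon> + V * K)" .
    also have "\<dots> = (2 * \<nu>) powr p * (C2 * (A \<epsilon> * \<epsilon> powr ((r + 1) / 2)) + K * V * (\<epsilon> ^ N * \<epsilon> powr ((r + 1) / 2)))"
      using \<epsilon> by (simp add: field_simps)
    also have "\<epsilon> ^ N * \<epsilon> powr ((r + 1) / 2) = \<epsilon> powr p"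
      using \<epsilon> by (simp add: p(2) powr_add powr_realpow)
    finally show ?thesis using a0 unfolding c1_def by (simp add: field_simps)
  qed
  have powr_lim: "((\<lambda>\<epsilon>. \<epsilon> powr x) \<longlongrightarrow> 0) (at_right 0)" if "x > 0" for x :: real
    using that eventually_at_right_less[of "0::real"]
    by (intro tendsto_zero_powrI[where b = x]) (auto intro: tendsto_eq_intros elim: eventually_mono)
  have "((\<lambda>\<epsilon>. A \<epsilon> * \<epsilon> powr ((r + 1) / 2)) \<longlongrightarrow> 0) (at_right 0)"
  proof -
    have "((\<lambda>\<epsilon>. V * (2 * pi * exp (2 * M)) * (norm (theta (\<i> * of_real (pi / 2 - \<epsilon>))) * \<epsilon> powr ((r + 1) / 2)) +
        (V * (2 * pi * exp (2 * M) * norm \<rho>) + C1) * \<epsilon> powr ((r + 1) / 2)) \<longlongrightarrow>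
        V * (2 * pi * exp (2 * M)) * 0 + (V * (2 * pi * exp (2 * M) * norm \<rho>) + C1) * 0) (at_right 0)"
      using r by (intro tendsto_intros small powr_lim) auto
    thus ?thesis by (simp add: A_def algebra_simps)
  qed
  hence "((\<lambda>\<epsilon>. c1 * (C2 * (A \<epsilon> * \<epsilon> powr ((r + 1) / 2)) + K * V * \<epsilon> powr p)) \<longlongrightarrow> c1 * (C2 * 0 + K * V * 0)) (at_right 0)"
    using p by (intro tendsto_intros powr_lim) auto
  moreover have "eventually (\<lambda>\<epsilon>. \<epsilon> < pi / 3) (at_right 0)"
    using eventually_at_right_real[of 0 "pi / 3"] by (auto elim: eventually_mono)
  hence "eventually (\<lambda>\<epsilon>. norm (P \<epsilon>) \<le> c1 * (C2 * (A \<epsilon> * \<epsilon> powr ((r + 1) / 2)) + K * V * \<epsilon> powr p)) (at_right 0)"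
    using eventually_at_right_less[of 0] by eventually_elim (rule main_bound, auto)
  ultimately have P_lim: "(P \<longlongrightarrow> 0) (at_right 0)"
    by (intro Lim_null_comparison[of P]) auto
  \<comment> \<open>The coefficients in \<open>P\<close> still depend on \<epsilon>; replacing them
    by their values at \<open>\<epsilon> = 0\<close> gives a genuine almost periodic sum
    \<open>Q\<close>.\<close>
  define C where "C = (\<lambda>j. of_real (w j * exp (- (pi / 2) * \<tau> j)) * Gamma (q j))"
  define Q where "Q = (\<lambda>u. \<Sum>j. C j * exp (\<i> * of_real (\<tau> j * u)))"
  have C_summable: "summable (\<lambda>j. norm (C j))"
    using P_summable[of "\<lambda>j. exp (- (pi / 2) * \<tau> j)" "exp (2 * M)" "\<lambda>_. 0"] E2[of "pi / 2"] pi_less_4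
    by (simp add: C_def)
  have PQ: "norm (Q (- ln (2 * \<nu> * sin \<epsilon>)) - P \<epsilon>) \<le> V * (Gamma p * exp (2 * M)) * (exp (\<epsilon> * M) - 1)"
    if \<epsilon>: "0 < \<epsilon>" "\<epsilon> < pi / 3" for \<epsilon>
  proof -
    define y where "y = - ln (2 * \<nu> * sin \<epsilon>)"
    define f where "f = (\<lambda>j. C j * exp (\<i> * of_real (\<tau> j * y)))"
    define g where "g = (\<lambda>j. of_real (w j * exp (- (pi / 2 - \<epsilon>) * \<tau> j)) * Gamma (q j) * exp (\<i> * of_real (\<tau> j * y)))"
    have f_sum: "summable (\<lambda>j. norm (f j))" using C_summable by (simp add: f_def norm_mult)
    have "\<bar>pi / 2 - \<epsilon>\<bar> \<le> 2" using \<epsilon> pi_less_4 by (auto simp: abs_le_iff)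
    hence "norm (exp (- (pi / 2 - \<epsilon>) * \<tau> j)) \<le> exp (2 * M)" for j using E2 by (simp only: real_norm_def abs_exp_cancel)
    hence g_sum: "summable (\<lambda>j. norm (g j))" unfolding g_def by (rule P_summable)
    have fg: "norm (f j - g j) \<le> \<bar>w j\<bar> * (Gamma p * exp (2 * M) * (exp (\<epsilon> * M) - 1))" for j
    proof -
      have "exp (- (pi / 2 - \<epsilon>) * \<tau> j) = exp (- (pi / 2) * \<tau> j) * exp (\<epsilon> * \<tau> j)"
        by (simp add: algebra_simps flip: exp_add)
      hence "f j - g j = of_real (w j * (exp (- (pi / 2) * \<tau> j) * (1 - exp (\<epsilon> * \<tau> j)))) * Gamma (q j) * exp (\<i> * of_real (\<tau> j * y))"
        by (simp add: f_def g_def C_def algebra_simps)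
      hence "norm (f j - g j) = \<bar>w j\<bar> * (norm (Gamma (q j)) * exp (- (pi / 2) * \<tau> j) * \<bar>exp (\<epsilon> * \<tau> j) - 1\<bar>)"
        by (simp only: norm_mult norm_of_real abs_mult abs_exp_cancel norm_exp_i_times) (simp add: abs_minus_commute)
      also have "\<dots> \<le> \<bar>w j\<bar> * (Gamma p * exp (2 * M) * (exp (\<epsilon> * M) - 1))"
      proof (intro mult_left_mono mult_mono)
        have "\<bar>exp (\<epsilon> * \<tau> j) - 1\<bar> \<le> exp \<bar>\<epsilon> * \<tau> j\<bar> - 1" by (rule abs_exp_minus_1_le)
        also have "\<dots> \<le> exp (\<epsilon> * M) - 1" using \<epsilon> \<tau>_bound[of j] by (simp add: abs_mult)
        finally show "\<bar>exp (\<epsilon> * \<tau> j) - 1\<bar> \<le> exp (\<epsilon> * M) - 1" .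
        show "exp (- (pi / 2) * \<tau> j) \<le> exp (2 * M)" using pi_less_4 by (intro E2) simp
      qed (use \<Gamma> Gamma_real_pos[OF p(1)] in auto)
      finally show ?thesis .
    qed
    have d_sum: "summable (\<lambda>j. norm (f j - g j))"
      by (rule summable_comparison_test'[OF summable_mult2[OF w_summable]]) (use fg in simp)
    have "Q y - P \<epsilon> = (\<Sum>j. f j - g j)"
      using suminf_diff[OF summable_norm_cancel[OF f_sum] summable_norm_cancel[OF g_sum]]
      by (simp add: Q_def P_def f_def g_def y_def)
    also have "norm \<dots> \<le> (\<Sum>j. norm (f j - g j))" by (rule summable_norm[OF d_sum])
    also have "\<dots> \<le> (\<Sum>j. \<bar>w j\<bar> * (Gamma p * exp (2 * M) * (exp (\<epsilon> * M) - 1)))"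
      by (intro suminf_le fg d_sum summable_mult2 w_summable)
    also have "\<dots> = V * (Gamma p * exp (2 * M) * (exp (\<epsilon> * M) - 1))"
      unfolding V_def by (rule suminf_mult2[OF w_summable, symmetric])
    finally show ?thesis by (simp add: y_def mult.assoc)
  qed
  have "((\<lambda>\<epsilon>. V * (Gamma p * exp (2 * M)) * (exp (\<epsilon> * M) - 1)) \<longlongrightarrow> V * (Gamma p * exp (2 * M)) * (exp (0 * M) - 1)) (at_right 0)"
    by (intro tendsto_intros)
  moreover have "eventually (\<lambda>\<epsilon>. norm (Q (- ln (2 * \<nu> * sin \<epsilon>)) - P \<epsilon>) \<le> V * (Gamma p * exp (2 * M)) * (exp (\<epsilon> * M) - 1)) (at_right 0)"
    using eventually_at_right_real[of 0 "pi / 3"] by (rule eventually_mono) (auto intro!: PQ)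
  ultimately have "((\<lambda>\<epsilon>. Q (- ln (2 * \<nu> * sin \<epsilon>)) - P \<epsilon>) \<longlongrightarrow> 0) (at_right 0)"
    by (intro Lim_null_comparison[of "\<lambda>\<epsilon>. Q (- ln (2 * \<nu> * sin \<epsilon>)) - P \<epsilon>"]) auto
  from tendsto_add[OF this P_lim] have Q_lim: "((\<lambda>\<epsilon>. Q (- ln (2 * \<nu> * sin \<epsilon>))) \<longlongrightarrow> 0) (at_right 0)" by simp
  \<comment> \<open>The inverse of the substitution
    \<open>u = - ln (2 * \<nu> * sin \<epsilon>)\<close>, which turns \<epsilon> tending to 0 into
    \<open>u\<close> tending to infinity.\<close>
  define e where "e = (\<lambda>u. arcsin (exp (- u) / (2 * \<nu>)))"
  have exp_lim: "((\<lambda>u. exp (- u) / (2 * \<nu>)) \<longlongrightarrow> 0) at_top"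
    by (intro tendsto_divide_zero filterlim_compose[OF exp_at_bot] filterlim_uminus_at_bot_at_top)
  have small_u: "eventually (\<lambda>u. exp (- u) / (2 * \<nu>) < 1) at_top" by (rule order_tendstoD(2)[OF exp_lim]) simp
  have sin_e: "sin (e u) = exp (- u) / (2 * \<nu>)" "e u > 0" if "exp (- u) / (2 * \<nu>) < 1" for u
  proof -
    have 0: "0 < exp (- u) / (2 * \<nu>)" using \<nu> by simp
    show "sin (e u) = exp (- u) / (2 * \<nu>)" unfolding e_def using 0 that by (intro sin_arcsin) linarith+
    have "arcsin 0 < e u" unfolding e_def using 0 that by (intro arcsin_less_arcsin) linarith+
    thus "e u > 0" by simp
  qed
  have "filterlim e (at_right 0) at_top"
    unfolding filterlim_at
  proof
    show "\<forall>\<^sub>F u in at_top. e u \<in> {0<..} \<and> e u \<noteq> 0"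
      using small_u by eventually_elim (use sin_e(2) in force)
    have "((\<lambda>u. arcsin (exp (- u) / (2 * \<nu>))) \<longlongrightarrow> arcsin 0) at_top"
      using isCont_tendsto_compose[OF isCont_arcsin exp_lim] by simp
    thus "(e \<longlongrightarrow> 0) at_top" by (simp add: e_def[abs_def])
  qed
  from filterlim_compose[OF Q_lim this] have "((\<lambda>u. Q (- ln (2 * \<nu> * sin (e u)))) \<longlongrightarrow> 0) at_top" .
  moreover have "eventually (\<lambda>u. Q (- ln (2 * \<nu> * sin (e u))) = Q u) at_top"
    using small_u by eventually_elim (use \<nu> sin_e(1) in simp)
  ultimately have "(Q \<longlongrightarrow> 0) at_top" by (rule Lim_transform_eventually)
  hence "C j0 = 0"
    unfolding Q_def by (rule almost_periodic_tendsto_zero[OF C_summable \<tau>_bound inj])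
  thus False using w \<Gamma>(2) by (simp add: C_def)
qed

end

section \<open>Series of the class A\<close>

lemma norm_dirichlet_term:
  assumes "0 < l"
  shows "norm (z * of_real l powr (- s)) = norm z * l powr (- Re s)"
  using assms by (simp add: norm_mult norm_powr_real_powr)

lemma exponent_seq_pos: "exponent_seq l \<Longrightarrow> 0 < l (Suc n)"
  by (simp add: exponent_seq_def)

text \<open>The infimum supplies a point of absolute convergence to the left of \<sigma>. Since
  \<open>l n \<ge> 1\<close> eventually, increasing the exponent only decreases the terms of the
  tail.\<close>

lemma dirichlet_abs_summable:
  assumes l: "exponent_seq l" and \<sigma>: "abs_conv_abscissa a l < ereal \<sigma>"
  shows "summable (\<lambda>n. norm (a (Suc n)) * l (Suc n) powr (- \<sigma>))"
proof -
  obtain s where s: "Re s < \<sigma>" "summable (\<lambda>n. norm (a (Suc n) * of_real (l (Suc n)) powr (- s)))"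
    using \<sigma> unfolding abs_conv_abscissa_def Inf_less_iff by auto
  have s': "summable (\<lambda>n. norm (a (Suc n)) * l (Suc n) powr (- Re s))"
    using s(2) by (simp only: norm_dirichlet_term[OF exponent_seq_pos[OF l]])
  have "filterlim (\<lambda>n. l (Suc n)) at_top sequentially"
    using l unfolding exponent_seq_def by (simp add: filterlim_sequentially_Suc)
  hence "eventually (\<lambda>n. l (Suc n) \<ge> 1) sequentially" by (simp add: filterlim_at_top)
  hence "eventually (\<lambda>n. norm (norm (a (Suc n)) * l (Suc n) powr (- \<sigma>)) \<le> norm (a (Suc n)) * l (Suc n) powr (- Re s)) sequentially"
  proof eventually_elim
    case (elim n)
    have "l (Suc n) powr (- \<sigma>) \<le> l (Suc n) powr (- Re s)" using elim s(1) by (intro powr_mono) auto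
    thus ?case by (simp add: mult_left_mono)
  qed
  thus ?thesis by (rule summable_comparison_test_ev[OF _ s'])
qed

lemma cnj_gen_dirichlet:
  assumes l: "exponent_seq l" and \<sigma>: "abs_conv_abscissa a l < ereal (Re s)"
    and b: "\<And>n. b (Suc n) = cnj (a (Suc n))" and m: "\<And>n. m (Suc n) = l (Suc n)"
  shows "gen_dirichlet b m s = cnj (gen_dirichlet a l (cnj s))"
proof -
  have "summable (\<lambda>n. norm (a (Suc n) * of_real (l (Suc n)) powr (- cnj s)))"
    using dirichlet_abs_summable[OF l \<sigma>] by (simp add: norm_dirichlet_term[OF exponent_seq_pos[OF l]])
  hence "summable (\<lambda>n. a (Suc n) * of_real (l (Suc n)) powr (- cnj s))" by (rule summable_norm_cancel)
  hence "cnj (gen_dirichlet a l (cnj s)) = (\<Sum>n. cnj (a (Suc n) * of_real (l (Suc n)) powr (- cnj s)))"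
    unfolding gen_dirichlet_def by (rule bounded_linear.suminf[OF bounded_linear_cnj])
  moreover have "cnj (a (Suc n) * of_real (l (Suc n)) powr (- cnj s)) = b (Suc n) * of_real (m (Suc n)) powr (- s)" for n
    using exponent_seq_pos[OF l, of n] by (simp add: b m powr_def Ln_of_real exp_cnj)
  ultimately show ?thesis by (simp only: gen_dirichlet_def)
qed

text \<open>By monotonicity the two neighbours of \<open>n0\<close> decide:
  \<open>1 - x / l (Suc n)\<close> increases for \<open>n > n0\<close>, and for
  \<open>n < n0\<close> the gap is at least that to the left neighbour.\<close>

lemma exponent_seq_separated:
  assumes l: "exponent_seq l"
  obtains k where "0 < k" "\<And>n. n \<noteq> n0 \<Longrightarrow> k * l (Suc n) \<le> \<bar>l (Suc n) - l (Suc n0)\<bar>"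
proof -
  have pos: "0 < l (Suc n)" for n by (rule exponent_seq_pos[OF l])
  have less: "l (Suc i) < l (Suc j)" if "i < j" for i j
    using l that unfolding exponent_seq_def by (auto dest: strict_mono_onD)
  have mono: "l (Suc i) \<le> l (Suc j)" if "i \<le> j" for i j
    using less[of i j] that by (cases "i = j") auto
  define x where "x = l (Suc n0)"
  define k1 where "k1 = 1 - x / l (Suc (Suc n0))"
  \<comment> \<open>The left neighbour of \<open>l (Suc n0)\<close> is \<open>l n0\<close>, which is
    a term of the sequence only for \<open>n0 > 0\<close>; otherwise any positive value will
    do.\<close>
  define k2 where "k2 = (if n0 = 0 then 1 else (x - l n0) / x)"
  have x: "x > 0" using pos by (simp add: x_def)
  have k1: "k1 > 0" using less[of n0 "Suc n0"] pos[of "Suc n0"] by (simp add: k1_def x_def)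
  have k2: "k2 > 0" using less[of "n0 - 1" n0] x by (simp add: k2_def x_def)
  have "min k1 k2 * l (Suc n) \<le> \<bar>l (Suc n) - x\<bar>" if "n \<noteq> n0" for n
  proof (cases "n > n0")
    case True
    have "x / l (Suc n) \<le> x / l (Suc (Suc n0))"
      using mono[of "Suc n0" n] True x pos by (intro divide_left_mono) auto
    hence "min k1 k2 \<le> 1 - x / l (Suc n)" by (simp add: k1_def min_le_iff_disj)
    hence "min k1 k2 * l (Suc n) \<le> (1 - x / l (Suc n)) * l (Suc n)" using pos[of n] by (intro mult_right_mono) auto
    also have "\<dots> = l (Suc n) - x" using pos[of n] by (simp add: field_simps)
    finally show ?thesis by linarith
  next
    case False
    hence n: "n < n0" using that by simp
    have "min k1 k2 * l (Suc n) \<le> k2 * x"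
      using less[OF n] pos[of n] k2 by (intro mult_mono) (auto simp: x_def)
    also have "\<dots> = x - l n0" using n x by (simp add: k2_def)
    also have "\<dots> \<le> x - l (Suc n)" using mono[of n "n0 - 1"] n by simp
    finally show ?thesis by linarith
  qed
  thus ?thesis using that[of "min k1 k2"] k1 k2 by (simp add: x_def)
qed

text \<open>Treats both alternatives at \<open>r\<close> alike: the limit is 0 if the function is
  analytic there and the residue in case of a simple pole.\<close>

lemma simple_pole_limit:
  assumes "is_continuation r a l \<phi>"
  obtains \<rho> where "((\<lambda>s. \<phi> s * (s - of_real r)) \<longlongrightarrow> \<rho>) (at (of_real r))"
proof -
  have an: "\<phi> analytic_on UNIV - {of_real r}"
    and cases: "\<phi> analytic_on {of_real r} \<or> is_pole \<phi> (of_real r) \<and> zorder \<phi> (of_real r) = -1"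
    using assms by (auto simp: is_continuation_def)
  from cases show ?thesis
  proof
    assume "\<phi> analytic_on {of_real r}"
    hence "isCont \<phi> (of_real r)" by (rule analytic_at_imp_isCont)
    hence "((\<lambda>s. \<phi> s * (s - of_real r)) \<longlongrightarrow> \<phi> (of_real r) * (of_real r - of_real r)) (at (of_real r))"
      by (intro tendsto_intros) (simp add: isCont_def)
    thus ?thesis by (rule that)
  next
    assume pole: "is_pole \<phi> (of_real r) \<and> zorder \<phi> (of_real r) = -1"
    have "\<phi> holomorphic_on UNIV - {of_real r}" using an by (rule analytic_imp_holomorphic)
    from zorder_exist_pole[OF this open_UNIV UNIV_I] pole
    obtain e where e: "e > 0" "zor_poly \<phi> (of_real r) holomorphic_on cball (of_real r) e"
      "\<And>w. w \<in> cball (of_real r) e - {of_real r} \<Longrightarrow> \<phi> w = zor_poly \<phi> (of_real r) w / (w - of_real r)"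
      by auto
    have "continuous_on (cball (of_real r) e) (zor_poly \<phi> (of_real r))"
      using e(2) by (rule holomorphic_on_imp_continuous_on)
    hence "isCont (zor_poly \<phi> (of_real r)) (of_real r)"
      by (rule continuous_on_interior) (use e(1) in simp)
    hence "((\<lambda>w. zor_poly \<phi> (of_real r) w) \<longlongrightarrow> zor_poly \<phi> (of_real r) (of_real r)) (at (of_real r))"
      by (simp add: isCont_def)
    moreover have "eventually (\<lambda>w. zor_poly \<phi> (of_real r) w = \<phi> w * (w - of_real r)) (at (of_real r))"
      using eventually_at_in_open'[OF open_ball, of "of_real r" "of_real r" e] eventually_neq_at_within[of "of_real r" "of_real r" UNIV] e(1)
      by (auto elim!: eventually_elim2 simp: e(3) dist_commute less_imp_le)
    ultimately have "((\<lambda>s. \<phi> s * (s - of_real r)) \<longlongrightarrow> zor_poly \<phi> (of_real r) (of_real r)) (at (of_real r))"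
      by (rule Lim_transform_eventually)
    thus ?thesis by (rule that)
  qed
qed

text \<open>The identities for \<open>X\<close> are given only in two half-planes. Far from the real
  axis there are no singularities, so the identity theorem extends each of them over
  \<open>Im s > T\<close> and \<open>Im s < - T\<close> separately.\<close>

lemma class_A_functional_equation_off_real:
  assumes A: "class_A r a l \<phi> b m \<psi>"
  obtains X T where "0 < T"
    "\<And>s. T < \<bar>Im s\<bar> \<Longrightarrow> X s = Gamma s * \<phi> s"
    "\<And>s. T < \<bar>Im s\<bar> \<Longrightarrow> X s = Gamma (of_real r - s) * \<psi> (of_real r - s)"
    "\<And>\<sigma>1 \<sigma>2 \<epsilon>. \<epsilon> > 0 \<Longrightarrow> \<exists>T. \<forall>s. \<sigma>1 \<le> Re s \<longrightarrow> Re s \<le> \<sigma>2 \<longrightarrow> T \<le> \<bar>Im s\<bar> \<longrightarrow> norm (X s) < \<epsilon>"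
proof -
  have hp: "hecke_pair r a l b m" and \<phi>: "is_continuation r a l \<phi>" and \<psi>: "is_continuation r b m \<psi>"
    using A by (auto simp: class_A_def)
  obtain \<sigma>a where \<sigma>a: "abs_conv_abscissa a l = ereal \<sigma>a" using hp by (auto simp: hecke_pair_def)
  obtain \<sigma>b where \<sigma>b: "abs_conv_abscissa b m = ereal \<sigma>b" using hp by (auto simp: hecke_pair_def)
  from hp obtain X K where
    X1: "\<And>s. ereal (Re s) > abs_conv_abscissa a l \<Longrightarrow> s \<notin> \<int>\<^sub>\<le>\<^sub>0 \<Longrightarrow> X s = Gamma s * gen_dirichlet a l s" and
    X2: "\<And>s. ereal (Re s) < ereal r - abs_conv_abscissa b m \<Longrightarrow> of_real r - s \<notin> \<int>\<^sub>\<le>\<^sub>0 \<Longrightarrow>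
       X s = Gamma (of_real r - s) * gen_dirichlet b m (of_real r - s)" and
    X3: "\<And>\<sigma>1 \<sigma>2 \<epsilon>. \<epsilon> > 0 \<Longrightarrow> \<exists>T. \<forall>s. \<sigma>1 \<le> Re s \<longrightarrow> Re s \<le> \<sigma>2 \<longrightarrow> T \<le> \<bar>Im s\<bar> \<longrightarrow> norm (X s) < \<epsilon>" and
    K: "compact K" "X analytic_on (- K)"
    unfolding hecke_pair_def by blast
  obtain B where B: "\<And>s. s \<in> K \<Longrightarrow> norm s \<le> B" using compact_imp_bounded[OF K(1)] by (auto simp: bounded_iff)
  \<comment> \<open>Beyond this height lies no point of \<open>K\<close>, and, \<open>T\<close>
    being positive, neither \<open>r\<close> nor a pole of a Gamma factor.\<close>
  define T where "T = \<bar>B\<bar> + 1"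
  have T: "T > 0" by (simp add: T_def)
  have X_holo: "X holomorphic_on {s. T < \<bar>Im s\<bar>}"
  proof (rule analytic_imp_holomorphic[OF analytic_on_subset[OF K(2)]])
    show "{s. T < \<bar>Im s\<bar>} \<subseteq> - K"
    proof
      fix s assume "s \<in> {s. T < \<bar>Im s\<bar>}"
      hence "B < norm s" using abs_Im_le_cmod[of s] by (simp add: T_def)
      thus "s \<in> - K" using B[of s] by auto
    qed
  qed
  have nonint: "s \<notin> \<int>\<^sub>\<le>\<^sub>0" if "T < \<bar>Im s\<bar>" for s using that T by (auto elim!: nonpos_Ints_cases)
  have Y_holo: "(\<lambda>s. Gamma s * \<phi> s) holomorphic_on {s. T < \<bar>Im s\<bar>}"
    using \<phi> T unfolding is_continuation_def
    by (intro holomorphic_intros analytic_imp_holomorphic[OF analytic_on_subset]) (use T in \<open>auto dest: nonint\<close>)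
  have "\<psi> holomorphic_on UNIV - {of_real r}" using \<psi> by (auto simp: is_continuation_def intro: analytic_imp_holomorphic)
  moreover have "(\<lambda>s. of_real r - s) holomorphic_on {s. T < \<bar>Im s\<bar>}" by (intro holomorphic_intros)
  ultimately have "(\<psi> \<circ> (\<lambda>s. of_real r - s)) holomorphic_on {s. T < \<bar>Im s\<bar>}"
    using T by (intro holomorphic_on_compose_gen) (auto simp: complex_eq_iff)
  hence W_holo: "(\<lambda>s. Gamma (of_real r - s) * \<psi> (of_real r - s)) holomorphic_on {s. T < \<bar>Im s\<bar>}"
    using T by (intro holomorphic_intros) (auto simp: o_def intro!: nonint)
  \<comment> \<open>The open set \<open>R\<close> only has to meet every horizontal line, so that it
    meets both half-planes; it will be the left or right half-plane of absolute convergence.\<close>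
  have eq: "f s = g s"
    if hol: "f holomorphic_on {s. T < \<bar>Im s\<bar>}" "g holomorphic_on {s. T < \<bar>Im s\<bar>}"
      and R: "open R" "\<And>t. \<exists>s\<in>R. Im s = t" "\<And>s. s \<in> R \<Longrightarrow> T < \<bar>Im s\<bar> \<Longrightarrow> f s = g s"
      and s: "T < \<bar>Im s\<bar>" for f g :: "complex \<Rightarrow> complex" and R s
  proof (cases "Im s > 0")
    case True
    show ?thesis
    proof (rule analytic_continuation_open[of "R \<inter> {s. T < Im s}" "{s. T < Im s}" f g])
      show "R \<inter> {s. T < Im s} \<noteq> {}" using R(2)[of "T + 1"] by force
      show "open (R \<inter> {s. T < Im s})" "open {s. T < Im s}" using R(1) open_halfspace_Im_gt by blast+
      show "connected {s. T < Im s}" by (intro convex_connected convex_halfspace_Im_gt)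
      show "f holomorphic_on {s. T < Im s}" "g holomorphic_on {s. T < Im s}"
        by (rule holomorphic_on_subset[OF hol(1)], force) (rule holomorphic_on_subset[OF hol(2)], force)
    qed (use True s R(3) in auto)
  next
    case False
    show ?thesis
    proof (rule analytic_continuation_open[of "R \<inter> {s. Im s < - T}" "{s. Im s < - T}" f g])
      show "R \<inter> {s. Im s < - T} \<noteq> {}" using R(2)[of "- T - 1"] by force
      show "open (R \<inter> {s. Im s < - T})" "open {s. Im s < - T}" using R(1) open_halfspace_Im_lt by blast+
      show "connected {s. Im s < - T}" by (intro convex_connected convex_halfspace_Im_lt)
      show "f holomorphic_on {s. Im s < - T}" "g holomorphic_on {s. Im s < - T}"
        by (rule holomorphic_on_subset[OF hol(1)], force) (rule holomorphic_on_subset[OF hol(2)], force)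
    qed (use False s R(3) in auto)
  qed
  show ?thesis
  proof (rule that[OF T _ _ X3])
    fix s assume s: "T < \<bar>Im s\<bar>"
    show "X s = Gamma s * \<phi> s"
    proof (rule eq[OF X_holo Y_holo _ _ _ s, of "{s. \<sigma>a < Re s}"])
      show "\<exists>s\<in>{s. \<sigma>a < Re s}. Im s = t" for t by (rule bexI[of _ "Complex (\<sigma>a + 1) t"]) auto
      show "X s = Gamma s * \<phi> s" if "s \<in> {s. \<sigma>a < Re s}" "T < \<bar>Im s\<bar>" for s
        using X1[of s] \<phi> that T nonint[of s] by (auto simp: \<sigma>a is_continuation_def)
    qed (rule open_halfspace_Re_gt)
    show "X s = Gamma (of_real r - s) * \<psi> (of_real r - s)"
    proof (rule eq[OF X_holo W_holo _ _ _ s, of "{s. Re s < r - \<sigma>b}"])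
      show "\<exists>s\<in>{s. Re s < r - \<sigma>b}. Im s = t" for t by (rule bexI[of _ "Complex (r - \<sigma>b - 1) t"]) auto
      show "X s = Gamma (of_real r - s) * \<psi> (of_real r - s)" if "s \<in> {s. Re s < r - \<sigma>b}" "T < \<bar>Im s\<bar>" for s
        using X2[of s] \<psi> that T nonint[of "of_real r - s"] by (auto simp: \<sigma>b is_continuation_def)
    qed (rule open_halfspace_Re_lt)
  qed
qed

text \<open>In this strip both sides are holomorphic, so agreement high up in it suffices, and real
  points on the critical line are reached as well.\<close>

lemma class_A_functional_equation:
  assumes A: "class_A r a l \<phi> b m \<psi>" and s: "0 < Re s" "Re s < r"
  shows "Gamma s * \<phi> s = Gamma (of_real r - s) * \<psi> (of_real r - s)"
proof -
  have \<phi>: "\<phi> holomorphic_on UNIV - {of_real r}" and \<psi>: "\<psi> holomorphic_on UNIV - {of_real r}" and r: "0 < r"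
    using A by (auto simp: class_A_def is_continuation_def hecke_pair_def intro: analytic_imp_holomorphic)
  obtain X T where T: "0 < T" "\<And>s. T < \<bar>Im s\<bar> \<Longrightarrow> X s = Gamma s * \<phi> s"
    "\<And>s. T < \<bar>Im s\<bar> \<Longrightarrow> X s = Gamma (of_real r - s) * \<psi> (of_real r - s)"
    using class_A_functional_equation_off_real[OF A] by metis
  define S where "S = {s. 0 < Re s \<and> Re s < r}"
  have S: "open S" "connected S"
    unfolding S_def by (auto intro: open_vertical_strip convex_connected convex_vertical_strip)
  have nonint: "s \<notin> \<int>\<^sub>\<le>\<^sub>0" if "0 < Re s" for s using that by (auto elim!: nonpos_Ints_cases)
  show ?thesis
  proof (rule analytic_continuation_open[of "S \<inter> {s. T < Im s}" S "\<lambda>s. Gamma s * \<phi> s"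
        "\<lambda>s. Gamma (of_real r - s) * \<psi> (of_real r - s)"])
    show "open (S \<inter> {s. T < Im s})" using S(1) open_halfspace_Im_gt by blast
    have "Complex (r / 2) (T + 1) \<in> S \<inter> {s. T < Im s}" using r by (simp add: S_def)
    thus "S \<inter> {s. T < Im s} \<noteq> {}" by blast
    show "(\<lambda>s. Gamma s * \<phi> s) holomorphic_on S"
      by (intro holomorphic_intros holomorphic_on_subset[OF \<phi>]) (auto simp: S_def dest: nonint)
    have "(\<lambda>s. of_real r - s) holomorphic_on S" by (intro holomorphic_intros)
    hence "(\<psi> \<circ> (\<lambda>s. of_real r - s)) holomorphic_on S"
      by (rule holomorphic_on_compose_gen[OF _ \<psi>]) (auto simp: S_def)
    thus "(\<lambda>s. Gamma (of_real r - s) * \<psi> (of_real r - s)) holomorphic_on S"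
      by (intro holomorphic_intros) (auto simp: S_def o_def intro!: nonint)
    show "s \<in> S" using s by (simp add: S_def)
    show "Gamma s * \<phi> s = Gamma (of_real r - s) * \<psi> (of_real r - s)" if "s \<in> S \<inter> {s. T < Im s}" for s
      using T(2)[of s] T(3)[of s] that T(1) by simp
  qed (use S in auto)
qed

text \<open>Schwarz reflection: the identity is clear for the series far to the right, and the plane
  without the real point \<open>r\<close> is connected and closed under conjugation.\<close>

lemma continuation_cnj:
  assumes \<phi>: "is_continuation r a l \<phi>" and \<psi>: "is_continuation r b m \<psi>" and l: "exponent_seq l"
    and b: "\<And>n. b (Suc n) = cnj (a (Suc n))" and m: "\<And>n. m (Suc n) = l (Suc n)"
    and abs: "abs_conv_abscissa a l = ereal \<sigma>" "abs_conv_abscissa b m = ereal \<sigma>" and s: "s \<noteq> of_real r"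
  shows "\<psi> s = cnj (\<phi> (cnj s))"
proof (rule analytic_continuation_open[of "{s. max \<sigma> r < Re s}" "- {of_real r}" \<psi> "\<lambda>s. cnj (\<phi> (cnj s))"])
  show "connected (- {complex_of_real r})" by (rule connected_punctured_universe) simp
  have "Complex (max \<sigma> r + 1) 0 \<in> {s. max \<sigma> r < Re s}" by (simp add: less_add_one del: max_less_iff_conj)
  thus "{s. max \<sigma> r < Re s} \<noteq> {}" by blast
  show "\<psi> holomorphic_on - {of_real r}"
    using \<psi> by (auto simp: is_continuation_def Compl_eq_Diff_UNIV intro: analytic_imp_holomorphic)
  have "\<phi> holomorphic_on cnj ` (- {of_real r})"
  proof (rule holomorphic_on_subset)
    show "\<phi> holomorphic_on UNIV - {of_real r}" using \<phi> by (auto simp: is_continuation_def intro: analytic_imp_holomorphic)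
  qed (auto simp: complex_eq_iff)
  hence "(cnj \<circ> \<phi> \<circ> cnj) holomorphic_on - {of_real r}"
    by (rule holomorphic_on_compose_cnj_cnj) auto
  thus "(\<lambda>s. cnj (\<phi> (cnj s))) holomorphic_on - {of_real r}" by (simp add: o_def)
  show "\<psi> s = cnj (\<phi> (cnj s))" if "s \<in> {s. max \<sigma> r < Re s}" for s
  proof -
    have s: "\<sigma> < Re s" "\<sigma> < Re (cnj s)" using that by auto
    have "\<psi> s = gen_dirichlet b m s" "\<phi> (cnj s) = gen_dirichlet a l (cnj s)"
      using \<phi> \<psi> s abs by (auto simp: is_continuation_def)
    thus ?thesis using cnj_gen_dirichlet[where a = a and b = b and l = l and m = m and s = s, OF l _ b m] s abs by simp
  qed
  show "open {s. max \<sigma> r < Re s}" by (rule open_halfspace_Re_gt)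
qed (use s in auto)

lemma norm_gen_dirichlet_le:
  assumes l: "exponent_seq l" and sum: "summable (\<lambda>n. norm (a (Suc n)) * l (Suc n) powr (- \<sigma>))"
    and s: "Re s = \<sigma>"
  shows "norm (gen_dirichlet a l s) \<le> (\<Sum>n. norm (a (Suc n)) * l (Suc n) powr (- \<sigma>))"
proof -
  have eq: "norm (a (Suc n) * of_real (l (Suc n)) powr (- s)) = norm (a (Suc n)) * l (Suc n) powr (- \<sigma>)" for n
    using norm_dirichlet_term[OF exponent_seq_pos[OF l]] s by simp
  have "summable (\<lambda>n. norm (a (Suc n) * of_real (l (Suc n)) powr (- s)))" unfolding eq by (rule sum)
  from summable_norm[OF this] show ?thesis unfolding gen_dirichlet_def eq .
qed

text \<open>On the right edge the series is bounded and Gamma decays; on the left edge the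
  functional equation exchanges it for the dual series at the same abscissa \<open>c\<close>.
  Phragmen-Lindelof fills the strip.\<close>

lemma class_A_decay:
  assumes A: "class_A r a l \<phi> b m \<psi>"
    and \<sigma>a: "abs_conv_abscissa a l < ereal (real N + 1/2)" and \<sigma>b: "abs_conv_abscissa b m < ereal (real N + 1/2)"
    and rN: "r < real N + 1/2"
  obtains T where "\<And>\<eta>. 0 \<le> \<eta> \<Longrightarrow> \<eta> < pi / 2 \<Longrightarrow> \<exists>K. \<forall>s. r - (real N + 1/2) \<le> Re s \<longrightarrow> Re s \<le> real N + 1/2 \<longrightarrow>
      T \<le> \<bar>Im s\<bar> \<longrightarrow> norm (Gamma s * \<phi> s) \<le> K * exp (- \<eta> * \<bar>Im s\<bar>)"
proof -
  define c where "c = real N + 1/2"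
  have l: "exponent_seq l" and m: "exponent_seq m" and r: "0 < r"
    and \<phi>: "is_continuation r a l \<phi>" and \<psi>: "is_continuation r b m \<psi>"
    using A by (auto simp: class_A_def hecke_pair_def)
  obtain X T0 where X: "0 < T0" "\<And>s. T0 < \<bar>Im s\<bar> \<Longrightarrow> X s = Gamma s * \<phi> s"
    "\<And>s. T0 < \<bar>Im s\<bar> \<Longrightarrow> X s = Gamma (of_real r - s) * \<psi> (of_real r - s)"
    and X3: "\<And>\<sigma>1 \<sigma>2 \<epsilon>. \<epsilon> > 0 \<Longrightarrow> \<exists>T. \<forall>s. \<sigma>1 \<le> Re s \<longrightarrow> Re s \<le> \<sigma>2 \<longrightarrow> T \<le> \<bar>Im s\<bar> \<longrightarrow> norm (X s) < \<epsilon>"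
    using class_A_functional_equation_off_real[OF A] by metis
  \<comment> \<open>The uniform limit 0 of \<open>X\<close> supplies the a priori bound without
    which the Phragmen-Lindelof principle could not start.\<close>
  obtain T1 where T1: "\<And>s. r - c \<le> Re s \<Longrightarrow> Re s \<le> c \<Longrightarrow> T1 \<le> \<bar>Im s\<bar> \<Longrightarrow> norm (X s) < 1"
    using X3[of 1 "r - c" c] by auto
  define T where "T = max T0 T1 + 1"
  have T: "0 < T" "T0 < T" "T1 \<le> T" using X(1) by (auto simp: T_def)
  define Sa where "Sa = (\<Sum>n. norm (a (Suc n)) * l (Suc n) powr (- c))"
  define Sb where "Sb = (\<Sum>n. norm (b (Suc n)) * m (Suc n) powr (- c))"
  have suma: "summable (\<lambda>n. norm (a (Suc n)) * l (Suc n) powr (- c))"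
    using dirichlet_abs_summable[OF l, of a c] \<sigma>a by (simp add: c_def)
  have sumb: "summable (\<lambda>n. norm (b (Suc n)) * m (Suc n) powr (- c))"
    using dirichlet_abs_summable[OF m, of b c] \<sigma>b by (simp add: c_def)
  have S_nonneg: "0 \<le> Sa" "0 \<le> Sb" unfolding Sa_def Sb_def by (auto intro!: suminf_nonneg suma sumb)
  have \<phi>_le: "norm (\<phi> (Complex c t)) \<le> Sa" for t
  proof -
    have "\<phi> (Complex c t) = gen_dirichlet a l (Complex c t)" using \<phi> \<sigma>a by (simp add: is_continuation_def c_def)
    thus ?thesis using norm_gen_dirichlet_le[OF l suma] by (simp add: Sa_def)
  qed
  have \<psi>_le: "norm (\<psi> (Complex c t)) \<le> Sb" for t
  proof -
    have "\<psi> (Complex c t) = gen_dirichlet b m (Complex c t)" using \<psi> \<sigma>b by (simp add: is_continuation_def c_def)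
    thus ?thesis using norm_gen_dirichlet_le[OF m sumb] by (simp add: Sb_def)
  qed
  have holo: "(\<lambda>s. Gamma s * \<phi> s) holomorphic_on {s. Im s \<noteq> 0}"
    using \<phi> by (intro holomorphic_intros Gamma_holomorphic_off_real analytic_imp_holomorphic[OF analytic_on_subset[of _ "UNIV - {of_real r}"]])
      (auto simp: is_continuation_def)
  have "\<exists>K. \<forall>s. r - c \<le> Re s \<longrightarrow> Re s \<le> c \<longrightarrow> T \<le> \<bar>Im s\<bar> \<longrightarrow> norm (Gamma s * \<phi> s) \<le> K * exp (- \<eta> * \<bar>Im s\<bar>)"
    if \<eta>: "0 \<le> \<eta>" "\<eta> < pi / 2" for \<eta>
  proof -
    obtain C where C: "0 \<le> C" "\<And>t. norm (Gamma (Complex c t)) \<le> C * exp (- \<eta> * \<bar>t\<bar>)"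
      unfolding c_def using norm_Gamma_half_integer_exp[OF \<eta>(2)] by blast
    have edge: "norm (Gamma (Complex c t)) * x \<le> C * (Sa + Sb) * exp (- \<eta> * \<bar>t\<bar>)" if "0 \<le> x" "x \<le> Sa + Sb" for t x
    proof -
      have "norm (Gamma (Complex c t)) * x \<le> (C * exp (- \<eta> * \<bar>t\<bar>)) * (Sa + Sb)"
        using that C by (intro mult_mono) auto
      thus ?thesis by (simp add: mult_ac)
    qed
    obtain K where "\<And>s. r - c \<le> Re s \<Longrightarrow> Re s \<le> c \<Longrightarrow> T \<le> \<bar>Im s\<bar> \<Longrightarrow> norm (Gamma s * \<phi> s) \<le> K * exp (- \<eta> * \<bar>Im s\<bar>)"
    proof (rule phragmen_lindelof_strip[OF holo T(1) \<eta>(1), of "r - c" c 1 "C * (Sa + Sb)"])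
      show "r - c \<le> c" using rN r by (simp add: c_def)
      show "norm (Gamma s * \<phi> s) \<le> 1" if "r - c \<le> Re s" "Re s \<le> c" "T \<le> \<bar>Im s\<bar>" for s
        using T1[of s] X(2)[of s] that T by simp
      show "norm (Gamma (Complex c t) * \<phi> (Complex c t)) \<le> C * (Sa + Sb) * exp (- \<eta> * \<bar>t\<bar>)" for t
        unfolding norm_mult using \<phi>_le[of t] S_nonneg by (intro edge) auto
      show "norm (Gamma (Complex (r - c) t) * \<phi> (Complex (r - c) t)) \<le> C * (Sa + Sb) * exp (- \<eta> * \<bar>t\<bar>)" if "T \<le> \<bar>t\<bar>" for t
      proof -
        have "of_real r - Complex (r - c) t = Complex c (- t)" by (simp add: complex_eq_iff)
        hence "Gamma (Complex (r - c) t) * \<phi> (Complex (r - c) t) = Gamma (Complex c (- t)) * \<psi> (Complex c (- t))"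
          using X(2,3)[of "Complex (r - c) t"] that T by simp
        thus ?thesis using edge[of "norm (\<psi> (Complex c (- t)))" "- t"] \<psi>_le[of "- t"] S_nonneg by (simp add: norm_mult)
      qed
    qed blast
    thus ?thesis by blast
  qed
  thus ?thesis using that[of T] unfolding c_def by blast
qed

theorem corollary4p5:
  fixes r :: real
    and c \<tau> lam mu :: "nat \<Rightarrow> real"
    and a b :: "nat \<Rightarrow> complex"
    and \<phi> \<psi> :: "complex \<Rightarrow> complex"
  assumes "\<And>j. j \<ge> 1 \<Longrightarrow> c j \<noteq> 0"
    and "summable (\<lambda>j. \<bar>c (Suc j)\<bar>)"
    and "bounded (\<tau> ` {1..})"
    and "inj_on \<tau> {1..}"
    and "class_A r a lam \<phi> b mu \<psi>"
    and "\<And>n. n \<ge> 1 \<Longrightarrow> b n = cnj (a n)"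
    and "\<And>n. n \<ge> 1 \<Longrightarrow> lam n = mu n"
    and "abs_conv_abscissa a lam < ereal (min 1 r + 1 / 2 * max 1 r)"
    and "(\<lambda>\<epsilon>. Theta a lam (exp (\<i> * of_real (pi / 2 - \<epsilon>))))
           \<in> o[at_right 0](\<lambda>\<epsilon>. complex_of_real (\<epsilon> powr (- ((r + 1) / 2))))
         \<or> abs_conv_abscissa a lam < ereal ((r + 1) / 2)"
  shows "infinite {s. Re s = r / 2 \<and> F_shift c \<tau> \<phi> s = 0}"
proof -
  note A = assms(5)
  have lam: "exponent_seq lam" and r: "0 < r" and \<phi>: "is_continuation r a lam \<phi>" and \<psi>: "is_continuation r b mu \<psi>"
    and a_nz: "\<exists>n\<ge>1. a n \<noteq> 0" and fin: "\<bar>abs_conv_abscissa a lam\<bar> \<noteq> \<infinity>"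
    using A by (auto simp: class_A_def hecke_pair_def)
  have b: "b (Suc n) = cnj (a (Suc n))" and mu: "mu (Suc n) = lam (Suc n)" for n using assms(6,7) by auto
  obtain \<sigma>0 where \<sigma>0: "abs_conv_abscissa a lam = ereal \<sigma>0" using fin by auto
  have lam_pos: "0 < lam (Suc n)" for n by (rule exponent_seq_pos[OF lam])
  \<comment> \<open>Conjugation does not change the moduli of the coefficients.\<close>
  have "abs_conv_abscissa b mu = abs_conv_abscissa a lam"
    unfolding abs_conv_abscissa_def by (simp only: b mu norm_mult complex_mod_cnj)
  hence \<sigma>0': "abs_conv_abscissa b mu = ereal \<sigma>0" using \<sigma>0 by simp
  \<comment> \<open>Puts the line of abscissa \<open>N + 1/2\<close> to the right of the pole at
    \<open>r\<close> and into the half-plane of absolute convergence of both series.\<close>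
  obtain N where N: "max \<sigma>0 r < real N" using reals_Archimedean2 by blast
  obtain M where M: "\<And>j. \<bar>\<tau> (Suc j)\<bar> \<le> M" using assms(3) unfolding bounded_real by auto
  obtain T where T: "\<And>\<eta>. 0 \<le> \<eta> \<Longrightarrow> \<eta> < pi / 2 \<Longrightarrow> \<exists>K. \<forall>s. r - (real N + 1/2) \<le> Re s \<longrightarrow> Re s \<le> real N + 1/2 \<longrightarrow>
      T \<le> \<bar>Im s\<bar> \<longrightarrow> norm (Gamma s * \<phi> s) \<le> K * exp (- \<eta> * \<bar>Im s\<bar>)"
  proof (rule class_A_decay[OF A, of N])
    show "abs_conv_abscissa a lam < ereal (real N + 1/2)" "abs_conv_abscissa b mu < ereal (real N + 1/2)"
      "r < real N + 1/2" using N by (auto simp: \<sigma>0 \<sigma>0')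
  qed blast
  obtain \<rho>0 where \<rho>0: "((\<lambda>s. \<phi> s * (s - of_real r)) \<longlongrightarrow> \<rho>0) (at (of_real r))"
    using simple_pole_limit[OF \<phi>] by blast
  have pos_nonint: "s \<notin> \<int>\<^sub>\<le>\<^sub>0" if "0 < Re s" for s using that by (auto elim!: nonpos_Ints_cases)
  \<comment> \<open>The residue of the completed series at \<open>r\<close> is that of \<phi> times
    \<open>Gamma r\<close>, because Gamma is regular at the positive point \<open>r\<close>.\<close>
  interpret completed_shift_sum "\<lambda>n. a (Suc n)" "\<lambda>n. lam (Suc n)" "\<lambda>s. Gamma s * \<phi> s" r T
    "Gamma (of_real r) * \<rho>0" N "\<lambda>j. c (Suc j)" "\<lambda>j. \<tau> (Suc j)" M
  proof unfold_locales
    show "summable (\<lambda>n. norm (a (Suc n)) * lam (Suc n) powr (- \<sigma>))" if "real N + 1/2 \<le> \<sigma>" for \<sigma>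
      using that N by (intro dirichlet_abs_summable[OF lam]) (simp add: \<sigma>0)
    show "r < real N + 1/2" using N by simp
    show "Gamma (Complex (real N + 1/2) t) * \<phi> (Complex (real N + 1/2) t) =
      Gamma (Complex (real N + 1/2) t) * (\<Sum>n. a (Suc n) * exp (- Complex (real N + 1/2) t * of_real (ln (lam (Suc n)))))" for t
    proof -
      have "\<phi> (Complex (real N + 1/2) t) = gen_dirichlet a lam (Complex (real N + 1/2) t)"
        using \<phi> N \<sigma>0 by (simp add: is_continuation_def)
      also have "\<dots> = (\<Sum>n. a (Suc n) * exp (- Complex (real N + 1/2) t * of_real (ln (lam (Suc n)))))"
        unfolding gen_dirichlet_def powr_def using lam_pos by (simp add: Ln_of_real less_imp_neq[symmetric])
      finally show ?thesis by simp
    qed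
    have "\<phi> holomorphic_on {s. 0 < Re s} - {of_real r}"
      using \<phi> by (intro analytic_imp_holomorphic[OF analytic_on_subset[of _ "UNIV - {of_real r}"]]) (auto simp: is_continuation_def)
    thus "(\<lambda>s. Gamma s * \<phi> s) holomorphic_on {s. 0 < Re s} - {of_real r}"
      by (intro holomorphic_intros) (auto dest: pos_nonint)
    have "isCont Gamma (complex_of_real r)" using r by (intro isCont_Gamma continuous_ident pos_nonint) simp
    hence "((\<lambda>s. Gamma s * (\<phi> s * (s - of_real r))) \<longlongrightarrow> Gamma (of_real r) * \<rho>0) (at (of_real r))"
      unfolding isCont_def by (rule tendsto_mult[OF _ \<rho>0])
    thus "((\<lambda>s. Gamma s * \<phi> s * (s - of_real r)) \<longlongrightarrow> Gamma (of_real r) * \<rho>0) (at (of_real r))"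
      by (simp add: mult.assoc)
    show "\<exists>K. \<forall>s. r / 2 \<le> Re s \<longrightarrow> Re s \<le> real N + 1/2 \<longrightarrow> T \<le> \<bar>Im s\<bar> \<longrightarrow>
        norm (Gamma s * \<phi> s) \<le> K * exp (- \<eta> * \<bar>Im s\<bar>)" if \<eta>: "0 \<le> \<eta>" "\<eta> < pi / 2" for \<eta>
    proof -
      have "r - (real N + 1/2) \<le> r / 2" using N r by linarith
      thus ?thesis using T[OF \<eta>] by (meson order_trans)
    qed
  qed (use r lam_pos assms(2) M in auto)
  \<comment> \<open>On this line the reflected point \<open>r - s\<close> is the conjugate of
    \<open>s\<close>, so the functional equation says that \<open>Z t\<close> equals its own
    conjugate.\<close>
  have Z_real: "Im (Z t) = 0" for t
  proof -
    let ?s = "Complex (r / 2) t"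
    have c: "of_real r - ?s = cnj ?s" by (simp add: complex_eq_iff)
    have "\<psi> (cnj ?s) = cnj (\<phi> ?s)"
      using continuation_cnj[OF \<phi> \<psi> lam b mu \<sigma>0 \<sigma>0', of "cnj ?s"] r by (simp add: complex_eq_iff)
    hence "Z t = cnj (Z t)"
      unfolding Z_def using class_A_functional_equation[OF A, of ?s] r by (simp add: c cnj_Gamma)
    thus ?thesis by (simp add: complex_eq_iff)
  qed
  have G_real: "Im (G t) = 0" for t
  proof -
    have "summable (\<lambda>j. of_real (c (Suc j)) * Z (t + \<tau> (Suc j)))"
      by (rule summable_norm_cancel[OF G_terms_summable])
    from bounded_linear.suminf[OF bounded_linear_Im this] show ?thesis
      unfolding G_def using Z_real by simp
  qed
  have theta_eq: "theta (\<i> * of_real (pi / 2 - \<epsilon>)) = Theta a lam (exp (\<i> * of_real (pi / 2 - \<epsilon>)))" for \<epsilon>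
    by (simp add: theta_def Theta_def)
  have small: "((\<lambda>\<epsilon>. norm (theta (\<i> * of_real (pi / 2 - \<epsilon>))) * \<epsilon> powr ((r + 1) / 2)) \<longlongrightarrow> 0) (at_right 0)"
    using assms(9)
  proof
    assume "(\<lambda>\<epsilon>. Theta a lam (exp (\<i> * of_real (pi / 2 - \<epsilon>))))
           \<in> o[at_right 0](\<lambda>\<epsilon>. complex_of_real (\<epsilon> powr (- ((r + 1) / 2))))"
    from tendsto_norm_zero[OF smalloD_tendsto[OF this]]
    have "((\<lambda>\<epsilon>. norm (theta (\<i> * of_real (pi / 2 - \<epsilon>))) / \<epsilon> powr (- ((r + 1) / 2))) \<longlongrightarrow> 0) (at_right 0)"
      unfolding theta_eq by (simp add: norm_divide)
    moreover have "x / \<epsilon> powr (- y) = x * \<epsilon> powr y" for x \<epsilon> y :: real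
      by (simp add: powr_minus divide_inverse)
    ultimately show ?thesis by (simp only:)
  next
    assume "abs_conv_abscissa a lam < ereal ((r + 1) / 2)"
    \<comment> \<open>The exponent passed to \<open>theta_small_of_summable\<close> must be
      positive, while the abscissa may be negative.\<close>
    hence "max 0 \<sigma>0 < (r + 1) / 2" using r by (simp add: \<sigma>0)
    then obtain \<sigma> where \<sigma>: "max 0 \<sigma>0 < \<sigma>" "\<sigma> < (r + 1) / 2" using dense by blast
    hence "summable (\<lambda>n. norm (a (Suc n)) * lam (Suc n) powr (- \<sigma>))"
      by (intro dirichlet_abs_summable[OF lam]) (simp add: \<sigma>0)
    thus ?thesis using \<sigma> by (intro theta_small_of_summable) auto
  qed
  obtain n0 where n0: "a (Suc n0) \<noteq> 0" using a_nz by (metis Suc_le_D One_nat_def)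
  obtain k where k: "0 < k" "\<And>n. n \<noteq> n0 \<Longrightarrow> k * lam (Suc n) \<le> \<bar>lam (Suc n) - lam (Suc n0)\<bar>"
    using exponent_seq_separated[OF lam] by blast
  have inj: "inj (\<lambda>j. \<tau> (Suc j))" using assms(4) by (auto simp: inj_on_def)
  have "infinite {t. G t = 0}"
    by (rule infinite_zeros[OF inj _ n0 k G_real small, of 0]) (use assms(1) in auto)
  moreover have "inj_on (Complex (r / 2)) {t. G t = 0}" by (auto simp: inj_on_def)
  ultimately have "infinite (Complex (r / 2) ` {t. G t = 0})" by (simp add: finite_image_iff)
  moreover have "Complex (r / 2) ` {t. G t = 0} \<subseteq> {s. Re s = r / 2 \<and> F_shift c \<tau> \<phi> s = 0}"
  proof -
    have "Complex (r / 2) t + \<i> * of_real x = Complex (r / 2) (t + x)" for t x by (simp add: complex_eq_iff)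
    hence "F_shift c \<tau> \<phi> (Complex (r / 2) t) = G t" for t
      by (simp add: F_shift_def G_def Z_def mult.assoc)
    thus ?thesis by auto
  qed
  ultimately show ?thesis using infinite_super by blast
qed

end
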